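(* Let $(w,\lambda,1)$ be a non-degenerate, non-periodic band datum of multiplicity one, with $w\in\mathbb Z^{3\tau}$ and $\lambda\in\mathbb C^*$, and let $w'=w+\varepsilon(w)$. Then the maximal Cohen-Macaulay $A$-module $M(w,\lambda,1)$, where $A=\mathbb C[[x,y,z]]/(xyz)$, corresponds under Eisenbud's theorem to the matrix factorization of $xyz$ having $\varphi(w',\lambda,1)$ as one factor. That is, there is a $3\tau\times 3\tau$ matrix $\psi$ over $S=\mathbb C[[x,y,z]]$ with $\varphi(w',\lambda,1)\,\psi=\psi\,\varphi(w',\lambda,1)=xyz\cdot I_{3\tau}$ (namely $\psi=\frac{xyz}{\det\varphi}\operatorname{adj}\varphi$), and $M(w,\lambda,1)\cong\operatorname{coker}\big(\underline{\varphi}(w',\lambda,1):A^{3\tau}\to A^{3\tau}\big)$ as $A$-modules, where $\underline\varphi$ denotes $\varphi$ reduced modulo $xyz$.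
   Context: Words. A word is $w=(w_1,\dots,w_{3\tau})\in\mathbb Z^{3\tau}$, $\tau\ge1$, with indices in $\mathbb Z/3\tau$ (cyclic); write $l_i=w_{3i-2}$, $m_i=w_{3i-1}$, $n_i=w_{3i}$ for $i\in\mathbb Z/\tau$. Its $k$-shift $w^{(k)}$ is the cyclic shift by $3k$ entries. $w$ is periodic if $w^{(t)}=w$ for some positive divisor $t<\tau$ of $\tau$. A band datum of multiplicity one is $(w,\lambda,1)$ with $w$ a word and $\lambda\in\mathbb C^*$; it is degenerate if $w=(0,0,0)$ and $\lambda=1$. Conversion. The sign word $\delta=\delta(w)\in\{0,1\}^{3\tau}$: $\delta_j=0$ if $w_j<0$, or if $w_j=0$ and at least one of the (cyclically) first non-zero entries adjacent, on either side, to the maximal string of $0$s containing $w_j$ exists and is negative; $\delta_j=1$ otherwise. The correction word is $\varepsilon_j=-1+\delta_{j-1}+\delta_j+\delta_{j+1}$, and $w'=w+\varepsilon(w)$. Matrix. Put $\chi_{3i-2}=x,\ \chi_{3i-1}=y,\ \chi_{3i}=z$ (indices mod $3\tau$), with the convention that $\chi_j^a=0$ if $a<0$. Then $\varphi=\varphi(w',\lambda,1)$ is the $3\tau\times3\tau$ matrix over $S$ with $\varphi_{jj}=\chi_{j-1}$ for all $j$; $\varphi_{j-1,j}=-\chi_j^{w'_j-1}$ and $\varphi_{j,j-1}=-\chi_j^{-w'_j}$ for $2\le j\le3\tau$; $\varphi_{3\tau,1}=-\lambda x^{w'_1-1}$; $\varphi_{1,3\tau}=-\lambda^{-1}x^{-w'_1}$;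 all other entries $0$. Module. For $a\in\mathbb Z$ let $a^+=\max\{0,a\}$, $a^-=\max\{0,-a\}$. $\tilde M(w,\lambda,1)$ is the $A$-submodule of $A^\tau$ (basis $e_i$, $i\in\mathbb Z/\tau$) generated, for all $i$, by $x^2y^2e_i$, $y^2z^2e_i$, $z^2x^2e_i$, $(xy^{m_i^++2}+y^{m_i^-+2}z)e_i$, $(yz^{n_i^++2}+z^{n_i^-+2}x)e_i$, and $x^{l_i^-+2}y\,e_i+c_i\,zx^{l_i^++2}e_{i-1}$, where $c_1=\lambda$ and $c_i=1$ for $i\neq1$. $M(w,\lambda,1)=\tilde M(w,\lambda,1)^\dagger$ is its Macaulayfication, where $N^\dagger=\operatorname{Hom}_A(\operatorname{Hom}_A(N,K_A),K_A)$ and $K_A$ is the canonical module of $A$ (here $K_A\cong A$). Eisenbud's theorem: $(\varphi,\psi)\mapsto\operatorname{coker}\underline\varphi$ is an equivalence from the homotopy category of matrix factorizations of $xyz$ over $S$ to the stable category of maximal Cohen-Macaulay $A$-modules. *)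

theory Defs
  imports
    "HOL-Computational_Algebra.Formal_Power_Series"
    "HOL-Algebra.AbelCoset"
    "Jordan_Normal_Form.VS_Connect"
begin

section \<open>The rings \<open>S = \<complex>[[x,y,z]]\<close> and \<open>A = S/(xyz)\<close>\<close>

text \<open>\<open>\<complex>[[x,y,z]]\<close> is rendered as the iterated power series ring \<open>\<complex>[[x]][[y]][[z]]\<close>.\<close>

type_synonym pser = "complex fps fps fps"

definition constS :: "complex \<Rightarrow> pser" where
  "constS c = fps_const (fps_const (fps_const c))"

definition xS :: pser where "xS = fps_const (fps_const fps_X)"
definition yS :: pser where "yS = fps_const fps_X"
definition zS :: pser where "zS = fps_X"

lemma dvd_diff_swap: "a dvd x - y \<Longrightarrow> a dvd y - x" for a :: pser
  using dvd_minus_iff[of a "x - y"] by simp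

quotient_type cusp = pser / "\<lambda>a b. xS * yS * zS dvd a - b"
  morphisms rep_cusp toA
proof (rule equivpI)
  show "reflp (\<lambda>a b. xS * yS * zS dvd a - b)"
    by (rule reflpI) simp
  show "symp (\<lambda>a b. xS * yS * zS dvd a - b)"
    by (rule sympI) (rule dvd_diff_swap)
  show "transp (\<lambda>a b. xS * yS * zS dvd a - b)"
    by (rule transpI) (drule (1) dvd_add, simp)
qed

lemma not_xyz_dvd_1: "\<not> xS * yS * zS dvd 1"
proof
  assume "xS * yS * zS dvd 1"
  then have "zS dvd (1 :: pser)" by (rule dvd_mult_right)
  then obtain k where "1 = zS * k" by (auto elim: dvdE)
  then have "fps_nth (1 :: pser) 0 = fps_nth (zS * k) 0" by simp
  then show False by (simp add: zS_def)
qed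

instantiation cusp :: comm_ring_1
begin

lift_definition zero_cusp :: cusp is 0 .
lift_definition one_cusp :: cusp is 1 .
lift_definition plus_cusp :: "cusp \<Rightarrow> cusp \<Rightarrow> cusp" is "(+)"
  by (drule (1) dvd_add) (simp add: algebra_simps)
lift_definition uminus_cusp :: "cusp \<Rightarrow> cusp" is uminus
  by (drule dvd_diff_swap) simp
lift_definition minus_cusp :: "cusp \<Rightarrow> cusp \<Rightarrow> cusp" is "(-)"
  by (drule (1) dvd_diff) (simp add: algebra_simps)
lift_definition times_cusp :: "cusp \<Rightarrow> cusp \<Rightarrow> cusp" is "(*)"
proof -
  fix a b c d :: pser
  assume "xS * yS * zS dvd a - b" "xS * yS * zS dvd c - d"
  then have "xS * yS * zS dvd (a - b) * c + b * (c - d)"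
    by (intro dvd_add dvd_mult2 dvd_mult) auto
  then show "xS * yS * zS dvd a * c - b * d" by (simp add: algebra_simps)
qed

instance
proof
  show "(0 :: cusp) \<noteq> 1"
    by transfer (use not_xyz_dvd_1 dvd_diff_swap[of _ 0 1] in auto)
qed (transfer; simp add: algebra_simps; fail)+

end


section \<open>Modules\<close>

definition hom_module ::
  "('a, 'r) ring_scheme \<Rightarrow> ('a, 'b, 'm) module_scheme \<Rightarrow> ('a, 'c, 'n) module_scheme
     \<Rightarrow> ('a, 'b \<Rightarrow> 'c) module" where
  "hom_module R M N = \<lparr>
     carrier = module_hom R M N \<inter> extensional (carrier M),
     mult = undefined,
     one = undefined,
     zero = (\<lambda>v\<in>carrier M. \<zero>\<^bsub>N\<^esub>),
     add = (\<lambda>f g. \<lambda>v\<in>carrier M. f v \<oplus>\<^bsub>N\<^esub> g v),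
     smult = (\<lambda>a f. \<lambda>v\<in>carrier M. a \<odot>\<^bsub>N\<^esub> f v)\<rparr>"

definition quot_module :: "('a, 'b, 'm) module_scheme \<Rightarrow> 'b set \<Rightarrow> ('a, 'b set) module" where
  "quot_module M N = \<lparr>
     carrier = a_rcosets\<^bsub>M\<^esub> N,
     mult = undefined,
     one = undefined,
     zero = N,
     add = set_add M,
     smult = (\<lambda>a C. \<Union>v\<in>C. N +>\<^bsub>M\<^esub> (a \<odot>\<^bsub>M\<^esub> v))\<rparr>"

definition module_isomorphic ::
  "('a, 'r) ring_scheme \<Rightarrow> ('a, 'b, 'm) module_scheme \<Rightarrow> ('a, 'c, 'n) module_scheme \<Rightarrow> bool" where
  "module_isomorphic R M N \<longleftrightarrow>
     (\<exists>f \<in> module_hom R M N. bij_betw f (carrier M) (carrier N))"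

text \<open>The canonical module \<open>K\<^sub>A\<close>: as \<open>A\<close> is Gorenstein, it is \<open>A\<close> as a module over itself.\<close>

definition canonical_module :: "(cusp, cusp) module" where
  "canonical_module = \<lparr>carrier = UNIV, mult = undefined, one = undefined,
     zero = 0, add = (+), smult = (*)\<rparr>"

definition macaulayfication ::
  "(cusp, 'b, 'm) module_scheme \<Rightarrow> (cusp, ('b \<Rightarrow> cusp) \<Rightarrow> cusp) module" where
  "macaulayfication N =
     hom_module class_ring (hom_module class_ring N canonical_module) canonical_module"

text \<open>Cokernel of \<open>A\<^sup>n \<rightarrow> A\<^sup>m\<close>, \<open>v \<mapsto> \<Phi> v\<close>, for an \<open>m \<times> n\<close> matrix \<open>\<Phi>\<close>.\<close>

definition coker :: "'a :: comm_ring_1 mat \<Rightarrow> ('a, 'a vec set) module" where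
  "coker \<Phi> = quot_module (module_vec TYPE('a) (dim_row \<Phi>))
     ((\<lambda>v. \<Phi> *\<^sub>v v) ` carrier_vec (dim_col \<Phi>))"


section \<open>Words\<close>

text \<open>A word \<open>(w\<^sub>1, \<dots>, w\<^bsub>3\<tau>\<^esub>)\<close> is an \<open>int list\<close> of length \<open>3\<tau>\<close>;
  \<open>ent w j\<close> is \<open>w\<^sub>j\<close>, indexed cyclically and starting from \<open>1\<close>.\<close>

definition ent :: "int list \<Rightarrow> int \<Rightarrow> int" where
  "ent w j = w ! nat ((j - 1) mod int (length w))"

definition periodic_word :: "int list \<Rightarrow> bool" where
  "periodic_word w \<longleftrightarrow>
     (\<exists>t. 0 < t \<and> t < length w div 3 \<and> t dvd length w div 3 \<and> rotate (3 * t) w = w)"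

definition degenerate :: "int list \<Rightarrow> complex \<Rightarrow> bool" where
  "degenerate w lam \<longleftrightarrow> w = [0, 0, 0] \<and> lam = 1"

text \<open>For \<open>w\<^sub>j = 0\<close>, walking from \<open>j\<close> through zeros to the first non-zero entry
  on either side yields the entries adjacent to the maximal string of zeros containing \<open>w\<^sub>j\<close>.\<close>

definition sign_word :: "int list \<Rightarrow> int \<Rightarrow> int" where
  "sign_word w j =
     (if ent w j < 0 \<or>
         ent w j = 0 \<and>
           ((\<exists>k>0. ent w (j + k) < 0 \<and> (\<forall>m. 0 < m \<and> m < k \<longrightarrow> ent w (j + m) = 0)) \<or>
            (\<exists>k>0. ent w (j - k) < 0 \<and> (\<forall>m. 0 < m \<and> m < k \<longrightarrow> ent w (j - m) = 0)))
      then 0 else 1)"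

definition correction :: "int list \<Rightarrow> int \<Rightarrow> int" where
  "correction w j = - 1 + sign_word w (j - 1) + sign_word w j + sign_word w (j + 1)"

definition convert_word :: "int list \<Rightarrow> int list" where
  "convert_word w = map (\<lambda>j. ent w j + correction w j) [1..int (length w)]"


section \<open>The matrix \<open>\<phi>(w', \<lambda>, 1)\<close>\<close>

definition chi :: "int \<Rightarrow> pser" where
  "chi j = (if j mod 3 = 1 then xS else if j mod 3 = 2 then yS else zS)"

definition chi_pow :: "int \<Rightarrow> int \<Rightarrow> pser" where
  "chi_pow j a = (if a < 0 then 0 else chi j ^ nat a)"

definition phi_entry :: "int list \<Rightarrow> complex \<Rightarrow> int \<Rightarrow> int \<Rightarrow> pser" where
  "phi_entry w lam i j =
     (if i = j then chi (j - 1)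
      else if i = j - 1 then - chi_pow j (ent w j - 1)
      else if j = i - 1 then - chi_pow i (- ent w i)
      else if i = int (length w) \<and> j = 1 then - constS lam * chi_pow 1 (ent w 1 - 1)
      else if i = 1 \<and> j = int (length w) then - constS (inverse lam) * chi_pow 1 (- ent w 1)
      else 0)"

text \<open>Matrices are indexed from \<open>0\<close>, but \<^const>\<open>phi_entry\<close> from \<open>1\<close>.\<close>

definition phi :: "int list \<Rightarrow> complex \<Rightarrow> pser mat" where
  "phi w lam = mat (length w) (length w) (\<lambda>(r, s). phi_entry w lam (int r + 1) (int s + 1))"


section \<open>The module \<open>M(w, \<lambda>, 1)\<close>\<close>

definition pos_part :: "int \<Rightarrow> nat" where "pos_part a = nat (max 0 a)"
definition neg_part :: "int \<Rightarrow> nat" where "neg_part a = nat (max 0 (- a))"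

definition xA :: cusp where "xA = toA xS"
definition yA :: cusp where "yA = toA yS"
definition zA :: cusp where "zA = toA zS"

text \<open>The basis vector \<open>e\<^sub>i\<close> of \<open>A\<^sup>\<tau>\<close>, with \<open>i\<close> taken modulo \<open>\<tau>\<close>.\<close>

definition basis_vec :: "nat \<Rightarrow> int \<Rightarrow> cusp vec" where
  "basis_vec \<tau> i = unit_vec \<tau> (nat ((i - 1) mod int \<tau>))"

definition generators :: "int list \<Rightarrow> complex \<Rightarrow> cusp vec set" where
  "generators w lam = (let \<tau> = length w div 3; e = basis_vec \<tau> in
     \<Union>i\<in>{1..int \<tau>}.
       let l = ent w (3 * i - 2); m = ent w (3 * i - 1); n = ent w (3 * i);
           c = (if i = 1 then toA (constS lam) else 1)
       in {(xA^2 * yA^2) \<cdot>\<^sub>v e i,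
           (yA^2 * zA^2) \<cdot>\<^sub>v e i,
           (zA^2 * xA^2) \<cdot>\<^sub>v e i,
           (xA * yA ^ (pos_part m + 2) + yA ^ (neg_part m + 2) * zA) \<cdot>\<^sub>v e i,
           (yA * zA ^ (pos_part n + 2) + zA ^ (neg_part n + 2) * xA) \<cdot>\<^sub>v e i,
           (xA ^ (neg_part l + 2) * yA) \<cdot>\<^sub>v e i +
             (c * zA * xA ^ (pos_part l + 2)) \<cdot>\<^sub>v e (i - 1)})"

definition M_tilde :: "int list \<Rightarrow> complex \<Rightarrow> (cusp, cusp vec) module" where
  "M_tilde w lam = (let V = module_vec TYPE(cusp) (length w div 3) in
     V\<lparr>carrier := module.span class_ring V (generators w lam)\<rparr>)"

definition M_module :: "int list \<Rightarrow> complex \<Rightarrow> (cusp, (cusp vec \<Rightarrow> cusp) \<Rightarrow> cusp) module" where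
  "M_module w lam = macaulayfication (M_tilde w lam)"

end

theory Submission
  imports Defs
begin

text \<open>
The ring A embeds into the product of the power series rings of the three coordinate planes, so
elements of A-modules are described by functions on planes that agree along the axes. Indexing by
all integers instead of a cycle absorbs the parameter: one works with sequences satisfying
U (j - n) = lam U j.

A homomorphism from M_tilde to A amounts to functions f_j on the planes with coordinates chi_j,
chi_(j+1) which are glued along the axes with multiplicities given by w. An element of the kernel
of the transpose of phi over A restricts on the planes to monomials times such functions; the
exponents of these monomials are what the correction word accounts for. Hence the dual of M_tilde
is this kernel, and since phi is a factor of a matrix factorization, dualizing once more turns the
kernel of the transpose into the cokernel of phi.

For the cofactor psi one shows that xyz kills the cokernel of phi over S. The relations push
xyz e_s along the cycle. Either this stops with 0 at a change of sign, or it leads once around and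
multiplies xyz e_s by a monomial times lam or its inverse. By non-degeneracy and non-periodicity 1 minus
this factor is a unit, so again xyz e_s is 0.
\<close>

section \<open>Coordinate planes and axes\<close>

text \<open>At each link \<open>j\<close> the two opposite entries of \<open>phi\<close> next to the
  diagonal carry the exponents \<open>v j - 1\<close> and \<open>- v j\<close>, and exactly one of
  them is nonnegative. The sign word says which one, so on every link the relations push in only one
  direction. The obstacle is the exponent 0. If \<open>v j\<close> is 1 or 0, the surviving entry is
  a unit, which does not vanish on any plane and couples functions that would otherwise decouple.
  For \<open>v j = 1\<close> the coupled restriction turns out to be 0. For \<open>v j = 0\<close>
  it survives at a zero entry of negative sign just behind a position of positive sign. There the
  kernel equations contain one summand more than the gluing conditions of the dual, and the two
  solution spaces are identified only after a unipotent twist, which is invertible because such runs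
  of zeros end. No presentation of \<open>M_tilde\<close> is computed. A linear form is recovered
  from its values on the generators with squares of monomials, and it is built by showing that these
  values determine a value at every vector of the span. Reflexivity comes from the exactness of a
  matrix factorization modulo \<open>xyz\<close>, applied to the pair, the swapped pair and the
  transposes.\<close>

definition fps_coeff_map :: "('a::zero \<Rightarrow> 'b::zero) \<Rightarrow> 'a fps \<Rightarrow> 'b fps" where
  "fps_coeff_map f a = Abs_fps (\<lambda>i. f (fps_nth a i))"

lemma fps_coeff_map_nth [simp]: "fps_nth (fps_coeff_map f a) i = f (fps_nth a i)"
  by (simp add: fps_coeff_map_def)

definition fps_at0 :: "'a::zero fps \<Rightarrow> 'a fps" where
  "fps_at0 a = fps_const (fps_nth a 0)"

definition ring_endo :: "('a::comm_ring_1 \<Rightarrow> 'a) \<Rightarrow> bool" where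
  "ring_endo f \<longleftrightarrow> f 1 = 1 \<and> (\<forall>a b. f (a + b) = f a + f b) \<and> (\<forall>a b. f (a * b) = f a * f b)"

lemma ring_endo_0: "ring_endo f \<Longrightarrow> f 0 = 0"
  unfolding ring_endo_def by (metis add_cancel_right_right)

lemma ring_endo_sum: "ring_endo f \<Longrightarrow> f (sum g I) = (\<Sum>i\<in>I. f (g i))"
  by (induction I rule: infinite_finite_induct) (auto simp: ring_endo_0, simp add: ring_endo_def)

lemma ring_endo_coeff_map:
  assumes "ring_endo f" shows "ring_endo (fps_coeff_map f)"
proof -
  have "fps_coeff_map f 1 = 1"
    using assms ring_endo_0[OF assms] by (intro fps_ext) (auto simp: ring_endo_def)
  moreover have "fps_coeff_map f (a + b) = fps_coeff_map f a + fps_coeff_map f b" for a b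
    using assms by (intro fps_ext) (auto simp: ring_endo_def)
  moreover have "fps_coeff_map f (a * b) = fps_coeff_map f a * fps_coeff_map f b" for a b
    using assms by (intro fps_ext) (simp add: fps_mult_nth ring_endo_sum, simp add: ring_endo_def)
  ultimately show ?thesis by (simp add: ring_endo_def)
qed

lemma ring_endo_at0: "ring_endo (fps_at0 :: 'a::comm_ring_1 fps \<Rightarrow> _)"
  by (simp add: ring_endo_def fps_at0_def)

text \<open>The three variables sit at different depths of the iterated series ring,
  \<open>z\<close> outermost and \<open>x\<close> innermost; this explains the number of coefficient
  maps.\<close>

definition set_zero :: "int \<Rightarrow> pser \<Rightarrow> pser" where
  "set_zero j = (if j mod 3 = 1 then fps_coeff_map (fps_coeff_map fps_at0)
     else if j mod 3 = 2 then fps_coeff_map fps_at0 else fps_at0)"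

lemma ring_endo_set_zero: "ring_endo (set_zero j)"
  by (auto simp: set_zero_def intro!: ring_endo_coeff_map ring_endo_at0)

lemma set_zero_hom [simp]:
  "set_zero j 1 = 1" "set_zero j 0 = 0"
  "set_zero j (a + b) = set_zero j a + set_zero j b"
  "set_zero j (a * b) = set_zero j a * set_zero j b"
  using ring_endo_set_zero[of j] by (auto simp: ring_endo_def ring_endo_0)

lemma set_zero_minus [simp]: "set_zero j (- a) = - set_zero j a"
  using set_zero_hom(3)[of j a "- a"] by (simp add: eq_neg_iff_add_eq_0 add.commute del: set_zero_hom(3))

lemma set_zero_diff [simp]: "set_zero j (a - b) = set_zero j a - set_zero j b"
  using set_zero_hom(3)[of j a "- b"] by simp

lemma set_zero_power [simp]: "set_zero j (a ^ k) = set_zero j a ^ k"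
  by (induction k) auto

lemma set_zero_idem [simp]: "set_zero j (set_zero j a) = set_zero j a"
  by (auto simp: set_zero_def fps_at0_def intro!: fps_ext)

lemma set_zero_commute: "set_zero j (set_zero k a) = set_zero k (set_zero j a)"
  by (auto simp: set_zero_def fps_at0_def intro!: fps_ext)

lemma set_zero_cong: "j mod 3 = k mod 3 \<Longrightarrow> set_zero j = set_zero k"
  by (simp add: set_zero_def)

lemma chi_cong: "j mod 3 = k mod 3 \<Longrightarrow> chi j = chi k"
  by (simp add: chi_def)

lemma set_zero_chi: "set_zero j (chi k) = (if (k - j) mod 3 = 0 then 0 else chi k)"
proof -
  have "(k - j) mod 3 = 0 \<longleftrightarrow> k mod 3 = j mod 3" by presburger
  moreover have "j mod 3 \<in> {0, 1, 2}" "k mod 3 \<in> {0, 1, 2}" by auto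
  ultimately show ?thesis
    by (auto simp: set_zero_def chi_def fps_at0_def xS_def yS_def zS_def intro!: fps_ext)
qed

lemma set_zero_constS [simp]: "set_zero j (constS c) = constS c"
  by (auto simp: set_zero_def constS_def fps_at0_def intro!: fps_ext)

lemma fps_at0_eq_0_iff: "fps_at0 a = 0 \<longleftrightarrow> fps_X dvd (a :: 'a::comm_ring_1 fps)"
proof
  assume "fps_at0 a = 0"
  then have "a = fps_X * fps_shift 1 a"
    by (intro fps_ext) (auto simp: fps_at0_def)
  then show "fps_X dvd a" by (rule dvdI)
qed (auto simp: fps_at0_def elim!: dvdE)

lemma fps_const_dvd_iff: "fps_const c dvd a \<longleftrightarrow> (\<forall>i. c dvd fps_nth a i)"
  for c :: "'a::comm_ring_1"
proof
  assume "\<forall>i. c dvd fps_nth a i"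
  then have "\<forall>i. \<exists>k. fps_nth a i = c * k" by (simp add: dvd_def)
  then obtain k where "\<And>i. fps_nth a i = c * k i" using choice[of "\<lambda>i k. fps_nth a i = c * k"] by blast
  then have "a = fps_const c * Abs_fps k" by (intro fps_ext) simp
  then show "fps_const c dvd a" by (rule dvdI)
qed (auto elim!: dvdE)

lemma fps_coeff_map_eq_0_iff: "fps_coeff_map f a = 0 \<longleftrightarrow> (\<forall>i. f (fps_nth a i) = 0)"
  by (auto simp: fps_eq_iff)

lemma set_zero_eq_0_iff: "set_zero j a = 0 \<longleftrightarrow> chi j dvd a"
  by (simp add: set_zero_def chi_def xS_def yS_def zS_def fps_at0_eq_0_iff fps_const_dvd_iff
      fps_coeff_map_eq_0_iff)

lemma chi_nonzero [simp]: "chi j \<noteq> 0"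
  by (simp add: chi_def xS_def yS_def zS_def)

lemma set_zero_shift3 [simp]: "set_zero (j + 3) = set_zero j" "set_zero (3 + j) = set_zero j"
  by (rule set_zero_cong; simp add: mod_eq_dvd_iff)+

lemma chi_shift3 [simp]: "chi (j + 3) = chi j"
  by (rule chi_cong; simp add: mod_eq_dvd_iff)+

lemma chi_prod: "xS * yS * zS = chi j * chi (j + 1) * chi (j + 2)"
proof -
  have "j mod 3 = 0 \<or> j mod 3 = 1 \<or> j mod 3 = 2" by presburger
  then consider "j mod 3 = 0" | "j mod 3 = 1" | "j mod 3 = 2" by blast
  then show ?thesis
  proof cases
    case 1
    moreover have "(j + 1) mod 3 = 1" "(j + 2) mod 3 = 2" using 1 by presburger+
    ultimately show ?thesis by (simp add: chi_def)
  next
    case 2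
    moreover have "(j + 1) mod 3 = 2" "(j + 2) mod 3 = 0" using 2 by presburger+
    ultimately show ?thesis by (simp add: chi_def)
  next
    case 3
    moreover have "(j + 1) mod 3 = 0" "(j + 2) mod 3 = 1" using 3 by presburger+
    ultimately show ?thesis by (simp add: chi_def)
  qed
qed

text \<open>After \<open>chi j\<close> is factored out, \<open>set_zero k\<close> fixes that factor,
  so it can be cancelled.\<close>

lemma chi_chi_dvd:
  assumes "set_zero j a = 0" "set_zero k a = 0" "(j - k) mod 3 \<noteq> 0"
  shows "chi j * chi k dvd a"
proof -
  obtain b where b: "a = chi j * b" using assms(1) by (auto simp: set_zero_eq_0_iff)
  have "set_zero k b = 0" using assms(2,3) by (auto simp: b set_zero_chi)
  then show ?thesis by (auto simp: b set_zero_eq_0_iff)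
qed

text \<open>The common kernel of the three restrictions is the ideal of \<open>xyz\<close>: this is
  injectivity of A into the product of its planes.\<close>

lemma xyz_dvd_iff:
  "xS * yS * zS dvd a \<longleftrightarrow> set_zero j a = 0 \<and> set_zero (j + 1) a = 0 \<and> set_zero (j + 2) a = 0"
proof
  assume "xS * yS * zS dvd a"
  then show "set_zero j a = 0 \<and> set_zero (j + 1) a = 0 \<and> set_zero (j + 2) a = 0"
    by (auto simp: chi_prod[of j] set_zero_chi elim!: dvdE)
next
  assume *: "set_zero j a = 0 \<and> set_zero (j + 1) a = 0 \<and> set_zero (j + 2) a = 0"
  then have "chi j * chi (j + 1) dvd a" by (intro chi_chi_dvd) auto
  then obtain b where b: "a = chi j * chi (j + 1) * b" by auto
  have "set_zero (j + 2) b = 0" using * by (auto simp: b set_zero_chi)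
  then show "xS * yS * zS dvd a" by (auto simp: b set_zero_eq_0_iff chi_prod[of j])
qed

lemma toA_hom [simp]:
  "toA 0 = 0" "toA 1 = 1" "toA (a + b) = toA a + toA b" "toA (a - b) = toA a - toA b"
  "toA (- a) = - toA a" "toA (a * b) = toA a * toA b"
  by (simp_all add: zero_cusp.abs_eq one_cusp.abs_eq plus_cusp.abs_eq minus_cusp.abs_eq
      uminus_cusp.abs_eq times_cusp.abs_eq)

lemma toA_power [simp]: "toA (a ^ k) = toA a ^ k"
  by (induction k) auto

lemma toA_eq_iff: "toA a = toA b \<longleftrightarrow> xS * yS * zS dvd a - b"
  by (rule cusp.abs_eq_iff)

lemma toA_eq_0_iff: "toA a = 0 \<longleftrightarrow> xS * yS * zS dvd a"
  using toA_eq_iff[of a 0] by simp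

lemma toA_surj: "\<exists>s. a = toA s"
  by (induction a rule: cusp.abs_induct) auto

lemma set_zero_xyz: "xS * yS * zS dvd a - b \<Longrightarrow> set_zero j a = set_zero j b"
  using xyz_dvd_iff[of "a - b" j] by simp

text \<open>The restriction of an element of A to the coordinate plane where chi j is 0.\<close>

lift_definition plane :: "int \<Rightarrow> cusp \<Rightarrow> pser" is set_zero
  by (rule set_zero_xyz)

lemmas plane_toA [simp] = plane.abs_eq

lemma plane_hom [simp]:
  "plane j 1 = 1" "plane j 0 = 0" "plane j (a + b) = plane j a + plane j b"
  "plane j (a * b) = plane j a * plane j b" "plane j (a - b) = plane j a - plane j b"
  "plane j (- a) = - plane j a"
  by (transfer; simp)+

lemma plane_power [simp]: "plane j (a ^ k) = plane j a ^ k"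
  by (induction k) simp_all

lemma chi_cong_add: "j mod 3 = k mod 3 \<Longrightarrow> chi (j + i) = chi (k + i)"
  by (intro chi_cong mod_add_cong) simp_all

lemma set_zero_plane [simp]: "set_zero j (plane j a) = plane j a"
  by transfer simp

lemma set_zero_plane_commute: "set_zero j (plane k a) = set_zero k (plane j a)"
  by transfer (rule set_zero_commute)

lemma index_shift [simp]:
  "chi (j + 4) = chi (j + 1)" "chi (j + 5) = chi (j + 2)"
  "chi (j - 1) = chi (j + 2)" "chi (j - 2) = chi (j + 1)" "chi (j - 3) = chi j"
  "set_zero (j + 4) = set_zero (j + 1)" "set_zero (j + 5) = set_zero (j + 2)"
  "set_zero (j - 1) = set_zero (j + 2)" "set_zero (j - 2) = set_zero (j + 1)"
  "set_zero (j - 3) = set_zero j"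
  by (rule chi_cong set_zero_cong; simp add: mod_eq_dvd_iff)+

lemma plane_cong: "j mod 3 = k mod 3 \<Longrightarrow> plane j a = plane k a"
  by transfer (metis set_zero_cong)

lemma plane_shift [simp]:
  "plane (j + 3) a = plane j a" "plane (j + 4) a = plane (j + 1) a" "plane (j + 5) a = plane (j + 2) a"
  "plane (j - 1) a = plane (j + 2) a" "plane (j - 2) a = plane (j + 1) a" "plane (j - 3) a = plane j a"
  by (rule plane_cong; simp add: mod_eq_dvd_iff)+

lemma set_zero_chi_shift [simp]:
  "set_zero j (chi j) = 0" "set_zero j (chi (j + 1)) = chi (j + 1)"
  "set_zero j (chi (j + 2)) = chi (j + 2)"
  "set_zero (j + 1) (chi j) = chi j" "set_zero (j + 1) (chi (j + 1)) = 0"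
  "set_zero (j + 1) (chi (j + 2)) = chi (j + 2)"
  "set_zero (j + 2) (chi j) = chi j" "set_zero (j + 2) (chi (j + 1)) = chi (j + 1)"
  "set_zero (j + 2) (chi (j + 2)) = 0"
  by (simp_all add: set_zero_chi)

lemma cusp_eqI:
  assumes "plane j a = plane j b" "plane (j + 1) a = plane (j + 1) b" "plane (j + 2) a = plane (j + 2) b"
  shows "a = b"
proof -
  obtain s t where "a = toA s" "b = toA t" using toA_surj by metis
  then show ?thesis using assms by (simp add: toA_eq_iff xyz_dvd_iff[of _ j])
qed

lemma cusp_eq_iff:
  "a = b \<longleftrightarrow> plane (j + 2) a = plane (j + 2) b \<and> plane j a = plane j b \<and> plane (j + 1) a = plane (j + 1) b"
  by (auto intro: cusp_eqI)

text \<open>Inclusion-exclusion over three planes, three axes and the origin. Together with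
  \<open>cusp_eqI\<close> it describes A as the ring of compatible triples of plane
  functions.\<close>

lemma plane_glue:
  assumes "set_zero j a = a" "set_zero (j + 1) b = b" "set_zero (j + 2) c = c"
    and "set_zero (j + 1) a = set_zero j b" "set_zero (j + 2) b = set_zero (j + 1) c"
    and "set_zero j c = set_zero (j + 2) a"
  shows "\<exists>u. plane j u = a \<and> plane (j + 1) u = b \<and> plane (j + 2) u = c"
proof -
  let ?s = "a + b + c - set_zero (j + 1) a - set_zero (j + 2) b - set_zero j c
    + set_zero (j + 1) (set_zero (j + 2) a)"
  have 1: "set_zero j (set_zero (j + 1) a) = set_zero (j + 1) a"
    "set_zero j (set_zero (j + 1) (set_zero (j + 2) a)) = set_zero (j + 1) (set_zero (j + 2) a)"
    by (simp_all only: set_zero_commute[of j] assms(1))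
  have 2: "set_zero j (set_zero (j + 2) b) = set_zero (j + 1) (set_zero (j + 2) a)"
    by (simp only: set_zero_commute[of j] assms(4)[symmetric]) (rule set_zero_commute)
  have 3: "set_zero (j + 1) (set_zero (j + 2) b) = set_zero (j + 2) b"
    by (simp only: set_zero_commute[of "j + 1"] assms(2))
  have 4: "set_zero (j + 2) (set_zero (j + 1) a) = set_zero (j + 1) (set_zero (j + 2) a)"
    by (rule set_zero_commute)
  have 5: "set_zero (j + 2) (set_zero (j + 1) (set_zero (j + 2) a)) = set_zero (j + 1) (set_zero (j + 2) a)"
    by (simp only: set_zero_commute[of "j + 2"] set_zero_idem)
  have "set_zero j ?s = a"
    using assms(1,4) 1 2 by simp
  moreover have "set_zero (j + 1) ?s = b"
    using assms(2,5,6) 3 by simp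
  moreover have "set_zero (j + 2) ?s = c"
    using assms(3,6) 4 5 by simp
  ultimately show ?thesis by (intro exI[of _ "toA ?s"]) simp
qed

text \<open>The simplifier normalizes r + 1 to 1 + r in certain contexts; these instances undo it under the index functions.\<close>

lemma index_comm:
  fixes r :: int
  shows "g (1 + r) = g (r + 1)" "g (2 + r) = g (r + 2)" "g (3 + r) = g (r + 3)" "g (4 + r) = g (r + 4)"
    "g (5 + r) = g (r + 5)"
  by (simp_all add: add.commute)

lemmas index_comm_chi [simp] = index_comm[where g = chi]
lemmas index_comm_set_zero [simp] = index_comm[where g = set_zero]
lemmas index_comm_plane [simp] = index_comm[where g = plane]

section \<open>Monomials whose negative powers are 0\<close>

lemma chi_pow_add: "0 \<le> a \<Longrightarrow> 0 \<le> b \<Longrightarrow> chi_pow j a * chi_pow j b = chi_pow j (a + b)"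
  by (simp add: chi_pow_def nat_add_distrib flip: power_add)

lemma chi_pow_add_left: "0 \<le> a \<Longrightarrow> 0 \<le> b \<Longrightarrow> chi_pow j a * (chi_pow j b * s) = chi_pow j (a + b) * s"
  by (simp only: mult.assoc[symmetric] chi_pow_add)

lemma chi_pow_0 [simp]: "chi_pow j 0 = 1"
  by (simp add: chi_pow_def)

lemma chi_pow_1 [simp]: "chi_pow j 1 = chi j"
  by (simp add: chi_pow_def)

lemma chi_pow_Suc: "0 \<le> a \<Longrightarrow> chi_pow j (a + 1) = chi_pow j a * chi j"
  using chi_pow_add[of a 1 j] by simp

lemma chi_pow_neg [simp]: "a < 0 \<Longrightarrow> chi_pow j a = 0"
  by (simp add: chi_pow_def)

lemma chi_pow_eq_0_iff [simp]: "chi_pow j a = 0 \<longleftrightarrow> a < 0"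
  by (simp add: chi_pow_def)

lemma chi_pow_shift [simp]:
  "chi_pow (j + 3) a = chi_pow j a" "chi_pow (j + 4) a = chi_pow (j + 1) a"
  "chi_pow (j + 5) a = chi_pow (j + 2) a"
  "chi_pow (j - 1) a = chi_pow (j + 2) a" "chi_pow (j - 2) a = chi_pow (j + 1) a"
  "chi_pow (j - 3) a = chi_pow j a"
  by (simp_all add: chi_pow_def)

text \<open>A power of the variable that is set to zero leaves 1 exactly for the exponent 0. This is
  how the unit entries of \<open>phi\<close> show up on the planes.\<close>

lemma set_zero_chi_pow_shift [simp]:
  "set_zero j (chi_pow j a) = of_bool (a = 0)"
  "set_zero (j + 1) (chi_pow (j + 1) a) = of_bool (a = 0)"
  "set_zero (j + 2) (chi_pow (j + 2) a) = of_bool (a = 0)"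
  "set_zero j (chi_pow (j + 1) a) = chi_pow (j + 1) a"
  "set_zero j (chi_pow (j + 2) a) = chi_pow (j + 2) a"
  "set_zero (j + 1) (chi_pow j a) = chi_pow j a"
  "set_zero (j + 1) (chi_pow (j + 2) a) = chi_pow (j + 2) a"
  "set_zero (j + 2) (chi_pow j a) = chi_pow j a"
  "set_zero (j + 2) (chi_pow (j + 1) a) = chi_pow (j + 1) a"
  by (auto simp: chi_pow_def)

lemmas index_comm_chi_pow [simp] = index_comm[where g = chi_pow]

section \<open>The kernel of the transposed matrix\<close>

text \<open>
Here w is the word, v its conversion and d the sign word. The predicate c holds on the
strings of zeros of negative sign that follow a positive entry: their sign comes from the other side.\<close>

locale band_signs =
  fixes w v :: "int \<Rightarrow> int" and d c :: "int \<Rightarrow> bool"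
  assumes nonneg: "d j \<Longrightarrow> 0 \<le> w j"
    and nonpos: "\<not> d j \<Longrightarrow> w j \<le> 0"
    and zero_pos: "d j \<Longrightarrow> w j = 0 \<Longrightarrow> d (j - 1) \<and> d (j + 1)"
    and zero_neg: "\<not> d j \<Longrightarrow> w j = 0 \<Longrightarrow> \<not> d (j - 1) \<or> \<not> d (j + 1)"
    and c_iff: "c j \<longleftrightarrow> \<not> d j \<and> w j = 0 \<and> (d (j - 1) \<or> c (j - 1))"
    and c_next: "c j \<Longrightarrow> \<not> d (j + 1)"
    and c_stop: "\<exists>i>0. \<not> c (j + int i)"
    and v_def: "v j = w j - 1 + of_bool (d (j - 1)) + of_bool (d j) + of_bool (d (j + 1))"
begin

lemmas index_comm_w [simp] = index_comm[where g = w]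
lemmas index_comm_v [simp] = index_comm[where g = v]
lemmas index_comm_d [simp] = index_comm[where g = d]
lemmas index_comm_c [simp] = index_comm[where g = c]

text \<open>\<open>f j\<close> lives on the plane with coordinates \<open>chi j\<close> and
  \<open>chi (j + 1)\<close>, and meets \<open>f (j - 1)\<close> on the axis of
  \<open>chi j\<close>. The summand with \<open>c\<close> stems from a unit entry of
  \<open>phi\<close>, the one with \<open>v (j + 1) = 0\<close>.\<close>

definition spread :: "(int \<Rightarrow> pser) \<Rightarrow> bool" where
  "spread f \<longleftrightarrow> (\<forall>j. set_zero (j + 2) (f j) = f j) \<and>
    (\<forall>j. if d j then set_zero (j + 1) (f j) = chi_pow j (w j) * set_zero (j + 2) (f (j - 1))
           + of_bool (c (j + 1)) * set_zero (j + 2) (chi_pow (j + 2) (- w (j + 2)) * f (j + 2))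
         else chi_pow j (- w j) * set_zero (j + 1) (f j) = set_zero (j + 2) (f (j - 1)))"

text \<open>
The restrictions of an element of the kernel to the planes where chi (r + 2), chi r and chi (r + 1)
vanish, in terms of its family of plane functions.\<close>

definition face0 :: "(int \<Rightarrow> pser) \<Rightarrow> int \<Rightarrow> pser" where
  "face0 f r = chi_pow r (of_bool (d (r + 1))) * chi_pow (r + 1) (of_bool (\<not> d r)) * f r"

definition face1 :: "(int \<Rightarrow> pser) \<Rightarrow> int \<Rightarrow> pser" where
  "face1 f r = of_bool (\<not> d (r + 1)) * chi_pow (r + 1) (- w (r + 1) + of_bool (\<not> d r)) * f (r + 1)"

definition face2 :: "(int \<Rightarrow> pser) \<Rightarrow> int \<Rightarrow> pser" where
  "face2 f r = of_bool (d r) * (chi_pow r (w r + of_bool (d (r + 1))) * f (r - 1)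
     + of_bool (c (r + 1)) * chi_pow (r + 2) (- w (r + 2)) * f (r + 2))"

text \<open>\<open>A\<close>, \<open>B\<close>, \<open>C\<close> stand for the restrictions of a
  sequence \<open>U r\<close> to the planes where \<open>chi (r + 2)\<close>, \<open>chi r\<close>,
  \<open>chi (r + 1)\<close> vanish. The first three clauses are the column relation of
  \<open>phi\<close> on the three planes; an \<open>of_bool\<close> is what remains of a power of
  the vanishing variable. The last two say that the triples come from elements of A.\<close>

definition kernel :: "(int \<Rightarrow> pser) \<Rightarrow> (int \<Rightarrow> pser) \<Rightarrow> (int \<Rightarrow> pser) \<Rightarrow> bool" where
  "kernel A B C \<longleftrightarrow>
    (\<forall>r. 0 = chi_pow r (v r - 1) * B (r - 1) + chi_pow (r + 1) (- v (r + 1)) * C (r + 1)) \<and>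
    (\<forall>r. chi (r + 2) * B r = of_bool (v r = 1) * C (r - 1) + chi_pow (r + 1) (- v (r + 1)) * A (r + 1)) \<and>
    (\<forall>r. chi (r + 2) * C r = chi_pow r (v r - 1) * A (r - 1) + of_bool (v (r + 1) = 0) * B (r + 1)) \<and>
    (\<forall>r. set_zero (r + 2) (A r) = A r \<and> set_zero r (B r) = B r \<and> set_zero (r + 1) (C r) = C r) \<and>
    (\<forall>r. set_zero (r + 1) (A r) = set_zero (r + 2) (C r) \<and> set_zero r (A r) = set_zero (r + 2) (B r) \<and>
         set_zero (r + 1) (B r) = set_zero r (C r))"

lemma v_pos: "d j \<Longrightarrow> 1 \<le> v j"
  using nonneg[of j] zero_pos[of j] by (cases "w j = 0") (auto simp: v_def)

lemma v_nonpos: "\<not> d j \<Longrightarrow> v j \<le> 0"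
  using nonpos[of j] zero_neg[of j] by (cases "w j = 0") (auto simp: v_def)

text \<open>Hence exactly one of \<open>chi_pow j (v j - 1)\<close> and
  \<open>chi_pow j (- v j)\<close> is nonzero, and \<open>d j\<close> selects it. It also makes
  \<open>d\<close> inherit the period of \<open>v\<close>.\<close>

lemma d_iff: "d j \<longleftrightarrow> 1 \<le> v j"
  using v_pos[of j] v_nonpos[of j] by force

lemma face2_alt: "d r \<Longrightarrow> \<not> d (r + 1) \<Longrightarrow> c (r + 1) \<longleftrightarrow> w (r + 1) = 0"
  using c_iff[of "r + 1"] by auto

text \<open>At a negative link the correction gives \<open>- w (r + 1) + of_bool (\<not> d r) = - v
  (r + 1) + of_bool (d (r + 2))\<close>, which balances the two monomials.\<close>

lemma chi_face1: "chi (r + 2) * face1 f r = chi_pow (r + 1) (- v (r + 1)) * face0 f (r + 1)"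
proof (cases "d (r + 1)")
  case True
  then show ?thesis using v_pos[of "r + 1"] by (simp add: face1_def)
next
  case False
  have "chi_pow (r + 1) (- w (r + 1) + of_bool (\<not> d r))
      = chi_pow (r + 1) (- v (r + 1)) * chi_pow (r + 1) (of_bool (d (r + 2)))"
    using v_nonpos[OF False] False by (subst chi_pow_add) (auto simp: v_def)
  then show ?thesis using False by (simp add: face1_def face0_def mult_ac)
qed

text \<open>At a positive link \<open>w r + of_bool (d (r + 1)) = v r - 1 + of_bool (\<not> d (r -
  1))\<close> balances the first terms. The second terms are nonzero only if \<open>d r\<close>,
  \<open>v (r + 1) = 0\<close> and \<open>\<not> d (r + 2)\<close>; these force
  \<open>w (r + 1) = 0\<close>, that is, \<open>c (r + 1)\<close>.\<close>

lemma chi_face2: "chi (r + 2) * face2 f r = chi_pow r (v r - 1) * face0 f (r - 1) + of_bool (v (r + 1) = 0) * face1 f (r + 1)"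
proof -
  note [simp] = index_comm[where g = f]
  show ?thesis
  proof (cases "d r")
  case False
  have "of_bool (v (r + 1) = 0) * face1 f (r + 1) = 0"
  proof (cases "v (r + 1) = 0 \<and> \<not> d (r + 2)")
    case True
    then have "\<not> d (r + 1)" using v_pos[of "r + 1"] by force
    then show ?thesis using True False nonpos[of "r + 1"] by (simp add: v_def)
  qed (auto simp: face1_def)
  then show ?thesis using False v_nonpos[OF False] by (simp add: face2_def)
next
  case True
  have 1: "chi (r + 2) * (chi_pow r (w r + of_bool (d (r + 1))) * f (r - 1)) = chi_pow r (v r - 1) * face0 f (r - 1)"
  proof -
    have "chi_pow r (w r + of_bool (d (r + 1))) = chi_pow r (v r - 1) * chi_pow r (of_bool (\<not> d (r - 1)))"
      using v_pos[OF True] True by (subst chi_pow_add) (auto simp: v_def)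
    then show ?thesis using True by (simp add: face0_def mult_ac)
  qed
  have 2: "chi (r + 2) * (of_bool (c (r + 1)) * chi_pow (r + 2) (- w (r + 2)) * f (r + 2)) = of_bool (v (r + 1) = 0) * face1 f (r + 1)"
  proof (cases "c (r + 1)")
    case c: True
    then have *: "\<not> d (r + 1)" "w (r + 1) = 0" "\<not> d (r + 2)" using c_iff[of "r + 1"] c_next[of "r + 1"] by auto
    then have "chi_pow (r + 2) (- w (r + 2) + 1) = chi_pow (r + 2) (- w (r + 2)) * chi (r + 2)"
      using nonpos[of "r + 2"] chi_pow_add[of "- w (r + 2)" 1 "r + 2"] by simp
    then show ?thesis using * c True by (simp add: v_def face1_def)
  next
    case nc: False
    have "\<not> (v (r + 1) = 0 \<and> \<not> d (r + 2))"
    proof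
      assume *: "v (r + 1) = 0 \<and> \<not> d (r + 2)"
      then have "\<not> d (r + 1)" using v_pos[of "r + 1"] by force
      moreover from * this have "w (r + 1) = 0" using True by (auto simp: v_def)
      ultimately show False using nc face2_alt[OF True] by blast
    qed
    then show ?thesis using nc by (auto simp: face1_def)
  qed
  show ?thesis unfolding face2_def using True 1 2 by (simp add: distrib_left)
qed

qed

text \<open>Apart from the terms balanced in \<open>chi_face1\<close> and \<open>chi_face2\<close>,
  a face that meets a surviving monomial is 0 by its sign factor. Of the three axis conditions, two
  are the positive and the negative case of \<open>spread\<close>. On the third both sides vanish
  unless \<open>d r\<close> and \<open>c (r + 1)\<close>, and then the negative case at
  \<open>r + 2\<close> gives equality.\<close>

lemma kernel_of_spread:
  assumes f: "spread f"
  shows "kernel (face0 f) (face1 f) (face2 f)"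
proof -
  note [simp] = index_comm[where g = f]
  have fix_f [simp]: "set_zero (j + 2) (f j) = f j" for j
    using f by (simp add: spread_def)
  have fix_f' [simp]: "set_zero r (f (r + 1)) = f (r + 1)" "set_zero (r + 1) (f (r + 2)) = f (r + 2)"
    "set_zero (r + 1) (f (r - 1)) = f (r - 1)" for r
    using fix_f[of "r + 1"] fix_f[of "r + 2"] fix_f[of "r - 1"] by simp_all
  have pos: "set_zero (j + 1) (f j) = chi_pow j (w j) * set_zero (j + 2) (f (j - 1))
           + of_bool (c (j + 1)) * set_zero (j + 2) (chi_pow (j + 2) (- w (j + 2)) * f (j + 2))"
    if "d j" for j using f that by (auto simp: spread_def split: if_splits)
  have neg: "chi_pow j (- w j) * set_zero (j + 1) (f j) = set_zero (j + 2) (f (j - 1))"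
    if "\<not> d j" for j using f that by (auto simp: spread_def split: if_splits)
  have K1: "0 = chi_pow r (v r - 1) * face1 f (r - 1) + chi_pow (r + 1) (- v (r + 1)) * face2 f (r + 1)" for r
  proof -
    have "chi_pow r (v r - 1) * face1 f (r - 1) = 0"
      using v_nonpos[of r] by (cases "d r") (auto simp: face1_def)
    moreover have "chi_pow (r + 1) (- v (r + 1)) * face2 f (r + 1) = 0"
      using v_pos[of "r + 1"] by (cases "d (r + 1)") (auto simp: face2_def)
    ultimately show ?thesis by (simp only: add_0_left)
  qed
  have K2: "chi (r + 2) * face1 f r = of_bool (v r = 1) * face2 f (r - 1) + chi_pow (r + 1) (- v (r + 1)) * face0 f (r + 1)" for r
  proof -
    \<comment> \<open>With \<open>d (r - 1)\<close>, \<open>v r = 1\<close> would mean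
      \<open>w r = 0\<close> and \<open>\<not> d (r + 1)\<close>, but a zero of positive sign has
      positive signs on both sides.\<close>
    have 1: "of_bool (v r = 1) * face2 f (r - 1) = 0"
    proof (cases "v r = 1 \<and> d (r - 1)")
      case True
      then have "d r" using v_nonpos[of r] by force
      moreover have "w r + of_bool (d (r + 1)) = 0"
        using True \<open>d r\<close> by (auto simp: v_def)
      ultimately have False using nonneg[of r] zero_pos[of r] by (auto split: if_splits simp: of_bool_def)
      then show ?thesis ..
    qed (auto simp: face2_def)
    then show ?thesis by (simp add: chi_face1)
  qed
  have F: "set_zero (r + 2) (face0 f r) = face0 f r \<and> set_zero r (face1 f r) = face1 f r \<and>
      set_zero (r + 1) (face2 f r) = face2 f r" for r
    by (simp add: face0_def face1_def face2_def)
  have G1: "set_zero (r + 1) (face0 f r) = set_zero (r + 2) (face2 f r)" for r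
  proof (cases "d r")
    case True
    have "set_zero (r + 1) (face0 f r) = chi_pow r (of_bool (d (r + 1))) * set_zero (r + 1) (f r)"
      using True by (simp add: face0_def)
    also have "\<dots> = chi_pow r (w r + of_bool (d (r + 1))) * set_zero (r + 2) (f (r - 1))
        + of_bool (c (r + 1)) * set_zero (r + 2) (chi_pow (r + 2) (- w (r + 2)) * f (r + 2))"
    proof (cases "d (r + 1)")
      case d: True
      then have "\<not> c (r + 1)" using c_iff[of "r + 1"] by blast
      moreover have "chi_pow r (w r + 1) = chi r * chi_pow r (w r)"
        using chi_pow_add[of "w r" 1 r] nonneg[OF True] by (simp add: mult.commute)
      ultimately show ?thesis unfolding pos[OF True] using d
        by simp
    next
      case False
      then show ?thesis unfolding pos[OF True] by simp
    qed
    also have "\<dots> = set_zero (r + 2) (face2 f r)"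
      using True by (simp add: face2_def)
    finally show ?thesis .
  qed (simp add: face0_def face2_def)
  have G2: "set_zero r (face0 f r) = set_zero (r + 2) (face1 f r)" for r
  proof (cases "d (r + 1)")
    case False
    then have "set_zero r (f r) = chi_pow (r + 1) (- w (r + 1)) * set_zero (r + 2) (f (r + 1))"
      using neg[of "r + 1"] by simp
    then show ?thesis using False nonpos[OF False]
      by (simp add: face0_def face1_def chi_pow_add_left)
  qed (simp add: face0_def face1_def)
  have G3: "set_zero (r + 1) (face1 f r) = set_zero r (face2 f r)" for r
  proof -
    \<comment> \<open>This exponent belongs to the first summand of \<open>face2\<close>; being
      positive, it removes that summand on the axis where \<open>chi r\<close> vanishes.\<close>
    have 0: "w r + of_bool (d (r + 1)) > 0" if "d r"
      using nonneg[OF that] zero_pos[OF that] by (cases "w r = 0") auto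
    have 1: "set_zero (r + 1) (f (r + 1)) = chi_pow (r + 2) (- w (r + 2)) * set_zero r (f (r + 2))"
      if "\<not> d (r + 2)" using neg[of "r + 2"] that by simp
    show ?thesis
    proof (cases "d r \<and> c (r + 1)")
      case True
      then have "\<not> d (r + 1)" "w (r + 1) = 0" "\<not> d (r + 2)"
        using c_iff[of "r + 1"] c_next[of "r + 1"] by auto
      then show ?thesis using True 0 1 by (simp add: face1_def face2_def)
    next
      case False
      have "set_zero r (face2 f r) = 0"
      proof (cases "d r")
        case True
        then have "\<not> c (r + 1)" using False by simp
        then show ?thesis using True 0 by (simp add: face2_def)
      qed (simp add: face2_def)
      moreover have "set_zero (r + 1) (face1 f r) = 0"
      proof (cases "d (r + 1)")
        case nd: False
        then have "- w (r + 1) + of_bool (\<not> d r) \<noteq> 0"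
          using nonpos[OF nd] c_iff[of "r + 1"] False by (cases "d r") auto
        then show ?thesis by (simp add: face1_def)
      qed (simp add: face1_def)
      ultimately show ?thesis by simp
    qed
  qed
  show ?thesis unfolding kernel_def using K1 K2 chi_face2 F G1 G2 G3 by blast
qed

text \<open>Relations at neighbouring positions, restricted to an axis, force \<open>A r\<close> to
  vanish there, so it is divisible by the monomial of \<open>face0\<close>; the quotient is
  \<open>f r\<close>. Then \<open>B\<close> and \<open>C\<close> are determined, because
  \<open>chi (r + 2)\<close> can be cancelled in their relations.\<close>

lemma spread_of_kernel:
  assumes K: "kernel A B C"
  shows "\<exists>f. spread f \<and> A = face0 f \<and> B = face1 f \<and> C = face2 f"
proof -
  note [simp] = index_comm[where g = A] index_comm[where g = B] index_comm[where g = C]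
  from K have K2: "chi (r + 2) * B r = of_bool (v r = 1) * C (r - 1) + chi_pow (r + 1) (- v (r + 1)) * A (r + 1)"
    and K3: "chi (r + 2) * C r = chi_pow r (v r - 1) * A (r - 1) + of_bool (v (r + 1) = 0) * B (r + 1)"
    and fixA: "set_zero (r + 2) (A r) = A r"
    and G1: "set_zero (r + 1) (A r) = set_zero (r + 2) (C r)"
    and G2: "set_zero r (A r) = set_zero (r + 2) (B r)"
    and G3: "set_zero (r + 1) (B r) = set_zero r (C r)" for r
    unfolding kernel_def by blast+
  \<comment> \<open>The unit entry for \<open>v r = 1\<close> occurs only behind a negative sign at
    \<open>r - 1\<close>, where the right side of the third relation is 0.\<close>
  have C0: "C (r - 1) = 0" if "v r = 1" for r
  proof -
    from that have "d r" using v_nonpos[of r] by force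
    then have w: "w r + of_bool (d (r - 1)) + of_bool (d (r + 1)) = 1"
      using that by (simp add: v_def)
    have "\<not> d (r - 1)"
    proof
      assume "d (r - 1)"
      with w nonneg[OF \<open>d r\<close>] have "w r = 0 \<and> \<not> d (r + 1)" by (cases "d (r + 1)") auto
      then show False using zero_pos[OF \<open>d r\<close>] by blast
    qed
    then have "chi (r + 1) * C (r - 1) = 0"
      using K3[of "r - 1"] v_nonpos[of "r - 1"] that by simp
    then show ?thesis by simp
  qed
  have C0': "C (r + 2) = 0" if "d (r + 1)" "v (r + 2) = 0" for r
  proof -
    have nd: "\<not> d (r + 2)" using that(2) v_pos[of "r + 2"] by force
    \<comment> \<open>Otherwise \<open>c\<close> would hold at \<open>r + 2\<close> and at
      \<open>r + 3\<close> while \<open>d (r + 4)\<close>, against \<open>c_next\<close>: such a run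
      of zeros owes its sign to a negative entry at its right end.\<close>
    have "v (r + 3) \<noteq> 0"
    proof
      assume v3: "v (r + 3) = 0"
      then have nd3: "\<not> d (r + 3)" using v_pos[of "r + 3"] by force
      then have "w (r + 2) = 0" using that nd v_def[of "r + 2"] by simp
      then have c2: "c (r + 2)" using c_iff[of "r + 2"] nd that(1) by simp
      have "w (r + 3) - 1 + of_bool (d (r + 4)) = 0"
        using v3 nd nd3 v_def[of "r + 3"] by simp
      then have *: "w (r + 3) = 0 \<and> d (r + 4)" using nonpos[OF nd3] by (cases "d (r + 4)") auto
      then have "c (r + 3)" using c_iff[of "r + 3"] nd3 c2 by simp
      then show False using c_next[of "r + 3"] * by simp
    qed
    then have "chi (r + 1) * C (r + 2) = 0"
      using K3[of "r + 2"] nd that(2) by simp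
    then show ?thesis by simp
  qed
  \<comment> \<open>In the third relation at \<open>r + 1\<close> the left side has the factor
    \<open>chi (r + 3) = chi r\<close> and vanishes; the unit term vanishes by \<open>C0'\<close>,
    which leaves \<open>A r\<close> times a nonzero monomial.\<close>
  have A1: "set_zero r (A r) = 0" if "d (r + 1)" for r
  proof -
    have "of_bool (v (r + 2) = 0) * set_zero r (B (r + 2)) = 0"
      using G3[of "r + 2"] C0'[OF that] by (cases "v (r + 2) = 0") auto
    moreover have "set_zero r (chi (r + 3) * C (r + 1))
        = set_zero r (chi_pow (r + 1) (v (r + 1) - 1) * A r + of_bool (v (r + 2) = 0) * B (r + 2))"
      using K3[of "r + 1"] by simp
    ultimately have "chi_pow (r + 1) (v (r + 1) - 1) * set_zero r (A r) = 0"
      by (cases "v (r + 2) = 0") simp_all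
    then show ?thesis using v_pos[OF that] by simp
  qed
  have A2: "set_zero (r + 1) (A r) = 0" if "\<not> d r" for r
  proof -
    have "of_bool (v (r - 1) = 1) * C (r - 2) = 0"
      using C0[of "r - 1"] by simp
    then have "chi (r + 1) * B (r - 1) = chi_pow r (- v r) * A r"
      using K2[of "r - 1"] by simp
    then have "set_zero (r + 1) (chi (r + 1) * B (r - 1)) = set_zero (r + 1) (chi_pow r (- v r) * A r)"
      by simp
    then show ?thesis using v_nonpos[OF that] by simp
  qed
  have "\<exists>g. A r = chi_pow r (of_bool (d (r + 1))) * chi_pow (r + 1) (of_bool (\<not> d r)) * g" for r
    using A1[of r] A2[of r] chi_chi_dvd[of r "A r" "r + 1"]
    by (cases "d (r + 1)"; cases "d r") (auto simp: set_zero_eq_0_iff dvd_def)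
  then obtain f where f: "A r = chi_pow r (of_bool (d (r + 1))) * chi_pow (r + 1) (of_bool (\<not> d r)) * f r" for r
    by metis
  note [simp] = index_comm[where g = f]
  have fix_f [simp]: "set_zero (r + 2) (f r) = f r" for r
    using fixA[of r] by (cases "d (r + 1)"; cases "d r") (simp_all add: f)
  have fix_f' [simp]: "set_zero r (f (r + 1)) = f (r + 1)" "set_zero (r + 1) (f (r + 2)) = f (r + 2)"
    "set_zero (r + 1) (f (r - 1)) = f (r - 1)" for r
    using fix_f[of "r + 1"] fix_f[of "r + 2"] fix_f[of "r - 1"] by simp_all
  have A: "A = face0 f" using f by (intro ext) (simp add: face0_def)
  have B: "B = face1 f"
  proof
    fix r
    have "of_bool (v r = 1) * C (r - 1) = 0" using C0[of r] by simp
    then have "chi (r + 2) * B r = chi (r + 2) * face1 f r"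
      using K2[of r] by (simp add: A chi_face1)
    then show "B r = face1 f r" by simp
  qed
  have C: "C = face2 f"
  proof
    fix r
    have "chi (r + 2) * C r = chi (r + 2) * face2 f r"
      using K3[of r] by (simp add: A B chi_face2)
    then show "C r = face2 f r" by simp
  qed
  have "spread f"
    unfolding spread_def
  proof (intro conjI allI)
    fix j
    show "if d j then set_zero (j + 1) (f j) = chi_pow j (w j) * set_zero (j + 2) (f (j - 1))
           + of_bool (c (j + 1)) * set_zero (j + 2) (chi_pow (j + 2) (- w (j + 2)) * f (j + 2))
         else chi_pow j (- w j) * set_zero (j + 1) (f j) = set_zero (j + 2) (f (j - 1))"
    proof (cases "d j")
      case True
      have *: "chi_pow j (of_bool (d (j + 1))) * set_zero (j + 1) (f j) =
          chi_pow j (w j + of_bool (d (j + 1))) * set_zero (j + 2) (f (j - 1))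
        + of_bool (c (j + 1)) * set_zero (j + 2) (chi_pow (j + 2) (- w (j + 2)) * f (j + 2))"
        using G1[of j] True by (simp add: A C face0_def face2_def)
      show ?thesis
      proof (cases "d (j + 1)")
        case d: True
        then have "\<not> c (j + 1)" using c_iff[of "j + 1"] by blast
        moreover have "chi_pow j (w j + 1) = chi j * chi_pow j (w j)"
          using chi_pow_add[of "w j" 1 j] nonneg[OF True] by (simp add: mult.commute)
        ultimately show ?thesis using * d True by simp
      next
        case False
        then show ?thesis using * True by simp
      qed
    next
      case False
      have "chi_pow j (of_bool (\<not> d (j - 1))) * set_zero (j + 2) (f (j - 1)) =
          chi_pow j (- w j + of_bool (\<not> d (j - 1))) * set_zero (j + 1) (f j)"
        using G2[of "j - 1"] False by (simp add: A B face0_def face1_def)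
      also have "chi_pow j (- w j + of_bool (\<not> d (j - 1)))
          = chi_pow j (of_bool (\<not> d (j - 1))) * chi_pow j (- w j)"
        using nonpos[OF False] by (subst mult.commute, subst chi_pow_add) auto
      finally show ?thesis using False by (cases "d (j - 1)") simp_all
    qed
  qed simp
  then show ?thesis using A B C by blast
qed

text \<open>
The gluing conditions of the dual of M_tilde. They differ from those of a spread family by the term
at positions satisfying c, which the unipotent change of variables by tail removes.\<close>

definition glued :: "(int \<Rightarrow> pser) \<Rightarrow> bool" where
  "glued f \<longleftrightarrow> (\<forall>j. set_zero (j + 2) (f j) = f j) \<and>
    (\<forall>j. if d j then set_zero (j + 1) (f j) = chi_pow j (w j) * set_zero (j + 2) (f (j - 1))
         else chi_pow j (- w j) * set_zero (j + 1) (f j) = set_zero (j + 2) (f (j - 1)))"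

text \<open>Chosen so that on the axis of \<open>chi j\<close> it restricts to the extra summand of
  \<open>spread\<close>. The step 3 returns to a plane with the same coordinates.\<close>

definition tail :: "(int \<Rightarrow> pser) \<Rightarrow> int \<Rightarrow> pser" where
  "tail f j = of_bool (c (j + 1) \<and> c (j + 2)) * chi_pow (j + 3) (- w (j + 3)) * f (j + 3)"

text \<open>The distance to the end of the run of \<open>c\<close> ahead of \<open>j\<close>. It
  decreases along the jumps made by \<open>tail\<close>, which is therefore locally
  nilpotent.\<close>

definition rank :: "int \<Rightarrow> nat" where
  "rank j = (LEAST i. 0 < i \<and> \<not> c (j + int i))"

lemma rank: "0 < rank j" "\<not> c (j + int (rank j))"
  unfolding rank_def using LeastI_ex[OF c_stop[of j]] by auto

lemma rank_le: "0 < i \<Longrightarrow> \<not> c (j + int i) \<Longrightarrow> rank j \<le> i"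
  unfolding rank_def by (intro Least_le) auto

lemma rank_decreases:
  assumes "c (j + 1)" "c (j + 2)"
  shows "rank (j + 3) < rank j"
proof -
  have n1: "rank j \<noteq> 1" using rank(2)[of j] assms by auto
  have n2: "rank j \<noteq> 2" using rank(2)[of j] assms by auto
  show ?thesis
  proof (cases "rank j = 3")
    case True
    \<comment> \<open>A run of \<open>c\<close> can begin only behind a positive sign, and
      \<open>j + 3\<close> has a negative one; so \<open>j + 4\<close> is outside \<open>c\<close>
      as well.\<close>
    then have "\<not> c (j + 3)" using rank(2)[of j] by simp
    then have "\<not> c (j + 4)" using c_iff[of "j + 4"] c_next[OF assms(2)] by simp
    then have "rank (j + 3) \<le> 1" by (intro rank_le) auto
    then show ?thesis using True by simp
  next
    case False
    then have gt: "3 < rank j" using rank(1)[of j] n1 n2 by linarith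
    then have "j + 3 + int (rank j - 3) = j + int (rank j)" by simp
    then have "rank (j + 3) \<le> rank j - 3"
      using rank(2)[of j] gt by (intro rank_le) (auto simp: )
    then show ?thesis using gt by linarith
  qed
qed

lemma tail_before_pos: "d j \<Longrightarrow> tail f (j - 1) = 0"
  using c_iff[of j] by (simp add: tail_def)

text \<open>If \<open>c (j + 1)\<close> but not \<open>c (j + 2)\<close>, then
  \<open>w (j + 2)\<close> is nonzero and the extra summand vanishes on the axis. If both hold, then
  \<open>w (j + 2) = 0\<close>, and the gluing condition at \<open>j + 3\<close>, assumed as
  \<open>E\<close>, replaces \<open>f (j + 2)\<close> by \<open>f (j + 3)\<close>.\<close>

lemma tail_match:
  assumes fix_f: "\<And>j. set_zero (j + 2) (f j) = f j"
    and E: "c (j + 1) \<Longrightarrow> c (j + 2) \<Longrightarrow>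
      chi_pow j (- w (j + 3)) * set_zero (j + 1) (f (j + 3)) = set_zero (j + 2) (f (j + 2))"
  shows "d j \<Longrightarrow> set_zero (j + 1) (tail f j)
      = of_bool (c (j + 1)) * set_zero (j + 2) (chi_pow (j + 2) (- w (j + 2)) * f (j + 2))"
    and "\<not> d j \<Longrightarrow> chi_pow j (- w j) * set_zero (j + 1) (tail f j) = set_zero (j + 2) (tail f (j - 1))"
proof -
  note [simp] = index_comm[where g = f]
  have w2: "c (j + 2) \<longleftrightarrow> w (j + 2) = 0" if "c (j + 1)"
    using c_iff[of "j + 2"] c_next[OF that] that by simp
  have *: "set_zero (j + 1) (tail f j)
      = of_bool (c (j + 1)) * set_zero (j + 2) (chi_pow (j + 2) (- w (j + 2)) * f (j + 2))"
  proof (cases "c (j + 1)")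
    case c1: True
    show ?thesis
    proof (cases "c (j + 2)")
      case True
      then show ?thesis using c1 w2 E by (simp add: tail_def)
    next
      case False
      then show ?thesis using c1 w2 by (simp add: tail_def)
    qed
  qed (simp add: tail_def)
  show "d j \<Longrightarrow> set_zero (j + 1) (tail f j)
      = of_bool (c (j + 1)) * set_zero (j + 2) (chi_pow (j + 2) (- w (j + 2)) * f (j + 2))"
    by (rule *)
  show "chi_pow j (- w j) * set_zero (j + 1) (tail f j) = set_zero (j + 2) (tail f (j - 1))" if "\<not> d j"
  proof (cases "c (j + 1)")
    case True
    then have "c j" using c_iff[of "j + 1"] that by simp
    then have "w j = 0" using c_iff[of j] by simp
    then show ?thesis using True \<open>c j\<close> unfolding * by (simp add: tail_def)
  next
    case False
    then show ?thesis unfolding * by (simp add: tail_def)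
  qed
qed

lemma glued_of_spread:
  assumes f: "spread f"
  shows "glued (\<lambda>j. f j - tail f j)"
proof -
  note [simp] = index_comm[where g = f]
  have fix_f: "set_zero (j + 2) (f j) = f j" for j
    using f by (simp add: spread_def)
  have pos: "set_zero (j + 1) (f j) = chi_pow j (w j) * set_zero (j + 2) (f (j - 1))
           + of_bool (c (j + 1)) * set_zero (j + 2) (chi_pow (j + 2) (- w (j + 2)) * f (j + 2))"
    if "d j" for j using f that by (auto simp: spread_def split: if_splits)
  have neg: "chi_pow j (- w j) * set_zero (j + 1) (f j) = set_zero (j + 2) (f (j - 1))"
    if "\<not> d j" for j using f that by (auto simp: spread_def split: if_splits)
  have E: "chi_pow j (- w (j + 3)) * set_zero (j + 1) (f (j + 3)) = set_zero (j + 2) (f (j + 2))"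
    if "c (j + 1)" "c (j + 2)" for j
    using neg[of "j + 3"] c_next[OF that(2)] by simp
  note match = tail_match[of f, OF fix_f E]
  have "set_zero (j + 2) (tail f j) = tail f j" for j
    using fix_f[of "j + 3"] by (simp add: tail_def)
  moreover have "set_zero (j + 1) (f j - tail f j)
      = chi_pow j (w j) * set_zero (j + 2) (f (j - 1) - tail f (j - 1))" if "d j" for j
    using pos[OF that] match(1)[OF _ _ that] tail_before_pos[OF that] by simp
  moreover have "chi_pow j (- w j) * set_zero (j + 1) (f j - tail f j)
      = set_zero (j + 2) (f (j - 1) - tail f (j - 1))" if "\<not> d j" for j
    using neg[OF that] match(2)[OF _ _ that] by (simp add: right_diff_distrib)
  ultimately show ?thesis
    unfolding glued_def by (simp add: fix_f)
qed

text \<open>Inverts \<open>f \<mapsto> f - tail f\<close> by recursion on \<open>rank\<close>. The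
  condition at \<open>j\<close> needs the one at \<open>j + 3\<close>, whose rank is smaller
  whenever \<open>tail\<close> is active.\<close>

lemma spread_of_glued:
  assumes g: "glued g"
  shows "\<exists>f. spread f \<and> (\<forall>j. g j = f j - tail f j)"
proof -
  define F where "F = wfrec (measure rank)
    (\<lambda>f j. g j + of_bool (c (j + 1) \<and> c (j + 2)) * chi_pow (j + 3) (- w (j + 3)) * f (j + 3))"
  have F: "F j = g j + tail F j" for j
    unfolding F_def
    by (subst wfrec) (auto simp: cut_apply rank_decreases tail_def)
  note [simp] = index_comm[where g = F] index_comm[where g = g]
  have fix_F: "set_zero (j + 2) (F j) = F j" for j
  proof (induction "rank j" arbitrary: j rule: less_induct)
    case less
    have "set_zero (j + 2) (tail F j) = tail F j"
    proof (cases "c (j + 1) \<and> c (j + 2)")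
      case True
      then have "set_zero (j + 5) (F (j + 3)) = F (j + 3)"
        using less[of "j + 3"] rank_decreases by simp
      then show ?thesis by (simp add: tail_def)
    qed (auto simp: tail_def)
    moreover have "set_zero (j + 2) (g j) = g j" using g by (simp add: glued_def)
    ultimately show ?case by (subst (1 2) F) simp
  qed
  have "if d j then set_zero (j + 1) (F j) = chi_pow j (w j) * set_zero (j + 2) (F (j - 1))
           + of_bool (c (j + 1)) * set_zero (j + 2) (chi_pow (j + 2) (- w (j + 2)) * F (j + 2))
         else chi_pow j (- w j) * set_zero (j + 1) (F j) = set_zero (j + 2) (F (j - 1))" for j
  proof (induction "rank j" arbitrary: j rule: less_induct)
    case less
    have E: "chi_pow j (- w (j + 3)) * set_zero (j + 1) (F (j + 3)) = set_zero (j + 2) (F (j + 2))"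
      if "c (j + 1)" "c (j + 2)"
      using less[OF rank_decreases[OF that]] c_next[OF that(2)] by simp
    note match = tail_match[of F j, OF fix_F E]
    show ?case
    proof (cases "d j")
      case True
      have "set_zero (j + 1) (F j) = set_zero (j + 1) (g j) + set_zero (j + 1) (tail F j)"
        by (subst F) simp
      also have "set_zero (j + 1) (g j) = chi_pow j (w j) * set_zero (j + 2) (g (j - 1))"
        using g True unfolding glued_def by presburger
      also have "g (j - 1) = F (j - 1)" using F[of "j - 1"] tail_before_pos[OF True] by simp
      finally show ?thesis using True match(1)[OF _ _ True] by simp
    next
      case False
      have "chi_pow j (- w j) * set_zero (j + 1) (F j)
          = chi_pow j (- w j) * set_zero (j + 1) (g j) + chi_pow j (- w j) * set_zero (j + 1) (tail F j)"
        by (subst F) (simp add: distrib_left)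
      also have "chi_pow j (- w j) * set_zero (j + 1) (g j) = set_zero (j + 2) (g (j - 1))"
        using g False unfolding glued_def by presburger
      also have "chi_pow j (- w j) * set_zero (j + 1) (tail F j) = set_zero (j + 2) (tail F (j - 1))"
        using match(2)[OF _ _ False] by simp
      also have "set_zero (j + 2) (g (j - 1)) + set_zero (j + 2) (tail F (j - 1)) = set_zero (j + 2) (F (j - 1))"
        by (subst F) simp
      finally show ?thesis using False by simp
    qed
  qed
  then have "spread F" using fix_F by (simp add: spread_def)
  moreover have "g j = F j - tail F j" for j by (subst F) simp
  ultimately show ?thesis by blast
qed

lemma tail_fixpoint_eq_0:
  assumes "\<And>j. f j = tail f j"
  shows "f j = 0"
proof (induction "rank j" arbitrary: j rule: less_induct)
  case less
  then show ?case
    using assms[of j] rank_decreases[of j] by (cases "c (j + 1) \<and> c (j + 2)") (auto simp: tail_def)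
qed

section \<open>Kernel sequences over A and the glued functions they match\<close>

definition ker_seq :: "(int \<Rightarrow> cusp) \<Rightarrow> bool" where
  "ker_seq U \<longleftrightarrow> (\<forall>s. toA (chi (s - 1)) * U s =
     toA (chi_pow s (v s - 1)) * U (s - 1) + toA (chi_pow (s + 1) (- v (s + 1))) * U (s + 1))"

text \<open>An equation in A is three equations on planes. The remaining clauses of
  \<open>kernel\<close> hold for the restrictions of any element.\<close>

lemma ker_seq_iff_kernel:
  "ker_seq U \<longleftrightarrow> kernel (\<lambda>r. plane (r + 2) (U r)) (\<lambda>r. plane r (U r)) (\<lambda>r. plane (r + 1) (U r))"
proof -
  note [simp] = index_comm[where g = U]
  have 1: "toA (chi (s - 1)) * U s =
     toA (chi_pow s (v s - 1)) * U (s - 1) + toA (chi_pow (s + 1) (- v (s + 1))) * U (s + 1) \<longleftrightarrow>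
     0 = chi_pow s (v s - 1) * plane (s + 2) (U (s - 1)) + chi_pow (s + 1) (- v (s + 1)) * plane (s + 2) (U (s + 1)) \<and>
     chi (s + 2) * plane s (U s) = of_bool (v s = 1) * plane s (U (s - 1)) + chi_pow (s + 1) (- v (s + 1)) * plane s (U (s + 1)) \<and>
     chi (s + 2) * plane (s + 1) (U s) = chi_pow s (v s - 1) * plane (s + 1) (U (s - 1)) + of_bool (v (s + 1) = 0) * plane (s + 1) (U (s + 1))"
    for s
    by (subst cusp_eq_iff[of _ _ s]) simp
  have G: "set_zero (r + 1) (plane (r + 2) u) = set_zero (r + 2) (plane (r + 1) u)"
    "set_zero r (plane (r + 2) u) = set_zero (r + 2) (plane r u)"
    "set_zero (r + 1) (plane r u) = set_zero r (plane (r + 1) u)" for r u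
    by (rule set_zero_plane_commute)+
  show ?thesis
    unfolding ker_seq_def 1 kernel_def by (simp add: G all_conj_distrib)
qed

text \<open>One plane per position suffices: it determines \<open>f\<close>, and for a kernel
  sequence \<open>f\<close> determines the other two faces. Asking for \<open>f\<close> to exist
  avoids a division by the monomial of \<open>face0\<close>.\<close>

definition matches :: "(int \<Rightarrow> cusp) \<Rightarrow> (int \<Rightarrow> pser) \<Rightarrow> bool" where
  "matches U g \<longleftrightarrow> (\<exists>f. \<forall>r. plane (r + 2) (U r) = face0 f r \<and> g r = f r - tail f r)"

lemma matchesE:
  assumes "matches U g"
  obtains f where "\<And>r. plane (r + 2) (U r) = face0 f r" "\<And>r. g r = f r - tail f r"
  using assms unfolding matches_def by blast

lemma face0_inject: "face0 f r = face0 f' r \<Longrightarrow> f r = f' r"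
  by (cases "d r"; cases "d (r + 1)") (auto simp: face0_def)

lemma ker_seq_ex_matches:
  assumes "ker_seq U" shows "\<exists>g. glued g \<and> matches U g"
proof -
  obtain f where "spread f" and f: "(\<lambda>r. plane (r + 2) (U r)) = face0 f"
    using spread_of_kernel[OF assms[unfolded ker_seq_iff_kernel]] by blast
  then have "glued (\<lambda>j. f j - tail f j)" by (intro glued_of_spread)
  moreover have "matches U (\<lambda>j. f j - tail f j)"
    unfolding matches_def using fun_cong[OF f] by blast
  ultimately show ?thesis by blast
qed

lemma glued_ex_matches:
  assumes "glued g" shows "\<exists>U. ker_seq U \<and> matches U g"
proof -
  obtain f where f: "spread f" "\<And>j. g j = f j - tail f j"
    using spread_of_glued[OF assms] by blast
  have K: "kernel (face0 f) (face1 f) (face2 f)" by (rule kernel_of_spread[OF f(1)])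
  have "\<exists>u. plane r u = face1 f r \<and> plane (r + 1) u = face2 f r \<and> plane (r + 2) u = face0 f r" for r
    by (rule plane_glue) (use K in \<open>unfold kernel_def, metis+\<close>)
  then obtain U where U: "plane r (U r) = face1 f r \<and> plane (r + 1) (U r) = face2 f r \<and> plane (r + 2) (U r) = face0 f r" for r
    by metis
  then have "ker_seq U" using K unfolding ker_seq_iff_kernel by presburger
  moreover have "matches U g" unfolding matches_def using U f(2) by blast
  ultimately show ?thesis by blast
qed

lemma matches_unique:
  assumes "matches U g" "matches U g'" shows "g = g'"
proof
  fix r
  from assms(1) obtain f where f: "\<And>r. plane (r + 2) (U r) = face0 f r" "\<And>r. g r = f r - tail f r"
    by (rule matchesE) blast
  from assms(2) obtain f' where f': "\<And>r. plane (r + 2) (U r) = face0 f' r" "\<And>r. g' r = f' r - tail f' r"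
    by (rule matchesE) blast
  have "f r = f' r" for r by (rule face0_inject) (simp flip: f(1) f'(1))
  then have "f = f'" by (rule ext)
  then show "g r = g' r" using f(2) f'(2) by simp
qed

text \<open>Injectivity: \<open>f = tail f\<close> forces \<open>f = 0\<close> by
  \<open>tail_fixpoint_eq_0\<close>, and then all three faces are 0.\<close>

lemma matches_0_imp:
  assumes "ker_seq U" "matches U (\<lambda>_. 0)" shows "U r = 0"
proof -
  from assms(2) obtain f where f: "\<And>r. plane (r + 2) (U r) = face0 f r" "\<And>r. 0 = f r - tail f r"
    by (rule matchesE) blast
  have f0: "f j = 0" for j
    by (rule tail_fixpoint_eq_0) (rule f(2)[symmetric, unfolded right_minus_eq])
  obtain f' where f': "(\<lambda>r. plane (r + 2) (U r)) = face0 f'" "(\<lambda>r. plane r (U r)) = face1 f'"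
    "(\<lambda>r. plane (r + 1) (U r)) = face2 f'"
    using spread_of_kernel[OF assms(1)[unfolded ker_seq_iff_kernel]] by blast
  have f'0: "f' j = 0" for j
    using face0_inject[of f j f'] f(1)[of j] fun_cong[OF f'(1), of j] f0 by simp
  have "plane r (U r) = 0" "plane (r + 1) (U r) = 0" "plane (r + 2) (U r) = 0"
    using fun_cong[OF f'(1), of r] fun_cong[OF f'(2), of r] fun_cong[OF f'(3), of r]
    by (simp_all add: face0_def face1_def face2_def f'0)
  then show ?thesis by (intro cusp_eqI[of r]) simp_all
qed

lemma matches_add:
  assumes "matches U g" "matches U' g'" shows "matches (\<lambda>r. U r + U' r) (\<lambda>r. g r + g' r)"
proof -
  from assms(1) obtain f where f: "\<And>r. plane (r + 2) (U r) = face0 f r" "\<And>r. g r = f r - tail f r"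
    by (rule matchesE) blast
  from assms(2) obtain f' where f': "\<And>r. plane (r + 2) (U' r) = face0 f' r" "\<And>r. g' r = f' r - tail f' r"
    by (rule matchesE) blast
  show ?thesis unfolding matches_def
    by (intro exI[of _ "\<lambda>r. f r + f' r"]) (simp add: f f', simp add: face0_def tail_def distrib_left)
qed

text \<open>The multiplier \<open>plane (r + 2) a\<close> is the same at \<open>r\<close> and at
  \<open>r + 3\<close>, so it commutes with \<open>tail\<close>.\<close>

lemma matches_smult:
  assumes "matches U g" shows "matches (\<lambda>r. a * U r) (\<lambda>r. plane (r + 2) a * g r)"
proof -
  from assms(1) obtain f where f: "\<And>r. plane (r + 2) (U r) = face0 f r" "\<And>r. g r = f r - tail f r"
    by (rule matchesE) blast
  show ?thesis unfolding matches_def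
    by (intro exI[of _ "\<lambda>r. plane (r + 2) a * f r"])
      (simp add: f, simp add: face0_def tail_def right_diff_distrib mult.left_commute)
qed

text \<open>Carries quasi-periodicity back and forth between \<open>U\<close> and
  \<open>g\<close>.\<close>

lemma matches_shift:
  assumes "matches U g" and "\<And>j. w (j + n) = w j" "\<And>j. d (j + n) = d j" "\<And>j. c (j + n) = c j"
    and "n mod 3 = 0"
  shows "matches (\<lambda>r. U (r + n)) (\<lambda>r. g (r + n))"
proof -
  from assms(1) obtain f where f: "\<And>r. plane (r + 2) (U r) = face0 f r" "\<And>r. g r = f r - tail f r"
    by (rule matchesE) blast
  have chi_n: "chi_pow (j + n) = chi_pow j" for j
    using assms(5) by (intro ext) (auto simp: chi_pow_def intro!: arg_cong[where f = "\<lambda>x. x ^ _"] chi_cong)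
  have plane_n: "plane (j + n) = plane j" for j
    using assms(5) by (intro ext plane_cong) auto
  have eq: "r + n + k = r + k + n" for r k by simp
  show ?thesis unfolding matches_def
  proof (intro exI[of _ "\<lambda>r. f (r + n)"] allI conjI)
    fix r
    show "plane (r + 2) (U (r + n)) = face0 (\<lambda>r. f (r + n)) r"
      using f(1)[of "r + n"] unfolding face0_def eq plane_n chi_n assms(3) by simp
    show "g (r + n) = f (r + n) - tail (\<lambda>r. f (r + n)) r"
      using f(2)[of "r + n"] unfolding tail_def eq plane_n chi_n assms(2,4) by simp
  qed
qed

end

section \<open>The cofactor\<close>

text \<open>E s is the basis vector e_s and I the image of phi, so that relations hold in the cokernel of phi.\<close>

locale band_relations = band_signs +
  fixes I :: "('i \<Rightarrow> pser) set" and E :: "int \<Rightarrow> 'i \<Rightarrow> pser" and n :: nat and lam :: complex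
  assumes I_add: "x \<in> I \<Longrightarrow> y \<in> I \<Longrightarrow> (\<lambda>i. x i + y i) \<in> I"
    and I_scale: "x \<in> I \<Longrightarrow> (\<lambda>i. a * x i) \<in> I"
    and I_zero: "(\<lambda>i. 0) \<in> I"
    and rel: "(\<lambda>i. chi (s - 1) * E s i
      - (chi_pow s (v s - 1) * E (s - 1) i + chi_pow (s + 1) (- v (s + 1)) * E (s + 1) i)) \<in> I"
    and E_shift: "E (s - int n) i = constS lam * E s i"
    and lam: "lam \<noteq> 0"
    and n: "0 < n" "int n mod 3 = 0"
    and w_shift: "w (s - int n) = w s"
    and v_shift: "v (s - int n) = v s"
    and unit_pos: "(\<And>j. d j) \<Longrightarrow> 1 - constS lam * (\<Prod>i<n. chi_pow (s - int i) (w (s - int i))) dvd 1"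
    and unit_neg: "(\<And>j. \<not> d j) \<Longrightarrow>
      1 - constS (inverse lam) * (\<Prod>i<n. chi_pow (s + int i) (- w (s + int i))) dvd 1"
begin

text \<open>Equality of classes in the cokernel of \<open>phi\<close>.\<close>

definition eqv :: "('i \<Rightarrow> pser) \<Rightarrow> ('i \<Rightarrow> pser) \<Rightarrow> bool" where
  "eqv x y \<longleftrightarrow> (\<lambda>i. x i - y i) \<in> I"

lemma eqv_refl [simp]: "eqv x x"
  by (simp add: eqv_def I_zero)

lemma eqv_trans [trans]: "eqv x y \<Longrightarrow> eqv y z \<Longrightarrow> eqv x z"
  unfolding eqv_def by (drule (1) I_add) simp

lemma eqv_scale: "eqv x y \<Longrightarrow> eqv (\<lambda>i. a * x i) (\<lambda>i. a * y i)"
  unfolding eqv_def by (drule I_scale[of _ a]) (simp add: right_diff_distrib)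

lemma eqv_0_iff: "eqv x (\<lambda>i. 0) \<longleftrightarrow> x \<in> I"
  by (simp add: eqv_def)

lemma eqv_eq_trans [trans]: "eqv x y \<Longrightarrow> y = z \<Longrightarrow> eqv x z"
  by simp

lemma eqv_fixpoint:
  assumes "eqv x (\<lambda>i. a * x i)" "1 - a dvd 1"
  shows "eqv x (\<lambda>i. 0)"
proof -
  from assms(2) obtain b where b: "1 = (1 - a) * b" by (auto elim: dvdE)
  have "(\<lambda>i. x i - a * x i) \<in> I" using assms(1) by (simp add: eqv_def)
  then have "(\<lambda>i. b * (x i - a * x i)) \<in> I" by (rule I_scale)
  moreover have "b * (x i - a * x i) = x i" for i
  proof -
    have "b * (x i - a * x i) = (1 - a) * b * x i" by (simp add: algebra_simps)
    then show ?thesis by (simp flip: b)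
  qed
  ultimately show ?thesis by (simp add: eqv_0_iff)
qed

lemma rel_eqv: "eqv (\<lambda>i. chi (s - 1) * E s i) (\<lambda>i. chi_pow s (v s - 1) * E (s - 1) i
    + chi_pow (s + 1) (- v (s + 1)) * E (s + 1) i)"
  using rel[of s] by (simp add: eqv_def)

text \<open>The sign at \<open>s + 1\<close> makes \<open>- v (s + 1)\<close> negative, so the term
  with \<open>E (s + 1)\<close> is 0 and the relation moves one way.\<close>

lemma rel_down:
  assumes "d (s + 1)"
  shows "eqv (\<lambda>i. chi (s - 1) * E s i) (\<lambda>i. chi_pow s (v s - 1) * E (s - 1) i)"
  using rel_eqv[of s] v_pos[OF assms] by simp

lemma rel_up:
  assumes "\<not> d s"
  shows "eqv (\<lambda>i. chi (s - 1) * E s i) (\<lambda>i. chi_pow (s + 1) (- v (s + 1)) * E (s + 1) i)"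
  using rel_eqv[of s] v_nonpos[OF assms] by simp

text \<open>Up to a power of \<open>chi s\<close>, the form in which the term at
  \<open>s - 1\<close> of the relation for \<open>E s\<close>, multiplied by
  \<open>chi s * chi (s + 1)\<close>, arrives after one further relation. Its factor
  \<open>chi s = chi (s - 3)\<close> is the diagonal entry of column \<open>s - 2\<close>, so the
  next relation applies.\<close>

definition down :: "int \<Rightarrow> 'i \<Rightarrow> pser" where
  "down s i = chi s * chi_pow (s - 1) (v (s - 1) - 1) * E (s - 2) i"

text \<open>The mirror image of \<open>down\<close>; here \<open>chi (s + 1)\<close> is the diagonal
  entry of column \<open>s + 2\<close>.\<close>

definition up :: "int \<Rightarrow> 'i \<Rightarrow> pser" where
  "up s i = chi (s + 1) * chi_pow (s + 2) (- v (s + 2)) * E (s + 2) i"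

text \<open>Between positive signs \<open>v (s - 1) - 1 = w (s - 1) + 1\<close>. One factor
  \<open>chi (s - 1)\<close> is kept for the next step, which leaves the exponent
  \<open>w (s - 1)\<close>. If \<open>d (s - 2)\<close> fails, the new monomial is 0.\<close>

lemma down_step:
  assumes "d s" "d (s - 1)"
  shows "eqv (down s) (\<lambda>i. if d (s - 2) then chi_pow (s - 1) (w (s - 1)) * down (s - 1) i else 0)"
proof -
  have "eqv (\<lambda>i. chi_pow (s - 1) (v (s - 1) - 1) * (chi (s - 3) * E (s - 2) i))
      (\<lambda>i. chi_pow (s - 1) (v (s - 1) - 1) * (chi_pow (s - 2) (v (s - 2) - 1) * E (s - 3) i))"
    using rel_down[of "s - 2"] assms by (intro eqv_scale) simp
  also have "(\<lambda>i. chi_pow (s - 1) (v (s - 1) - 1) * (chi_pow (s - 2) (v (s - 2) - 1) * E (s - 3) i))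
    = (\<lambda>i. if d (s - 2) then chi_pow (s - 1) (w (s - 1)) * down (s - 1) i else 0)"
  proof (cases "d (s - 2)")
    case True
    have "v (s - 1) - 1 = w (s - 1) + 1"
      using assms True v_def[of "s - 1"] by simp
    then have "chi_pow (s - 1) (v (s - 1) - 1) = chi_pow (s - 1) (w (s - 1)) * chi (s - 1)"
      using nonneg[OF assms(2)] by (simp only: chi_pow_Suc)
    then show ?thesis using True by (simp add: down_def mult.assoc)
  next
    case False
    then show ?thesis using v_nonpos[OF False] by simp
  qed
  finally show ?thesis by (simp add: down_def[abs_def] mult_ac)
qed

lemma down_stop:
  assumes "d s" "d (s - 1)" "\<not> d (s - int m)"
  shows "eqv (down s) (\<lambda>i. 0)"
  using assms
proof (induction m arbitrary: s)
  case (Suc m)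
  show ?case
  proof (cases "d (s - 2)")
    case True
    have "eqv (down s) (\<lambda>i. chi_pow (s - 1) (w (s - 1)) * down (s - 1) i)"
      using down_step[OF Suc.prems(1,2)] True by simp
    also have "eqv (down (s - 1)) (\<lambda>i. 0)"
      by (rule Suc.IH) (use Suc.prems True in \<open>auto simp: algebra_simps\<close>)
    then have "eqv (\<lambda>i. chi_pow (s - 1) (w (s - 1)) * down (s - 1) i) (\<lambda>i. chi_pow (s - 1) (w (s - 1)) * 0)"
      by (rule eqv_scale)
    finally show ?thesis by simp
  next
    case False
    then show ?thesis using down_step[OF Suc.prems(1,2)] by simp
  qed
qed simp

lemma down_iterate:
  assumes "\<And>j. d j"
  shows "eqv (down s) (\<lambda>i. (\<Prod>k<m. chi_pow (s - 1 - int k) (w (s - 1 - int k))) * down (s - int m) i)"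
proof (induction m)
  case (Suc m)
  let ?P = "\<Prod>k<m. chi_pow (s - 1 - int k) (w (s - 1 - int k))"
  have "eqv (down (s - int m)) (\<lambda>i. chi_pow (s - int m - 1) (w (s - int m - 1)) * down (s - int m - 1) i)"
    using down_step[of "s - int m"] assms by simp
  then have "eqv (\<lambda>i. ?P * down (s - int m) i)
      (\<lambda>i. ?P * (chi_pow (s - int m - 1) (w (s - int m - 1)) * down (s - int m - 1) i))"
    by (rule eqv_scale)
  with Suc have "eqv (down s)
      (\<lambda>i. ?P * (chi_pow (s - int m - 1) (w (s - int m - 1)) * down (s - int m - 1) i))"
    by (rule eqv_trans)
  moreover have "s - 1 - int m = s - int m - 1" "s - int (Suc m) = s - int m - 1" by simp_all
  ultimately show ?case by (simp only: prod.lessThan_Suc mult.assoc)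
qed simp

lemma chi_n: "chi (s - int n) = chi s" "chi_pow (s - int n) a = chi_pow s a"
proof -
  show "chi (s - int n) = chi s"
    using mod_diff_right_eq[of s "int n" 3] n(2) by (intro chi_cong) simp
  then show "chi_pow (s - int n) a = chi_pow s a" by (simp add: chi_pow_def)
qed

text \<open>By this, a sign that is constant on a half-line is constant everywhere, the signs being
  periodic.\<close>

lemma multiple_reaches: "\<exists>k m. a + int m = int n * int k"
proof -
  obtain k where k: "a \<le> int k" by (metis nat_le_iff order_refl)
  also have "int k \<le> int n * int k"
    using n(1) mult_right_mono[of 1 "int n" "int k"] by simp
  finally have "a + int (nat (int n * int k - a)) = int n * int k" by simp
  then show ?thesis by blast
qed

lemma down_0:
  assumes "d s" "d (s - 1)"
  shows "eqv (down s) (\<lambda>i. 0)"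
proof (cases "\<exists>m. \<not> d (s - int m)")
  case True
  then show ?thesis using down_stop assms by blast
next
  case False
  have per: "d (j - int n) = d j" for j
    by (simp add: d_iff v_shift)
  have d: "d j" for j
  proof -
    have "d (j - int n * int k) = d j" for k
    proof (induction k)
      case (Suc k)
      then show ?case using per[of "j - int n * int k"] by (simp add: algebra_simps)
    qed simp
    moreover have "\<exists>k m. j - int n * int k = s - int m"
    proof -
      obtain k m where "j - s + int m = int n * int k" using multiple_reaches[of "j - s"] by blast
      then show ?thesis by (intro exI[of _ k] exI[of _ m]) simp
    qed
    ultimately show ?thesis using False by metis
  qed
  let ?W = "\<Prod>k<n. chi_pow (s - 1 - int k) (w (s - 1 - int k))"
  have "down (s - int n) i = constS lam * down s i" for i
  proof -
    have "s - int n - 1 = s - 1 - int n" "s - int n - 2 = s - 2 - int n" by simp_all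
    then show ?thesis by (simp only: down_def chi_n v_shift E_shift mult.left_commute)
  qed
  \<comment> \<open>After \<open>n\<close> steps the class is a multiple of itself;
    \<open>lam\<close> comes from \<open>E_shift\<close>.\<close>
  then have "eqv (down s) (\<lambda>i. constS lam * ?W * down s i)"
    using down_iterate[OF d, of s n] by (simp add: mult_ac)
  then show ?thesis
    using unit_pos[OF d, of "s - 1"] by (rule eqv_fixpoint)
qed

lemma down_term:
  assumes "d s"
  shows "eqv (\<lambda>i. chi_pow s (v s) * (chi (s + 1) * E (s - 1) i)) (\<lambda>i. 0)"
proof -
  have "eqv (\<lambda>i. chi_pow s (v s) * (chi (s - 2) * E (s - 1) i))
      (\<lambda>i. chi_pow s (v s) * (chi_pow (s - 1) (v (s - 1) - 1) * E (s - 2) i))"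
    using rel_down[of "s - 1"] assms by (intro eqv_scale) simp
  also have "eqv (\<lambda>i. chi_pow s (v s) * (chi_pow (s - 1) (v (s - 1) - 1) * E (s - 2) i)) (\<lambda>i. 0)"
  proof (cases "d (s - 1)")
    case True
    have "chi_pow s (v s) = chi_pow s (v s - 1) * chi s"
      using chi_pow_add[of "v s - 1" 1 s] v_pos[OF assms] by simp
    then have "(\<lambda>i. chi_pow s (v s) * (chi_pow (s - 1) (v (s - 1) - 1) * E (s - 2) i))
        = (\<lambda>i. chi_pow s (v s - 1) * down s i)"
      by (simp add: down_def mult_ac)
    then show ?thesis using eqv_scale[OF down_0[OF assms True], of "chi_pow s (v s - 1)"] by simp
  next
    case False
    then show ?thesis using v_nonpos[OF False] by simp
  qed
  finally show ?thesis by simp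
qed

lemma up_step:
  assumes "\<not> d (s + 1)" "\<not> d (s + 2)"
  shows "eqv (up s) (\<lambda>i. if d (s + 3) then 0 else chi_pow (s + 2) (- w (s + 2)) * up (s + 1) i)"
proof -
  note [simp] = index_comm[where g = E]
  have "eqv (\<lambda>i. chi_pow (s + 2) (- v (s + 2)) * (chi (s + 1) * E (s + 2) i))
      (\<lambda>i. chi_pow (s + 2) (- v (s + 2)) * (chi_pow (s + 3) (- v (s + 3)) * E (s + 3) i))"
    using rel_up[of "s + 2"] assms by (intro eqv_scale) simp
  also have "(\<lambda>i. chi_pow (s + 2) (- v (s + 2)) * (chi_pow (s + 3) (- v (s + 3)) * E (s + 3) i))
    = (\<lambda>i. if d (s + 3) then 0 else chi_pow (s + 2) (- w (s + 2)) * up (s + 1) i)"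
  proof (cases "d (s + 3)")
    case False
    have "- v (s + 2) = - w (s + 2) + 1"
      using assms False v_def[of "s + 2"] by simp
    then have "chi_pow (s + 2) (- v (s + 2)) = chi_pow (s + 2) (- w (s + 2)) * chi (s + 2)"
      using nonpos[OF assms(2)] by (simp only: chi_pow_Suc neg_0_le_iff_le)
    then show ?thesis using False by (simp add: up_def mult.assoc)
  next
    case True
    then show ?thesis using v_pos[OF True] by simp
  qed
  finally show ?thesis by (simp add: up_def[abs_def] mult_ac)
qed

lemma up_stop:
  assumes "\<not> d (s + 1)" "\<not> d (s + 2)" "d (s + 1 + int m)"
  shows "eqv (up s) (\<lambda>i. 0)"
  using assms
proof (induction m arbitrary: s)
  case (Suc m)
  show ?case
  proof (cases "d (s + 3)")
    case False
    have "eqv (up s) (\<lambda>i. chi_pow (s + 2) (- w (s + 2)) * up (s + 1) i)"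
      using up_step[OF Suc.prems(1,2)] False by simp
    also have "eqv (up (s + 1)) (\<lambda>i. 0)"
      by (rule Suc.IH) (use Suc.prems False in \<open>auto simp: add.assoc\<close>)
    then have "eqv (\<lambda>i. chi_pow (s + 2) (- w (s + 2)) * up (s + 1) i) (\<lambda>i. chi_pow (s + 2) (- w (s + 2)) * 0)"
      by (rule eqv_scale)
    finally show ?thesis by simp
  next
    case True
    then show ?thesis using up_step[OF Suc.prems(1,2)] by simp
  qed
qed simp

lemma up_iterate:
  assumes "\<And>j. \<not> d j"
  shows "eqv (up s) (\<lambda>i. (\<Prod>k<m. chi_pow (s + 2 + int k) (- w (s + 2 + int k))) * up (s + int m) i)"
proof (induction m)
  case (Suc m)
  let ?P = "\<Prod>k<m. chi_pow (s + 2 + int k) (- w (s + 2 + int k))"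
  have "eqv (up (s + int m)) (\<lambda>i. chi_pow (s + int m + 2) (- w (s + int m + 2)) * up (s + int m + 1) i)"
    using up_step[of "s + int m"] assms by simp
  then have "eqv (\<lambda>i. ?P * up (s + int m) i)
      (\<lambda>i. ?P * (chi_pow (s + int m + 2) (- w (s + int m + 2)) * up (s + int m + 1) i))"
    by (rule eqv_scale)
  with Suc have "eqv (up s)
      (\<lambda>i. ?P * (chi_pow (s + int m + 2) (- w (s + int m + 2)) * up (s + int m + 1) i))"
    by (rule eqv_trans)
  moreover have "s + 2 + int m = s + int m + 2" "s + int (Suc m) = s + int m + 1" by simp_all
  ultimately show ?case by (simp only: prod.lessThan_Suc mult.assoc)
qed simp

lemma up_0:
  assumes "\<not> d (s + 1)" "\<not> d (s + 2)"
  shows "eqv (up s) (\<lambda>i. 0)"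
proof (cases "\<exists>m. d (s + 1 + int m)")
  case True
  then show ?thesis using up_stop assms by blast
next
  case False
  have per: "d (j + int n) = d j" for j
    using v_shift[of "j + int n"] by (simp add: d_iff)
  have d: "\<not> d j" for j
  proof -
    have "d (j + int n * int k) = d j" for k
    proof (induction k)
      case (Suc k)
      then show ?case using per[of "j + int n * int k"] by (simp add: algebra_simps)
    qed simp
    moreover have "\<exists>k m. j + int n * int k = s + 1 + int m"
    proof -
      obtain k m where "s + 1 - j + int m = int n * int k" using multiple_reaches[of "s + 1 - j"] by blast
      then show ?thesis by (intro exI[of _ k] exI[of _ m]) simp
    qed
    ultimately show ?thesis using False by metis
  qed
  let ?W = "\<Prod>k<n. chi_pow (s + 2 + int k) (- w (s + 2 + int k))"
  have "up (s + int n) i = constS (inverse lam) * up s i" for i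
  proof -
    have 1: "s + int n + 1 - int n = s + 1" "s + int n + 2 - int n = s + 2" by simp_all
    have "constS (inverse lam) * (constS lam * x) = x" for x
      using lam by (simp add: constS_def flip: mult.assoc)
    then have "E (s + int n + 2) i = constS (inverse lam) * E (s + 2) i"
      using E_shift[of "s + int n + 2" i] by (simp only: 1)
    moreover have "chi (s + int n + 1) = chi (s + 1)" "v (s + int n + 2) = v (s + 2)"
      "chi_pow (s + int n + 2) a = chi_pow (s + 2) a" for a
      using chi_n[of "s + int n + 1"] chi_n[of "s + int n + 2"] v_shift[of "s + int n + 2"]
      by (simp_all only: 1)
    ultimately show ?thesis by (simp only: up_def mult.left_commute)
  qed
  then have "eqv (up s) (\<lambda>i. constS (inverse lam) * ?W * up s i)"
    using up_iterate[OF d, of s n] by (simp add: mult_ac)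
  then show ?thesis
    using unit_neg[OF d, of "s + 2"] by (rule eqv_fixpoint)
qed

lemma up_term:
  assumes "\<not> d (s + 1)"
  shows "eqv (\<lambda>i. chi_pow (s + 1) (1 - v (s + 1)) * (chi s * E (s + 1) i)) (\<lambda>i. 0)"
proof -
  note [simp] = index_comm[where g = E]
  have "eqv (\<lambda>i. chi_pow (s + 1) (1 - v (s + 1)) * (chi s * E (s + 1) i))
      (\<lambda>i. chi_pow (s + 1) (1 - v (s + 1)) * (chi_pow (s + 2) (- v (s + 2)) * E (s + 2) i))"
    using rel_up[of "s + 1"] assms by (intro eqv_scale) simp
  also have "eqv (\<lambda>i. chi_pow (s + 1) (1 - v (s + 1)) * (chi_pow (s + 2) (- v (s + 2)) * E (s + 2) i)) (\<lambda>i. 0)"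
  proof (cases "d (s + 2)")
    case False
    have "chi_pow (s + 1) (1 - v (s + 1)) = chi_pow (s + 1) (- v (s + 1)) * chi (s + 1)"
      using chi_pow_add[of "- v (s + 1)" 1 "s + 1"] v_nonpos[OF assms] by simp
    then have "(\<lambda>i. chi_pow (s + 1) (1 - v (s + 1)) * (chi_pow (s + 2) (- v (s + 2)) * E (s + 2) i))
        = (\<lambda>i. chi_pow (s + 1) (- v (s + 1)) * up s i)"
      by (simp add: up_def mult_ac)
    then show ?thesis using eqv_scale[OF up_0[OF assms False], of "chi_pow (s + 1) (- v (s + 1))"] by simp
  next
    case True
    then show ?thesis using v_pos[OF True] by simp
  qed
  finally show ?thesis by simp
qed

text \<open>\<open>chi s * chi (s + 1)\<close> completes the diagonal entry of column
  \<open>s\<close> to \<open>xyz\<close>. Each of the two other terms of that column is 0 for one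
  sign of its link and is removed by \<open>down_term\<close> or \<open>up_term\<close> for the
  other.\<close>

theorem xyz_E: "(\<lambda>i. xS * yS * zS * E s i) \<in> I"
proof -
  have 1: "eqv (\<lambda>i. chi_pow s (v s - 1) * chi s * chi (s + 1) * E (s - 1) i) (\<lambda>i. 0)"
  proof (cases "d s")
    case True
    have "chi_pow s (v s) = chi_pow s (v s - 1) * chi s"
      using chi_pow_add[of "v s - 1" 1 s] v_pos[OF True] by simp
    then show ?thesis using down_term[OF True] by (simp add: mult.assoc)
  next
    case False
    then show ?thesis using v_nonpos[OF False] by simp
  qed
  have 2: "eqv (\<lambda>i. chi_pow (s + 1) (- v (s + 1)) * chi s * chi (s + 1) * E (s + 1) i) (\<lambda>i. 0)"
  proof (cases "d (s + 1)")
    case False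
    have "chi_pow (s + 1) (1 - v (s + 1)) = chi_pow (s + 1) (- v (s + 1)) * chi (s + 1)"
      using chi_pow_add[of "- v (s + 1)" 1 "s + 1"] v_nonpos[OF False] by simp
    then show ?thesis using up_term[OF False] by (simp add: mult_ac)
  next
    case True
    then show ?thesis using v_pos[OF True] by simp
  qed
  have "eqv (\<lambda>i. chi s * chi (s + 1) * (chi (s - 1) * E s i))
    (\<lambda>i. chi s * chi (s + 1) * (chi_pow s (v s - 1) * E (s - 1) i + chi_pow (s + 1) (- v (s + 1)) * E (s + 1) i))"
    by (intro eqv_scale rel_eqv)
  also have "\<dots> = (\<lambda>i. chi_pow s (v s - 1) * chi s * chi (s + 1) * E (s - 1) i
      + chi_pow (s + 1) (- v (s + 1)) * chi s * chi (s + 1) * E (s + 1) i)"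
    by (simp add: distrib_left mult_ac)
  also have "eqv \<dots> (\<lambda>i. 0)"
    using 1 2 unfolding eqv_0_iff by (rule I_add)
  finally have "(\<lambda>i. chi s * chi (s + 1) * (chi (s - 1) * E s i)) \<in> I"
    by (simp only: eqv_0_iff)
  moreover have "chi s * chi (s + 1) * (chi (s - 1) * E s i) = xS * yS * zS * E s i" for i
    unfolding chi_prod[of s] by (simp add: mult_ac)
  ultimately show ?thesis by (simp only:)
qed

end

section \<open>The sign word\<close>

definition pos_sign :: "int list \<Rightarrow> int \<Rightarrow> bool" where
  "pos_sign ws j \<longleftrightarrow> sign_word ws j = 1"

definition after_pos :: "int list \<Rightarrow> int \<Rightarrow> bool" where
  "after_pos ws j \<longleftrightarrow> \<not> pos_sign ws j \<and> ent ws j = 0 \<and>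
     (\<exists>k>0. 0 < ent ws (j - k) \<and> (\<forall>m. 0 < m \<and> m < k \<longrightarrow> ent ws (j - m) = 0))"

lemma ent_cong: "j mod int (length ws) = k mod int (length ws) \<Longrightarrow> ent ws j = ent ws k"
  unfolding ent_def by (metis mod_diff_left_eq)

lemma ent_shift [simp]: "ent ws (j + int (length ws)) = ent ws j" "ent ws (j - int (length ws)) = ent ws j"
  by (rule ent_cong; simp add: mod_eq_dvd_iff)+

lemma sign_word_shift [simp]: "sign_word ws (j + int (length ws)) = sign_word ws j"
proof -
  have "ent ws (j + int (length ws) + k) = ent ws (j + k)" "ent ws (j + int (length ws) - k) = ent ws (j - k)" for k
    by (rule ent_cong; simp add: mod_eq_dvd_iff)+
  then show ?thesis unfolding sign_word_def by simp
qed

lemma sign_word_of_bool: "sign_word ws j = of_bool (pos_sign ws j)"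
  by (simp add: pos_sign_def sign_word_def)

lemma pos_sign_shift [simp]: "pos_sign ws (j + int (length ws)) = pos_sign ws j"
  by (simp add: pos_sign_def)

lemma after_pos_shift [simp]: "after_pos ws (j + int (length ws)) = after_pos ws j"
proof -
  have "ent ws (j + int (length ws) - k) = ent ws (j - k)" for k
    by (rule ent_cong; simp add: mod_eq_dvd_iff)
  then show ?thesis unfolding after_pos_def by simp
qed

lemma ent_convert_word:
  assumes "ws \<noteq> []"
  shows "ent (convert_word ws) j = ent ws j + correction ws j"
proof -
  let ?n = "int (length ws)"
  have n: "0 < ?n" using assms by simp
  define k where "k = (j - 1) mod ?n"
  have k: "0 \<le> k" "k < ?n" using n by (simp_all add: k_def)
  have jk: "\<exists>q. j = k + 1 + q * ?n"
    unfolding k_def by (metis add.commute diff_add_cancel mult.commute mult_div_mod_eq add.assoc)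
  then obtain q where q: "j = k + 1 + q * ?n" by blast
  have per: "f (i + q * ?n) = f i" if "\<And>i. f (i + ?n) = f i" for f :: "int \<Rightarrow> int" and i
  proof (induction q rule: int_induct[where k = 0])
    case (step1 q)
    then show ?case using that[of "i + q * ?n"] by (simp add: algebra_simps)
  next
    case (step2 q)
    then show ?case using that[of "i + (q - 1) * ?n"] by (simp add: algebra_simps)
  qed simp
  have corr: "correction ws (i + ?n) = correction ws i" for i
    unfolding correction_def using sign_word_shift[of ws "i - 1"] sign_word_shift[of ws i] sign_word_shift[of ws "i + 1"]
    by (simp add: algebra_simps)
  have "ent (convert_word ws) j = convert_word ws ! nat k"
    unfolding ent_def k_def by (simp add: convert_word_def)
  also have "\<dots> = ent ws (k + 1) + correction ws (k + 1)"
    using k nth_upto[of 1 "nat k" "int (length ws)"] by (simp add: convert_word_def add.commute[of 1])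
  also have "ent ws (k + 1) = ent ws j" unfolding q by (rule per[symmetric]) simp
  also have "correction ws (k + 1) = correction ws j" unfolding q by (rule per[symmetric]) (rule corr)
  finally show ?thesis .
qed

lemma pos_sign_zero:
  assumes "ent ws j = 0"
  shows "pos_sign ws j \<longleftrightarrow>
    \<not> (\<exists>k>0. ent ws (j + k) < 0 \<and> (\<forall>m. 0 < m \<and> m < k \<longrightarrow> ent ws (j + m) = 0)) \<and>
    \<not> (\<exists>k>0. ent ws (j - k) < 0 \<and> (\<forall>m. 0 < m \<and> m < k \<longrightarrow> ent ws (j - m) = 0))"
proof -
  have "(if A then 0 else 1 :: int) = 1 \<longleftrightarrow> \<not> A" for A by simp
  then show ?thesis
    unfolding pos_sign_def sign_word_def by (simp only: assms less_irrefl simp_thms de_Morgan_disj)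
qed

lemma pos_sign_nonzero: "ent ws j \<noteq> 0 \<Longrightarrow> pos_sign ws j \<longleftrightarrow> 0 < ent ws j"
  by (auto simp: pos_sign_def sign_word_def)

text \<open>\<open>s\<close> is the direction of a walk through zeros. Unfolding one step turns
  statements about walks from neighbouring indices into propositional ones.\<close>

lemma first_step:
  fixes e :: "int \<Rightarrow> int" and P :: "int \<Rightarrow> bool"
  assumes "s = 1 \<or> s = - 1" and "\<not> P 0"
  shows "(\<exists>k>0. P (e (j + s * k)) \<and> (\<forall>m. 0 < m \<and> m < k \<longrightarrow> e (j + s * m) = 0)) \<longleftrightarrow>
    P (e (j + s)) \<or> e (j + s) = 0 \<and>
      (\<exists>k>0. P (e (j + s + s * k)) \<and> (\<forall>m. 0 < m \<and> m < k \<longrightarrow> e (j + s + s * m) = 0))"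
    (is "?l \<longleftrightarrow> ?r")
proof
  assume ?l
  then obtain k where k: "0 < k" "P (e (j + s * k))" "\<forall>m. 0 < m \<and> m < k \<longrightarrow> e (j + s * m) = 0" by blast
  show ?r
  proof (cases "k = 1")
    case True
    then show ?thesis using k by simp
  next
    case False
    then have "e (j + s) = 0" using k(1) spec[OF k(3), of 1] by simp
    moreover have "P (e (j + s + s * (k - 1)))" using k(2) by (simp add: algebra_simps)
    moreover have "e (j + s + s * m) = 0" if "0 < m" "m < k - 1" for m
      using spec[OF k(3), of "m + 1"] that by (simp add: algebra_simps)
    ultimately show ?thesis using k(1) False by (intro disjI2 conjI exI[of _ "k - 1"]) auto
  qed
next
  assume ?r
  then show ?l
  proof (elim disjE conjE exE)
    assume "P (e (j + s))"
    then show ?l by (intro exI[of _ 1]) simp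
  next
    fix k assume e0: "e (j + s) = 0" and k: "0 < k" "P (e (j + s + s * k))"
      "\<forall>m. 0 < m \<and> m < k \<longrightarrow> e (j + s + s * m) = 0"
    have "e (j + s * m) = 0" if "0 < m" "m < k + 1" for m
      using spec[OF k(3), of "m - 1"] e0 that by (cases "m = 1") (auto simp: algebra_simps)
    moreover have "P (e (j + s * (k + 1)))" using k(2) by (simp add: algebra_simps)
    ultimately show ?l using k(1) by (intro exI[of _ "k + 1"]) auto
  qed
qed

definition right_neg :: "int list \<Rightarrow> int \<Rightarrow> bool" where
  "right_neg ws j \<longleftrightarrow> (\<exists>k>0. ent ws (j + k) < 0 \<and> (\<forall>m. 0 < m \<and> m < k \<longrightarrow> ent ws (j + m) = 0))"

definition left_neg :: "int list \<Rightarrow> int \<Rightarrow> bool" where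
  "left_neg ws j \<longleftrightarrow> (\<exists>k>0. ent ws (j - k) < 0 \<and> (\<forall>m. 0 < m \<and> m < k \<longrightarrow> ent ws (j - m) = 0))"

definition left_pos :: "int list \<Rightarrow> int \<Rightarrow> bool" where
  "left_pos ws j \<longleftrightarrow> (\<exists>k>0. 0 < ent ws (j - k) \<and> (\<forall>m. 0 < m \<and> m < k \<longrightarrow> ent ws (j - m) = 0))"

lemma right_neg_step: "right_neg ws j \<longleftrightarrow> ent ws (j + 1) < 0 \<or> ent ws (j + 1) = 0 \<and> right_neg ws (j + 1)"
  unfolding right_neg_def using first_step[of 1 "\<lambda>x. x < 0" "ent ws" j] by (simp add: add_ac)

lemma left_neg_step: "left_neg ws j \<longleftrightarrow> ent ws (j - 1) < 0 \<or> ent ws (j - 1) = 0 \<and> left_neg ws (j - 1)"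
  unfolding left_neg_def using first_step[of "-1" "\<lambda>x. x < 0" "ent ws" j] by simp

lemma left_pos_step: "left_pos ws j \<longleftrightarrow> 0 < ent ws (j - 1) \<or> ent ws (j - 1) = 0 \<and> left_pos ws (j - 1)"
  unfolding left_pos_def using first_step[of "-1" "\<lambda>x. 0 < x" "ent ws" j] by simp

lemma not_left_neg_pos: "\<not> (left_neg ws j \<and> left_pos ws j)"
proof
  assume "left_neg ws j \<and> left_pos ws j"
  then obtain k l where k: "0 < k" "ent ws (j - k) < 0" "\<forall>m. 0 < m \<and> m < k \<longrightarrow> ent ws (j - m) = 0"
    and l: "0 < l" "0 < ent ws (j - l)" "\<forall>m. 0 < m \<and> m < l \<longrightarrow> ent ws (j - m) = 0"
    unfolding left_neg_def left_pos_def by blast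
  consider "k < l" | "k = l" | "l < k" by linarith
  then show False
    using k(1,2) l(1,2) spec[OF k(3), of l] spec[OF l(3), of k] by cases auto
qed

lemma pos_sign_iff:
  "pos_sign ws j \<longleftrightarrow> 0 < ent ws j \<or> ent ws j = 0 \<and> \<not> right_neg ws j \<and> \<not> left_neg ws j"
  using pos_sign_nonzero[of ws j] pos_sign_zero[of ws j]
  by (cases "ent ws j = 0") (auto simp: right_neg_def left_neg_def)

lemma after_pos_iff: "after_pos ws j \<longleftrightarrow> \<not> pos_sign ws j \<and> ent ws j = 0 \<and> left_pos ws j"
  by (simp add: after_pos_def left_pos_def)

lemma band_signs_word:
  assumes "ws \<noteq> []"
  shows "band_signs (ent ws) (ent (convert_word ws)) (pos_sign ws) (after_pos ws)"
proof
  fix j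
  show "pos_sign ws j \<Longrightarrow> 0 \<le> ent ws j" "\<not> pos_sign ws j \<Longrightarrow> ent ws j \<le> 0"
    by (auto simp: pos_sign_iff)
  show "pos_sign ws (j - 1) \<and> pos_sign ws (j + 1)" if "pos_sign ws j" "ent ws j = 0"
  proof -
    have "\<not> right_neg ws j" "\<not> left_neg ws j" using that by (simp_all add: pos_sign_iff)
    then show ?thesis
      using right_neg_step[of ws j] left_neg_step[of ws j] right_neg_step[of ws "j - 1"]
        left_neg_step[of ws "j + 1"] that(2)
      by (auto simp: pos_sign_iff)
  qed
  show "\<not> pos_sign ws (j - 1) \<or> \<not> pos_sign ws (j + 1)" if "\<not> pos_sign ws j" "ent ws j = 0"
  proof -
    have "right_neg ws j \<or> left_neg ws j" using that by (simp add: pos_sign_iff)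
    then show ?thesis
      using right_neg_step[of ws j] left_neg_step[of ws j] by (auto simp: pos_sign_iff)
  qed
  show "after_pos ws j = (\<not> pos_sign ws j \<and> ent ws j = 0 \<and> (pos_sign ws (j - 1) \<or> after_pos ws (j - 1)))"
    using left_pos_step[of ws j] left_neg_step[of ws j] right_neg_step[of ws "j - 1"]
      not_left_neg_pos[of ws "j - 1"]
    by (auto simp: after_pos_iff pos_sign_iff)
  show "\<not> pos_sign ws (j + 1)" if "after_pos ws j"
  proof -
    \<comment> \<open>The first nonzero entry on the left is positive, so the negative sign can only
      come from the right.\<close>
    have "right_neg ws j" using that not_left_neg_pos[of ws j] by (auto simp: after_pos_iff pos_sign_iff)
    then show ?thesis using right_neg_step[of ws j] by (auto simp: pos_sign_iff)
  qed
  show "\<exists>i>0. \<not> after_pos ws (j + int i)"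
  \<comment> \<open>An endless run would make every entry 0 by cyclicity and leave no positive entry
    for \<open>left_pos\<close>.\<close>
  proof (rule ccontr)
    assume "\<not> (\<exists>i>0. \<not> after_pos ws (j + int i))"
    then have all: "after_pos ws (j + int i)" if "0 < i" for i using that by blast
    have zero: "ent ws i = 0" for i
    proof -
      let ?n = "int (length ws)"
      have n: "0 < ?n" using assms by simp
      \<comment> \<open>The additional \<open>?n\<close> keeps the offset positive, since
        \<open>all\<close> says nothing about the offset 0.\<close>
      have pos: "0 < (i - j) mod ?n + ?n" using n by (simp add: add_nonneg_pos)
      have "(j + ((i - j) mod ?n + ?n)) mod ?n = i mod ?n"
        by (simp only: add.assoc[symmetric] mod_add_self2 mod_add_right_eq) simp
      then have "ent ws i = ent ws (j + int (nat ((i - j) mod ?n + ?n)))"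
        using pos by (intro ent_cong) simp
      also have "\<dots> = 0"
        using all[of "nat ((i - j) mod ?n + ?n)"] pos by (simp only: after_pos_iff zero_less_nat_eq)
      finally show ?thesis .
    qed
    have "left_pos ws (j + 1)" using all[of 1] by (simp add: after_pos_iff)
    then show False by (auto simp: left_pos_def zero)
  qed
  show "ent (convert_word ws) j = ent ws j - 1 + of_bool (pos_sign ws (j - 1)) + of_bool (pos_sign ws j)
      + of_bool (pos_sign ws (j + 1))"
    by (simp add: ent_convert_word[OF assms] correction_def sign_word_of_bool)
qed

text \<open>Serves two instances, the identity of S for the cofactor and \<open>toA\<close> for the
  kernel, so that the columns of \<open>phi\<close> are computed once for both rings.\<close>

definition ring_map :: "(pser \<Rightarrow> 'r::comm_ring_1) \<Rightarrow> bool" where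
  "ring_map h \<longleftrightarrow> h 0 = 0 \<and> h 1 = 1 \<and> (\<forall>a b. h (a + b) = h a + h b) \<and> (\<forall>a b. h (a * b) = h a * h b)"

lemma ring_map_id: "ring_map (\<lambda>x. x)" and ring_map_toA: "ring_map toA"
  by (auto simp: ring_map_def)

lemma ring_map_simps:
  assumes "ring_map h"
  shows "h 0 = 0" "h 1 = 1" "h (a + b) = h a + h b" "h (a * b) = h a * h b" "h (- a) = - h a"
    "h (a - b) = h a - h b"
proof -
  show 1: "h 0 = 0" "h 1 = 1" "h (a + b) = h a + h b" "h (a * b) = h a * h b" for a b
    using assms by (auto simp: ring_map_def)
  show 2: "h (- a) = - h a" for a
    using 1(1) 1(3)[of a "- a"] by (simp add: eq_neg_iff_add_eq_0 add.commute)
  show "h (a - b) = h a - h b" using 1(3)[of a "- b"] 2 by simp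
qed

lemma constS_simps: "constS 1 = 1" "constS 0 = 0" "constS (a * b) = constS a * constS b"
  by (simp_all add: constS_def)

section \<open>Quasi-periodic sequences\<close>

locale quasi_periodic =
  fixes vw :: "int list" and n :: nat and lam :: complex
  assumes len: "length vw = n" and n_ge: "3 \<le> n" and n_mod: "int n mod 3 = 0" and lam_nz: "lam \<noteq> 0"
begin

text \<open>The convention is that going back by \<open>n\<close> multiplies by \<open>lam\<close>;
  hence \<open>q\<close> turns forward cost the power \<open>- q\<close>.\<close>

definition twist :: "(pser \<Rightarrow> 'r::comm_ring_1) \<Rightarrow> int \<Rightarrow> 'r" where
  "twist h q = h (constS (power_int lam (- q)))"

lemma twist_add: "ring_map h \<Longrightarrow> twist h (q + r) = twist h q * twist h r"
  using lam_nz power_int_add[of lam "- q" "- r"]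
  by (simp add: twist_def constS_simps ring_map_simps)

lemma twist_simps:
  assumes "ring_map h"
  shows "twist h 0 = 1" "twist h 1 = h (constS (inverse lam))" "twist h (- 1) = h (constS lam)"
  by (simp_all add: twist_def constS_simps power_int_minus ring_map_simps[OF assms])

definition unroll :: "(pser \<Rightarrow> 'r::comm_ring_1) \<Rightarrow> (nat \<Rightarrow> 'r) \<Rightarrow> int \<Rightarrow> 'r" where
  "unroll h u j = twist h ((j - 1) div int n) * u (nat ((j - 1) mod int n))"

lemma unroll_shift:
  assumes "ring_map h"
  shows "unroll h u (j + int n * q) = twist h q * unroll h u j"
proof -
  have "j + int n * q - 1 = j - 1 + int n * q" by simp
  moreover have "(j - 1 + int n * q) div int n = q + (j - 1) div int n" "(j - 1 + int n * q) mod int n = (j - 1) mod int n"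
    using n_ge by simp_all
  ultimately have "unroll h u (j + int n * q) = twist h (q + (j - 1) div int n) * u (nat ((j - 1) mod int n))"
    unfolding unroll_def by (simp only:)
  then show ?thesis
    by (simp add: unroll_def twist_add[OF assms] mult.assoc)
qed

lemma unroll_base: "ring_map h \<Longrightarrow> i < n \<Longrightarrow> unroll h u (int i + 1) = u i"
  by (simp add: unroll_def twist_simps)

lemma quasi_periodic_shift:
  assumes h: "ring_map h" and U: "\<And>j. U (j - int n) = h (constS lam) * U j"
  shows "U (j + int n * q) = twist h q * U j"
proof (induction q rule: int_induct[where k = 0])
  case base
  then show ?case by (simp add: twist_simps[OF h])
next
  case (step1 q)
  have e: "j + int n * (q + 1) - int n = j + int n * q" by (simp add: distrib_left)
  have "U (j + int n * q) = h (constS lam) * U (j + int n * (q + 1))"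
    using U[of "j + int n * (q + 1)"] unfolding e .
  then have "twist h 1 * U (j + int n * q) = (twist h 1 * h (constS lam)) * U (j + int n * (q + 1))"
    by (simp only: mult.assoc)
  also have "twist h 1 * h (constS lam) = 1"
    using twist_add[OF h, of 1 "-1"] by (simp add: twist_simps[OF h])
  finally have f: "U (j + int n * (q + 1)) = twist h 1 * (twist h q * U j)"
    by (simp only: step1(2) mult_1_left)
  show ?case by (simp add: f twist_add[OF h] mult_ac)
next
  case (step2 q)
  have e: "j + int n * q - int n = j + int n * (q - 1)" by (simp add: right_diff_distrib)
  have "U (j + int n * (q - 1)) = h (constS lam) * U (j + int n * q)"
    using U[of "j + int n * q"] unfolding e .
  also have "\<dots> = twist h (q + - 1) * U j"
    unfolding step2(2) twist_add[OF h] twist_simps[OF h] by (simp only: mult_ac)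
  finally show ?case by simp
qed

lemma unroll_eq:
  assumes "ring_map h" and "\<And>j. U (j - int n) = h (constS lam) * U j"
  shows "unroll h (\<lambda>i. U (int i + 1)) j = U j"
proof -
  have e: "(j - 1) mod int n + 1 + int n * ((j - 1) div int n) = j" by simp
  have "0 \<le> (j - 1) mod int n" using n_ge by simp
  moreover have "U j = twist h ((j - 1) div int n) * U ((j - 1) mod int n + 1)"
    using quasi_periodic_shift[where U = U, OF assms, of "(j - 1) mod int n + 1" "(j - 1) div int n"] unfolding e .
  ultimately show ?thesis by (simp add: unroll_def)
qed

definition rel :: "(pser \<Rightarrow> 'r::comm_ring_1) \<Rightarrow> (int \<Rightarrow> 'r) \<Rightarrow> int \<Rightarrow> 'r" where
  "rel h U s = h (chi (s - 1)) * U s - (h (chi_pow s (ent vw s - 1)) * U (s - 1)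
     + h (chi_pow (s + 1) (- ent vw (s + 1))) * U (s + 1))"

lemma ent_per: "ent vw (j + int n * q) = ent vw j"
  by (rule ent_cong) (simp add: len)

lemma chi_per: "chi (j + int n * q) = chi j"
proof (rule chi_cong)
  have "3 dvd int n" using n_mod by (simp add: dvd_eq_mod_eq_0)
  then show "(j + int n * q) mod 3 = j mod 3" by (simp add: mod_eq_dvd_iff)
qed

lemma chi_pow_per: "chi_pow (j + int n * q) a = chi_pow j a"
  by (simp add: chi_pow_def chi_per)

lemma rel_shift:
  assumes "ring_map h"
  shows "rel h (unroll h u) (s + int n * q) = twist h q * rel h (unroll h u) s"
proof -
  have "s + int n * q - 1 = s - 1 + int n * q" "s + int n * q + 1 = s + 1 + int n * q" by simp_all
  then show ?thesis
    unfolding rel_def by (simp only: chi_per chi_pow_per ent_per unroll_shift[OF assms])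
      (simp only: right_diff_distrib distrib_left mult_ac)
qed

lemma sum_delta_int:
  fixes a :: "nat \<Rightarrow> 'r::comm_ring_1"
  shows "(\<Sum>i<n. if int i + 1 = k then a i else 0) = (if 1 \<le> k \<and> k \<le> int n then a (nat (k - 1)) else 0)"
proof (cases "1 \<le> k")
  case True
  then have "(\<Sum>i<n. if int i + 1 = k then a i else 0) = (\<Sum>i<n. if i = nat (k - 1) then a i else 0)"
    by (intro sum.cong) auto
  then show ?thesis using True by (auto simp: sum.delta')
next
  case False
  then show ?thesis by (auto intro!: sum.neutral)
qed

text \<open>The corner entries of \<open>phi\<close> are ordinary neighbour entries for the unrolled
  sequence, whose value at 0 is \<open>lam\<close> times the last coordinate and at
  \<open>n + 1\<close> the inverse of \<open>lam\<close> times the first. \<open>n_ge\<close> keeps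
  the corners off the three diagonals.\<close>

lemma col_sum:
  fixes h :: "pser \<Rightarrow> 'r::comm_ring_1"
  assumes h: "ring_map h" and s: "s < n"
  shows "(\<Sum>i<n. h (phi vw lam $$ (i, s)) * u i) = rel h (unroll h u) (int s + 1)"
proof -
  let ?s = "int s + 1"
  let ?a = "h (chi (?s - 1))" and ?b = "- h (chi_pow ?s (ent vw ?s - 1))" and ?c = "- h (chi_pow (?s + 1) (- ent vw (?s + 1)))"
  let ?d = "- h (constS lam) * h (chi_pow 1 (ent vw 1 - 1))"
  let ?e = "- h (constS (inverse lam)) * h (chi_pow 1 (- ent vw 1))"
  note hs = ring_map_simps[OF h]
  note [simp] = index_comm[where g = "ent vw"] index_comm[where g = "unroll h u"]
  have "h (phi vw lam $$ (i, s)) * u i =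
      (if int i + 1 = ?s then ?a * u i else 0) + (if int i + 1 = ?s - 1 then ?b * u i else 0)
    + (if int i + 1 = ?s + 1 then ?c * u i else 0) + (if int i + 1 = int n then (if s = 0 then ?d * u i else 0) else 0)
    + (if int i + 1 = 1 then (if ?s = int n then ?e * u i else 0) else 0)" if "i < n" for i
  proof -
    consider "i = s" | "s = Suc i" | "i = Suc s" | "Suc i = n" "s = 0" | "i = 0" "Suc s = n"
      | "i \<noteq> s" "s \<noteq> Suc i" "i \<noteq> Suc s" "\<not> (Suc i = n \<and> s = 0)" "\<not> (i = 0 \<and> Suc s = n)"
      by blast
    then show ?thesis
    proof cases
      case 4
      then show ?thesis using that s n_ge by (simp add: phi_def len phi_entry_def hs of_nat_diff flip: of_nat_Suc)
    qed (use that s n_ge in \<open>simp_all add: phi_def len phi_entry_def hs\<close>)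
  qed
  then have "(\<Sum>i<n. h (phi vw lam $$ (i, s)) * u i) =
      (\<Sum>i<n. if int i + 1 = ?s then ?a * u i else 0) + (\<Sum>i<n. if int i + 1 = ?s - 1 then ?b * u i else 0)
    + (\<Sum>i<n. if int i + 1 = ?s + 1 then ?c * u i else 0)
    + (\<Sum>i<n. if int i + 1 = int n then (if s = 0 then ?d * u i else 0) else 0)
    + (\<Sum>i<n. if int i + 1 = 1 then (if ?s = int n then ?e * u i else 0) else 0)"
    by (simp add: sum.distrib)
  also have "\<dots> = ?a * u s + (if s = 0 then 0 else ?b * u (s - 1)) + (if ?s = int n then 0 else ?c * u (s + 1))
    + (if s = 0 then ?d * u (n - 1) else 0) + (if ?s = int n then ?e * u 0 else 0)"
    using s n_ge unfolding sum_delta_int by (auto simp: nat_add_distrib nat_diff_distrib)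
  also have "\<dots> = ?a * u s + ?b * unroll h u (?s - 1) + ?c * unroll h u (?s + 1)"
  proof -
    have 1: "(if s = 0 then 0 else ?b * u (s - 1)) + (if s = 0 then ?d * u (n - 1) else 0) = ?b * unroll h u (?s - 1)"
    proof (cases "s = 0")
      case True
      have "unroll h u 0 = h (constS lam) * u (n - 1)"
        using unroll_shift[OF h, of u "int n" "-1"] unroll_base[OF h, of "n - 1" u] n_ge
        by (simp add: of_nat_diff twist_simps[OF h])
      then show ?thesis using True by (simp add: mult_ac)
    next
      case False
      then show ?thesis using unroll_base[OF h, of "s - 1" u] s by (simp add: of_nat_diff)
    qed
    have 2: "(if ?s = int n then 0 else ?c * u (s + 1)) + (if ?s = int n then ?e * u 0 else 0) = ?c * unroll h u (?s + 1)"
    proof (cases "?s = int n")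
      case True
      have "unroll h u (1 + int n) = h (constS (inverse lam)) * u 0"
        using unroll_shift[OF h, of u 1 1] unroll_base[OF h, of 0 u] n_ge
        by (simp add: twist_simps[OF h])
      moreover have "chi_pow (1 + int n) = chi_pow 1" "ent vw (1 + int n) = ent vw 1"
        using chi_pow_per[of 1 1] ent_per[of 1 1] by (auto intro!: ext)
      ultimately show ?thesis using True by (simp add: mult_ac)
    next
      case False
      then show ?thesis using unroll_base[OF h, of "s + 1" u] s by simp
    qed
    show ?thesis unfolding 1[symmetric] 2[symmetric] by (simp only: add_ac)
  qed
  also have "\<dots> = rel h (unroll h u) ?s"
  proof -
    have "x - (y * p + z * q) = x + - y * p + - z * q" for x y z p q :: 'r
      by simp
    then show ?thesis by (simp only: rel_def unroll_base[OF h s])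
  qed
  finally show ?thesis .
qed

lemma reduce_index: "\<exists>r<n. \<exists>q. s = int r + 1 + int n * q"
proof (intro exI conjI)
  show "nat ((s - 1) mod int n) < n" using n_ge by (simp add: nat_less_iff)
  have "0 \<le> (s - 1) mod int n" using n_ge by simp
  then show "s = int (nat ((s - 1) mod int n)) + 1 + int n * ((s - 1) div int n)" by simp
qed

lemma rel_eq_0_iff:
  assumes "ring_map h"
  shows "(\<forall>s<n. (\<Sum>i<n. h (phi vw lam $$ (i, s)) * u i) = 0) \<longleftrightarrow> (\<forall>s. rel h (unroll h u) s = 0)"
proof
  assume *: "\<forall>s<n. (\<Sum>i<n. h (phi vw lam $$ (i, s)) * u i) = 0"
  show "\<forall>s. rel h (unroll h u) s = 0"
  proof
    fix s
    obtain r q where r: "r < n" "s = int r + 1 + int n * q" using reduce_index by blast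
    have "rel h (unroll h u) (int r + 1) = 0"
      unfolding col_sum[OF assms r(1), symmetric] using * r(1) by blast
    then show "rel h (unroll h u) s = 0"
      unfolding r(2) rel_shift[OF assms] by simp
  qed
qed (simp add: col_sum[OF assms])

end

section \<open>Units of the power series ring\<close>

lemma fps_dvd_1: "fps_nth a 0 dvd 1 \<Longrightarrow> a dvd 1" for a :: "'a::comm_ring_1 fps"
proof -
  assume "fps_nth a 0 dvd 1"
  then obtain y where "fps_nth a 0 * y = 1" by (metis dvdE)
  then have "a * fps_right_inverse a y = 1" by (rule fps_right_inverse)
  then show "a dvd 1" by (metis dvdI)
qed

definition const_coeff :: "pser \<Rightarrow> complex" where
  "const_coeff a = fps_nth (fps_nth (fps_nth a 0) 0) 0"

lemma pser_dvd_1: "const_coeff a \<noteq> 0 \<Longrightarrow> a dvd 1"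
  unfolding const_coeff_def by (intro fps_dvd_1) (simp add: dvd_field_iff)

lemma const_coeff_simps:
  "const_coeff (a * b) = const_coeff a * const_coeff b" "const_coeff (a - b) = const_coeff a - const_coeff b"
  "const_coeff 1 = 1" "const_coeff (constS x) = x"
  by (simp_all add: const_coeff_def fps_mult_nth_0 constS_def)

lemma const_coeff_power: "const_coeff (a ^ k) = const_coeff a ^ k"
  by (induction k) (simp_all add: const_coeff_simps)

lemma const_coeff_chi_pow: "const_coeff (chi_pow j a) = of_bool (a = 0)"
proof -
  have "const_coeff (chi j) = 0" by (simp add: const_coeff_def chi_def xS_def yS_def zS_def)
  then show ?thesis by (simp add: chi_pow_def const_coeff_power power_0_left) (simp add: const_coeff_def)
qed

lemma const_coeff_prod: "const_coeff (\<Prod>i\<in>I. f i) = (\<Prod>i\<in>I. const_coeff (f i))"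
  by (induction I rule: infinite_finite_induct) (simp_all add: const_coeff_simps)

text \<open>A factor with nonzero exponent has constant coefficient 0, also for a negative exponent,
  where the factor itself is 0. So the difference has constant coefficient 1.\<close>

lemma unit_1_minus_prod:
  fixes i0 n :: nat
  assumes "i0 < n" "e i0 \<noteq> 0"
  shows "1 - constS c * (\<Prod>i<n. chi_pow (j i) (e i)) dvd 1"
proof (rule pser_dvd_1)
  have 0: "(\<Prod>i<n. of_bool (e i = 0)) = (0 :: complex)"
    using assms by (intro prod_zero) auto
  then show "const_coeff (1 - constS c * (\<Prod>i<n. chi_pow (j i) (e i))) \<noteq> 0"
    unfolding const_coeff_simps const_coeff_prod const_coeff_chi_pow 0 by simp
qed

section \<open>Band data\<close>

locale band_datum =
  fixes w :: "int list" and \<tau> :: nat and lam :: complex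
  assumes tau: "\<tau> \<ge> 1" and len_w: "length w = 3 * \<tau>" and lam_nz: "lam \<noteq> 0"
    and nondeg: "\<not> degenerate w lam" and nonper: "\<not> periodic_word w"
begin

abbreviation "n \<equiv> 3 * \<tau>"

sublocale quasi_periodic "convert_word w" n lam
  by unfold_locales (use tau lam_nz in \<open>auto simp: convert_word_def len_w\<close>)

lemma w_nonempty: "w \<noteq> []"
  using len_w tau by auto

sublocale band_signs "ent w" "ent (convert_word w)" "pos_sign w" "after_pos w"
  by (rule band_signs_word[OF w_nonempty])

lemma ent_behind: "\<exists>i<n. ent w (s - int i) = ent w j"
proof -
  define i where "i = nat ((s - j) mod int n)"
  have n: "0 < int n" using tau by simp
  have i: "int i = (s - j) mod int n" using n by (simp add: i_def)
  then have "i < n" using n by (metis of_nat_less_iff pos_mod_bound)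
  moreover have "ent w (s - int i) = ent w j"
    unfolding i by (rule ent_cong) (metis len_w mod_diff_right_eq diff_diff_eq2 add_diff_cancel_left')
  ultimately show ?thesis by blast
qed

lemma ent_ahead: "\<exists>i<n. ent w (s + int i) = ent w j"
proof -
  define i where "i = nat ((j - s) mod int n)"
  have n: "0 < int n" using tau by simp
  have i: "int i = (j - s) mod int n" using n by (simp add: i_def)
  then have "i < n" using n by (metis of_nat_less_iff pos_mod_bound)
  moreover have "ent w (s + int i) = ent w j"
    unfolding i by (rule ent_cong) (metis len_w mod_add_right_eq add_diff_cancel_left' diff_add_eq add.commute)
  ultimately show ?thesis by blast
qed

text \<open>Non-periodicity and non-degeneracy enter here: the zero word is invariant under rotation
  by 3, and for length 3 only \<open>lam = 1\<close> makes it degenerate.\<close>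

lemma zero_word: assumes "\<And>j. ent w j = 0" shows "\<tau> = 1" "lam \<noteq> 1"
proof -
  have w: "w = replicate (length w) 0"
  proof (intro nth_equalityI)
    fix i assume "i < length w"
    then show "w ! i = replicate (length w) 0 ! i" using assms[of "int i + 1"] by (simp add: ent_def)
  qed simp
  show "\<tau> = 1"
  proof (rule ccontr)
    assume "\<tau> \<noteq> 1"
    then have "1 < \<tau>" using tau by simp
    moreover have "rotate (3 * 1) w = w"
      by (subst (1 2) w) (rule nth_equalityI, simp_all add: nth_rotate w_nonempty)
    ultimately have "periodic_word w" unfolding periodic_word_def len_w by (intro exI[of _ 1]) simp
    then show False using nonper by simp
  qed
  then have "w = [0, 0, 0]" using w len_w by (simp add: numeral_3_eq_3)
  then show "lam \<noteq> 1" using nondeg by (simp add: degenerate_def)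
qed

lemma unit_pos: "1 - constS lam * (\<Prod>i<n. chi_pow (s - int i) (ent w (s - int i))) dvd 1"
proof (cases "\<exists>j. ent w j \<noteq> 0")
  case True
  then obtain j where "ent w j \<noteq> 0" by blast
  then obtain i where "i < n" "ent w (s - int i) \<noteq> 0" using ent_behind[of s j] by auto
  then show ?thesis by (rule unit_1_minus_prod[where e = "\<lambda>i. ent w (s - int i)"])
next
  case False
  then have "ent w j = 0" for j by blast
  with zero_word(2) show ?thesis by (intro pser_dvd_1) (simp add: const_coeff_simps)
qed

lemma unit_neg:
  assumes "\<And>j. \<not> pos_sign w j"
  shows "1 - constS (inverse lam) * (\<Prod>i<n. chi_pow (s + int i) (- ent w (s + int i))) dvd 1"
proof (cases "\<exists>j. ent w j \<noteq> 0")
  case True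
  then obtain j where "ent w j \<noteq> 0" by blast
  then obtain i where "i < n" "- ent w (s + int i) \<noteq> 0" using ent_ahead[of s j] by auto
  then show ?thesis by (rule unit_1_minus_prod[where e = "\<lambda>i. - ent w (s + int i)"])
next
  case False
  then have "ent w j = 0" for j by blast
  \<comment> \<open>The zero word has no negative sign, so this case contradicts the
    assumption.\<close>
  then have "pos_sign w 0" by (simp add: pos_sign_iff right_neg_def left_neg_def)
  then show ?thesis using assms by blast
qed

text \<open>The image of \<open>phi\<close>, with functions in place of vectors to fit
  \<open>band_relations\<close>; values beyond \<open>n\<close> are left free.\<close>

definition columns :: "(nat \<Rightarrow> pser) set" where
  "columns = {x. \<exists>c. \<forall>r<n. x r = (\<Sum>s<n. phi (convert_word w) lam $$ (r, s) * c s)}"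

lemma xyz_column:
  assumes "k < n"
  shows "(\<lambda>r. xS * yS * zS * of_bool (r = k)) \<in> columns"
proof -
  let ?v = "convert_word w" and ?id = "\<lambda>x :: pser. x"
  define E where "E j r = unroll ?id (\<lambda>i. of_bool (r = i)) j" for j r
  have rel_E: "(\<lambda>r. rel ?id (\<lambda>j. E j r) s) \<in> columns" for s
  proof -
    obtain i q where i: "i < n" "s = int i + 1 + int n * q" using reduce_index by blast
    have "rel ?id (\<lambda>j. E j r) s = twist ?id q * phi ?v lam $$ (r, i)" if "r < n" for r
    proof -
      have "rel ?id (\<lambda>j. E j r) s = twist ?id q * rel ?id (\<lambda>j. E j r) (int i + 1)"
        unfolding i(2) E_def by (rule rel_shift[OF ring_map_id])
      \<comment> \<open>For fixed \<open>r\<close>, \<open>E j r\<close> is the unrolled indicator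
        of \<open>r\<close>, so the column sum reads off the entry of \<open>phi\<close> in row
        \<open>r\<close>.\<close>
      also have "rel ?id (\<lambda>j. E j r) (int i + 1) = (\<Sum>k<n. phi ?v lam $$ (k, i) * of_bool (r = k))"
        unfolding E_def by (rule col_sum[OF ring_map_id i(1), symmetric])
      also have "\<dots> = phi ?v lam $$ (r, i)"
        using that by (simp add: of_bool_def if_distrib[of "\<lambda>x. _ * x"] sum.delta cong: if_cong)
      finally show ?thesis .
    qed
    then show ?thesis
      using i(1) unfolding columns_def
      by (auto intro!: exI[of _ "\<lambda>k. twist ?id q * of_bool (k = i)"]
          simp: of_bool_def if_distrib[of "\<lambda>x. _ * x"] sum.delta mult_ac cong: if_cong)
  qed
  have per: "E (j - int n) r = constS lam * E j r" for j r
    using unroll_shift[OF ring_map_id, of "\<lambda>i. of_bool (r = i)" j "-1"]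
    by (simp add: E_def twist_simps[OF ring_map_id])
  have ent_v: "ent ?v (s - int n) = ent ?v s" for s using ent_per[of s "-1"] by simp
  interpret band_relations "ent w" "ent ?v" "pos_sign w" "after_pos w" columns E n lam
  proof
    show "(\<lambda>i. x i + y i) \<in> columns" if xy: "x \<in> columns" "y \<in> columns" for x y
    proof -
      obtain a b where "\<forall>r<n. x r = (\<Sum>s<n. phi ?v lam $$ (r, s) * a s)" "\<forall>r<n. y r = (\<Sum>s<n. phi ?v lam $$ (r, s) * b s)"
        using xy unfolding columns_def by blast
      then show ?thesis unfolding columns_def
        by (auto intro!: exI[of _ "\<lambda>s. a s + b s"] simp: sum.distrib distrib_left)
    qed
    show "(\<lambda>i. a * x i) \<in> columns" if xy: "x \<in> columns" for a x
    proof -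
      obtain b where "\<forall>r<n. x r = (\<Sum>s<n. phi ?v lam $$ (r, s) * b s)"
        using xy unfolding columns_def by blast
      then show ?thesis unfolding columns_def
        by (auto intro!: exI[of _ "\<lambda>s. a * b s"] simp: sum_distrib_left mult.left_commute)
    qed
    show "(\<lambda>i. 0) \<in> columns" by (auto simp: columns_def intro!: exI[of _ "\<lambda>s. 0"])
    show "(\<lambda>i. chi (s - 1) * E s i - (chi_pow s (ent ?v s - 1) * E (s - 1) i
        + chi_pow (s + 1) (- ent ?v (s + 1)) * E (s + 1) i)) \<in> columns" for s
      using rel_E[of s] by (simp only: rel_def)
    show "E (s - int n) i = constS lam * E s i" for s i by (rule per)
    show "ent w (s - int n) = ent w s" for s by (rule ent_cong) (simp add: len_w mod_eq_dvd_iff)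
    show "ent ?v (s - int n) = ent ?v s" for s by (rule ent_v)
  qed (use tau lam_nz unit_pos unit_neg in auto)
  have "E (int k + 1) r = of_bool (r = k)" for r
    unfolding E_def by (rule unroll_base[OF ring_map_id assms])
  then show ?thesis using xyz_E[of "int k + 1"] by simp
qed

lemma ex_psi:
  "\<exists>\<psi> \<in> carrier_mat n n. phi (convert_word w) lam * \<psi> = (xS * yS * zS) \<cdot>\<^sub>m 1\<^sub>m n"
proof -
  let ?\<phi> = "phi (convert_word w) lam"
  have phi: "?\<phi> \<in> carrier_mat n n" by (simp add: phi_def len)
  have "\<forall>k. \<exists>c. k < n \<longrightarrow> (\<forall>r<n. xS * yS * zS * of_bool (r = k) = (\<Sum>s<n. ?\<phi> $$ (r, s) * c s))"
    using xyz_column unfolding columns_def by blast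
  from choice[OF this] obtain c where c: "\<And>k r. k < n \<Longrightarrow> r < n \<Longrightarrow> xS * yS * zS * of_bool (r = k) = (\<Sum>s<n. ?\<phi> $$ (r, s) * c k s)"
    by blast
  let ?\<psi> = "mat n n (\<lambda>(s, k). c k s)"
  have "?\<phi> * ?\<psi> = (xS * yS * zS) \<cdot>\<^sub>m 1\<^sub>m n"
  proof (rule eq_matI)
    fix r k assume "r < dim_row ((xS * yS * zS) \<cdot>\<^sub>m 1\<^sub>m n)" "k < dim_col ((xS * yS * zS) \<cdot>\<^sub>m 1\<^sub>m n)"
    then have rk: "r < n" "k < n" by simp_all
    then have "(?\<phi> * ?\<psi>) $$ (r, k) = (\<Sum>s<n. ?\<phi> $$ (r, s) * c k s)"
      using phi by (simp add: scalar_prod_def atLeast0LessThan)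
    also have "\<dots> = ((xS * yS * zS) \<cdot>\<^sub>m 1\<^sub>m n) $$ (r, k)"
      using c[OF rk(2,1)] rk by (simp flip: c[OF rk(2,1)])
    finally show "(?\<phi> * ?\<psi>) $$ (r, k) = ((xS * yS * zS) \<cdot>\<^sub>m 1\<^sub>m n) $$ (r, k)" .
  qed (use phi in auto)
  then show ?thesis by (intro bexI[of _ ?\<psi>]) simp_all
qed

section \<open>The dual of the module\<close>

abbreviation "M_vecs \<equiv> carrier (M_tilde w lam)"

definition wneg :: "int \<Rightarrow> nat" where "wneg j = neg_part (ent w j)"

definition wpos :: "int \<Rightarrow> nat" where "wpos j = pos_part (ent w j)"

text \<open>The vectors e_i, extended quasi-periodically and repeated three times each so that the index runs through all entries of w.\<close>

definition base :: "int \<Rightarrow> cusp vec" where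
  "base j = twist toA ((j - 1) div int n) \<cdot>\<^sub>v unit_vec \<tau> (nat ((j - 1) mod int n) div 3)"

definition plane_gen :: "int \<Rightarrow> cusp vec" where
  "plane_gen j = toA (chi j * chi (j + 1)) ^ 2 \<cdot>\<^sub>v base j"

definition axis_gen :: "int \<Rightarrow> cusp vec" where
  "axis_gen j = toA (chi j ^ (wneg j + 2) * chi (j + 1)) \<cdot>\<^sub>v base j
     + toA (chi (j - 1) * chi j ^ (wpos j + 2)) \<cdot>\<^sub>v base (j - 1)"

lemma base_carrier [simp]: "base j \<in> carrier_vec \<tau>" "dim_vec (base j) = \<tau>"
  by (simp_all add: base_def)

lemma gen_carrier [simp]: "plane_gen j \<in> carrier_vec \<tau>" "axis_gen j \<in> carrier_vec \<tau>"
  by (simp_all add: plane_gen_def axis_gen_def)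

lemma base_shift: "base (j + int n * q) = twist toA q \<cdot>\<^sub>v base j"
proof -
  have e: "j + int n * q - 1 = j - 1 + int n * q" by simp
  have "(j - 1 + int n * q) div int n = q + (j - 1) div int n" "(j - 1 + int n * q) mod int n = (j - 1) mod int n"
    using tau by simp_all
  then show ?thesis
    unfolding base_def e by (simp add: twist_add[OF ring_map_toA] smult_smult_assoc)
qed

lemma base_eq:
  assumes "k < \<tau>" "t \<in> {1, 2, 3}"
  shows "base (3 * int k + t) = unit_vec \<tau> k"
proof -
  have "0 \<le> 3 * int k + t - 1" "3 * int k + t - 1 < int n" using assms by auto
  then have "(3 * int k + t - 1) div int n = 0" "(3 * int k + t - 1) mod int n = 3 * int k + t - 1"
    by simp_all
  moreover have "nat (3 * int k + t - 1) div 3 = k" using assms(2) by auto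
  ultimately show ?thesis by (simp add: base_def twist_simps[OF ring_map_toA])
qed

lemma gen_shift:
  "plane_gen (j + int n * q) = twist toA q \<cdot>\<^sub>v plane_gen j"
  "axis_gen (j + int n * q) = twist toA q \<cdot>\<^sub>v axis_gen j"
proof -
  have e: "j + int n * q + 1 = j + 1 + int n * q" "j + int n * q - 1 = j - 1 + int n * q" by simp_all
  have w: "wneg (j + int n * q) = wneg j" "wpos (j + int n * q) = wpos j"
    using ent_cong[of "j + int n * q" w j] by (simp_all add: wneg_def wpos_def len_w)
  show "plane_gen (j + int n * q) = twist toA q \<cdot>\<^sub>v plane_gen j"
    unfolding plane_gen_def e chi_per base_shift by (simp only: smult_smult_assoc mult.commute)
  show "axis_gen (j + int n * q) = twist toA q \<cdot>\<^sub>v axis_gen j"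
    unfolding axis_gen_def e chi_per base_shift w
    by (subst smult_add_distrib_vec[of _ \<tau>]) (simp_all only: smult_smult_assoc mult.commute base_carrier smult_carrier_vec)
qed

text \<open>The coefficient \<open>c\<close> of the generator with \<open>i = 1\<close> is absorbed
  in \<open>base 0\<close>, which is \<open>lam\<close> times the last unit vector.\<close>

lemma generators_eq:
  "generators w lam = (\<Union>k<\<tau>. {plane_gen (3 * int k + 1), plane_gen (3 * int k + 2), plane_gen (3 * int k + 3),
     axis_gen (3 * int k + 2), axis_gen (3 * int k + 3), axis_gen (3 * int k + 1)})"
proof -
  have image: "{1..int \<tau>} = (\<lambda>k. int k + 1) ` {..<\<tau>}"
  proof (intro equalityI subsetI)
    fix i assume "i \<in> {1..int \<tau>}"
    then show "i \<in> (\<lambda>k. int k + 1) ` {..<\<tau>}" by (intro image_eqI[of _ _ "nat (i - 1)"]) auto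
  qed auto
  have chi3: "chi (3 * int k) = zS" "chi (3 * int k + 1) = xS" "chi (3 * int k + 2) = yS" "chi (3 * int k + 3) = zS"
    "chi (3 * int k + 4) = xS" for k by (simp_all add: chi_def)
  have e: "basis_vec \<tau> (int k + 1) = unit_vec \<tau> k" if "k < \<tau>" for k
    using that by (simp add: basis_vec_def)
  have e': "(if int k + 1 = 1 then toA (constS lam) else 1) * a \<cdot>\<^sub>v basis_vec \<tau> (int k + 1 - 1) = a \<cdot>\<^sub>v base (3 * int k)"
    if k: "k < \<tau>" for k a
  proof (cases "k = 0")
    case True
    have "base (3 * int (\<tau> - 1) + 3 + int n * (- 1)) = toA (constS lam) \<cdot>\<^sub>v unit_vec \<tau> (\<tau> - 1)"
      unfolding base_shift using base_eq[of "\<tau> - 1" 3] tau by (simp add: twist_simps[OF ring_map_toA])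
    moreover have "3 * int (\<tau> - 1) + 3 + int n * (- 1) = 0" using tau by (simp add: of_nat_diff)
    moreover have "nat (- 1 mod int \<tau>) = \<tau> - 1"
      using tau by (simp add: zmod_minus1 nat_diff_distrib)
    ultimately show ?thesis using True by (simp add: basis_vec_def smult_smult_assoc mult.commute)
  next
    case False
    then have "base (3 * int (k - 1) + 3) = unit_vec \<tau> (k - 1)" using k by (intro base_eq) auto
    moreover have "3 * int (k - 1) + 3 = 3 * int k" "nat ((int k - 1) mod int \<tau>) = k - 1"
      using False k by (simp_all add: of_nat_diff nat_diff_distrib)
    ultimately show ?thesis using False by (simp add: basis_vec_def)
  qed
  have idx: "3 * (int k + 1) - 2 = 3 * int k + 1" "3 * (int k + 1) - 1 = 3 * int k + 2" "3 * (int k + 1) = 3 * int k + 3"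
    "3 * int k + 3 - 2 = 3 * int k + 1" "3 * int k + 3 - 1 = 3 * int k + 2" for k
    by simp_all
  have b: "base (3 * int k + 1) = unit_vec \<tau> k" "base (3 * int k + 2) = unit_vec \<tau> k" "base (3 * int k + 3) = unit_vec \<tau> k"
    if "k < \<tau>" for k using base_eq[OF that] by simp_all
  have p: "plane_gen (3 * int k + 1) = (xA^2 * yA^2) \<cdot>\<^sub>v basis_vec \<tau> (int k + 1)"
    "plane_gen (3 * int k + 2) = (yA^2 * zA^2) \<cdot>\<^sub>v basis_vec \<tau> (int k + 1)"
    "plane_gen (3 * int k + 3) = (zA^2 * xA^2) \<cdot>\<^sub>v basis_vec \<tau> (int k + 1)"
    "axis_gen (3 * int k + 2) = (xA * yA ^ (wpos (3 * int k + 2) + 2) + yA ^ (wneg (3 * int k + 2) + 2) * zA) \<cdot>\<^sub>v basis_vec \<tau> (int k + 1)"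
    "axis_gen (3 * int k + 3) = (yA * zA ^ (wpos (3 * int k + 3) + 2) + zA ^ (wneg (3 * int k + 3) + 2) * xA) \<cdot>\<^sub>v basis_vec \<tau> (int k + 1)"
    "axis_gen (3 * int k + 1) = (xA ^ (wneg (3 * int k + 1) + 2) * yA) \<cdot>\<^sub>v basis_vec \<tau> (int k + 1) +
        ((if int k + 1 = 1 then toA (constS lam) else 1) * zA * xA ^ (wpos (3 * int k + 1) + 2)) \<cdot>\<^sub>v basis_vec \<tau> (int k + 1 - 1)"
    if k: "k < \<tau>" for k
  proof -
    have i: "3 * int k + 2 - 1 = 3 * int k + 1" "3 * int k + 3 - 1 = 3 * int k + 2" "3 * int k + 1 - 1 = 3 * int k"
      "3 * int k + 1 + 1 = 3 * int k + 2" "3 * int k + 2 + 1 = 3 * int k + 3" "3 * int k + 3 + 1 = 3 * int k + 4"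
      by simp_all
    have sd: "a \<cdot>\<^sub>v u + a' \<cdot>\<^sub>v u = (a' + a) \<cdot>\<^sub>v u" for a a' :: cusp and u
      by (simp add: add.commute[of a'] flip: add_smult_distrib_vec)
    note defs = plane_gen_def axis_gen_def i chi3 b[OF k] e[OF k] xA_def yA_def zA_def toA_hom toA_power
    show "plane_gen (3 * int k + 1) = (xA^2 * yA^2) \<cdot>\<^sub>v basis_vec \<tau> (int k + 1)"
      "plane_gen (3 * int k + 2) = (yA^2 * zA^2) \<cdot>\<^sub>v basis_vec \<tau> (int k + 1)"
      "plane_gen (3 * int k + 3) = (zA^2 * xA^2) \<cdot>\<^sub>v basis_vec \<tau> (int k + 1)"
      by (simp_all only: defs power_mult_distrib)
    show "axis_gen (3 * int k + 2) = (xA * yA ^ (wpos (3 * int k + 2) + 2) + yA ^ (wneg (3 * int k + 2) + 2) * zA) \<cdot>\<^sub>v basis_vec \<tau> (int k + 1)"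
      "axis_gen (3 * int k + 3) = (yA * zA ^ (wpos (3 * int k + 3) + 2) + zA ^ (wneg (3 * int k + 3) + 2) * xA) \<cdot>\<^sub>v basis_vec \<tau> (int k + 1)"
      by (simp_all only: defs sd)
    have "axis_gen (3 * int k + 1) = (xA ^ (wneg (3 * int k + 1) + 2) * yA) \<cdot>\<^sub>v basis_vec \<tau> (int k + 1) +
        (zA * xA ^ (wpos (3 * int k + 1) + 2)) \<cdot>\<^sub>v base (3 * int k)"
      by (simp only: defs)
    then show "axis_gen (3 * int k + 1) = (xA ^ (wneg (3 * int k + 1) + 2) * yA) \<cdot>\<^sub>v basis_vec \<tau> (int k + 1) +
        ((if int k + 1 = 1 then toA (constS lam) else 1) * zA * xA ^ (wpos (3 * int k + 1) + 2)) \<cdot>\<^sub>v basis_vec \<tau> (int k + 1 - 1)"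
      by (simp only: e'[OF k] mult.assoc)
  qed
  have dt: "3 * \<tau> div 3 = \<tau>" by simp
  show ?thesis
    unfolding generators_def Let_def len_w dt image image_image
    by (rule arg_cong[where f = Union], rule image_cong[OF refl])
      (simp only: lessThan_iff idx p wpos_def wneg_def)
qed

lemma gen_reduce:
  assumes "\<And>k t. k < \<tau> \<Longrightarrow> t \<in> {1, 2, 3} \<Longrightarrow> P (3 * int k + t)"
    and "\<And>j q. P j \<Longrightarrow> P (j + int n * q)"
  shows "P j"
proof -
  obtain r q where r: "r < n" "j = int r + 1 + int n * q" using reduce_index by blast
  have "int r + 1 = 3 * int (r div 3) + (int (r mod 3) + 1)" by presburger
  moreover have "r div 3 < \<tau>" using r(1) by auto
  moreover have "int (r mod 3) + 1 \<in> {1, 2, 3}" by auto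
  ultimately have "P (int r + 1)" using assms(1) by metis
  then show ?thesis unfolding r(2) by (rule assms(2))
qed

lemma M_vecs_eq_span: "M_vecs = module.span class_ring (module_vec TYPE(cusp) \<tau>) (generators w lam)"
  by (simp add: M_tilde_def Let_def len_w)

lemma generators_carrier: "generators w lam \<subseteq> carrier_vec \<tau>"
  unfolding generators_eq by auto

lemma M_vecs_submodule: "submodule class_ring M_vecs (module_vec TYPE(cusp) \<tau>)"
proof -
  interpret vec_module "TYPE(cusp)" \<tau> .
  show ?thesis unfolding M_vecs_eq_span by (rule span_is_submodule) (use generators_carrier in auto)
qed

lemma M_vecs_closed:
  "v \<in> M_vecs \<Longrightarrow> v \<in> carrier_vec \<tau>" "0\<^sub>v \<tau> \<in> M_vecs"
  "u \<in> M_vecs \<Longrightarrow> v \<in> M_vecs \<Longrightarrow> u + v \<in> M_vecs" "v \<in> M_vecs \<Longrightarrow> a \<cdot>\<^sub>v v \<in> M_vecs"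
  using M_vecs_submodule by (auto simp: submodule_def module_vec_simps)

lemma generators_M_vecs: "generators w lam \<subseteq> M_vecs"
proof -
  interpret vec_module "TYPE(cusp)" \<tau> .
  show ?thesis unfolding M_vecs_eq_span by (rule in_own_span) (use generators_carrier in auto)
qed

lemma gen_M_vecs: "plane_gen j \<in> M_vecs" "axis_gen j \<in> M_vecs"
proof -
  have "plane_gen j \<in> M_vecs \<and> axis_gen j \<in> M_vecs"
  proof (rule gen_reduce)
    fix k and t :: int assume "k < \<tau>" "t \<in> {1, 2, 3}"
    then show "plane_gen (3 * int k + t) \<in> M_vecs \<and> axis_gen (3 * int k + t) \<in> M_vecs"
      using generators_M_vecs unfolding generators_eq by auto
  qed (simp only: gen_shift M_vecs_closed simp_thms)
  then show "plane_gen j \<in> M_vecs" "axis_gen j \<in> M_vecs" by simp_all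
qed

lemma M_vecs_induct [consumes 1, case_names plane axis zero add smult]:
  assumes "v \<in> M_vecs" and "\<And>j. P (plane_gen j)" "\<And>j. P (axis_gen j)" "P (0\<^sub>v \<tau>)"
    and "\<And>u v. u \<in> M_vecs \<Longrightarrow> v \<in> M_vecs \<Longrightarrow> P u \<Longrightarrow> P v \<Longrightarrow> P (u + v)"
    and "\<And>a v. v \<in> M_vecs \<Longrightarrow> P v \<Longrightarrow> P (a \<cdot>\<^sub>v v)"
  shows "P v"
proof -
  interpret vec_module "TYPE(cusp)" \<tau> .
  have "submodule class_ring {v \<in> M_vecs. P v} V"
    using assms(4-) M_vecs_submodule unfolding submodule_def by (auto simp: module_vec_simps)
  moreover have "generators w lam \<subseteq> {v \<in> M_vecs. P v}"
    using generators_M_vecs assms(2,3) unfolding generators_eq by auto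
  ultimately have "M_vecs \<subseteq> {v \<in> M_vecs. P v}"
    unfolding M_vecs_eq_span by (intro span_is_subset)
  then show ?thesis using assms(1) by blast
qed

text \<open>
The values F j on the generators plane_gen j and p j on the generators axis_gen j of a linear form
on M_tilde.\<close>

definition gluing_data :: "(int \<Rightarrow> cusp) \<Rightarrow> (int \<Rightarrow> cusp) \<Rightarrow> bool" where
  "gluing_data F p \<longleftrightarrow> (\<forall>j. F (j - int n) = toA (constS lam) * F j \<and> toA (chi (j - 1)) * F j = 0 \<and>
     toA (chi (j + 1)) * p j = toA (chi j) ^ wneg j * F j \<and>
     toA (chi (j - 1)) * p j = toA (chi j) ^ wpos j * F (j - 1))"

text \<open>
A linear form with values F has value a at v: multiplying v by the square of x y, y z or z x expresses
it through the generators plane_gen, and these three squares detect elements of A.\<close>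

definition represents :: "(int \<Rightarrow> cusp) \<Rightarrow> cusp vec \<Rightarrow> cusp \<Rightarrow> bool" where
  "represents F v a \<longleftrightarrow> (\<forall>t\<in>{1, 2, 3}. toA (chi t * chi (t + 1)) ^ 2 * a = (\<Sum>k<\<tau>. v $ k * F (3 * int k + t)))"

lemma represents_unique:
  assumes "represents F v a" "represents F v a'" shows "a = a'"
proof -
  have "plane (t + 2) a = plane (t + 2) a'" if "t \<in> {1, 2, 3}" for t
  proof -
    have "toA (chi t * chi (t + 1)) ^ 2 * a = toA (chi t * chi (t + 1)) ^ 2 * a'"
      using assms that by (simp only: represents_def)
    then have "plane (t + 2) (toA ((chi t * chi (t + 1)) ^ 2) * a) = plane (t + 2) (toA ((chi t * chi (t + 1)) ^ 2) * a')"
      by (simp only: toA_power)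
    then show ?thesis by (simp add: power_mult_distrib)
  qed
  from this[of 1] this[of 2] this[of 3] show ?thesis by (intro cusp_eqI[of 3]) simp_all
qed

lemma represents_linear:
  "represents F (0\<^sub>v \<tau>) 0"
  "represents F u a \<Longrightarrow> represents F v a' \<Longrightarrow> u \<in> carrier_vec \<tau> \<Longrightarrow> v \<in> carrier_vec \<tau> \<Longrightarrow> represents F (u + v) (a + a')"
  "represents F v a \<Longrightarrow> v \<in> carrier_vec \<tau> \<Longrightarrow> represents F (b \<cdot>\<^sub>v v) (b * a)"
proof -
  show "represents F (0\<^sub>v \<tau>) 0" by (simp add: represents_def)
  show "represents F (u + v) (a + a')"
    if "represents F u a" "represents F v a'" "u \<in> carrier_vec \<tau>" "v \<in> carrier_vec \<tau>"
    using that by (simp add: represents_def distrib_left distrib_right sum.distrib)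
  show "represents F (b \<cdot>\<^sub>v v) (b * a)" if "represents F v a" "v \<in> carrier_vec \<tau>"
    unfolding represents_def
  proof
    fix t :: int assume t: "t \<in> {1, 2, 3}"
    have "toA (chi t * chi (t + 1)) ^ 2 * (b * a) = b * (toA (chi t * chi (t + 1)) ^ 2 * a)"
      by (rule mult.left_commute)
    also have "\<dots> = b * (\<Sum>k<\<tau>. v $ k * F (3 * int k + t))"
      using that(1) t by (simp only: represents_def)
    also have "\<dots> = (\<Sum>k<\<tau>. (b \<cdot>\<^sub>v v) $ k * F (3 * int k + t))"
      using that(2) by (simp add: sum_distrib_left mult.assoc)
    finally show "toA (chi t * chi (t + 1)) ^ 2 * (b * a) = (\<Sum>k<\<tau>. (b \<cdot>\<^sub>v v) $ k * F (3 * int k + t))" .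
  qed
qed

lemma gluing_data_shift:
  "gluing_data F p \<Longrightarrow> F (j + int n * q) = twist toA q * F j"
  by (rule quasi_periodic_shift[OF ring_map_toA]) (simp add: gluing_data_def)

text \<open>\<open>base j\<close> is a multiple of the unit vector of the block of three indices
  that contains \<open>j\<close>; the sum picks the member of this block at place
  \<open>t\<close>.\<close>

lemma sum_base:
  assumes "gluing_data F p"
  shows "(\<Sum>k<\<tau>. base j $ k * F (3 * int k + t)) = F (3 * ((j - 1) div 3) + t)"
proof -
  obtain r q where r: "r < n" "j = int r + 1 + int n * q" using reduce_index by blast
  have r3: "r div 3 < \<tau>" using r(1) by auto
  have "base j = twist toA q \<cdot>\<^sub>v base (int r + 1)" unfolding r(2) by (rule base_shift)
  also have "base (int r + 1) = base (3 * int (r div 3) + (int (r mod 3) + 1))"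
    by (rule arg_cong[where f = base]) presburger
  also have "\<dots> = unit_vec \<tau> (r div 3)" by (rule base_eq[OF r3]) auto
  finally have "(\<Sum>k<\<tau>. base j $ k * F (3 * int k + t))
      = (\<Sum>k<\<tau>. if k = r div 3 then twist toA q * F (3 * int k + t) else 0)"
    by (intro sum.cong) (auto simp: unit_vec_def)
  also have "\<dots> = twist toA q * F (3 * int (r div 3) + t)"
    using r3 by simp
  also have "\<dots> = F (3 * int (r div 3) + t + int n * q)"
    by (rule gluing_data_shift[OF assms, symmetric])
  also have "3 * int (r div 3) + t + int n * q = 3 * ((j - 1) div 3) + t"
  proof -
    have "j - 1 = int r + 3 * (int \<tau> * q)" using r(2) by simp
    then have "(j - 1) div 3 = int r div 3 + int \<tau> * q" by simp
    then show ?thesis by (simp add: zdiv_int)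
  qed
  finally show ?thesis .
qed

lemma residue_cases:
  fixes j t :: int
  assumes "t \<in> {1, 2, 3}"
  defines "m \<equiv> 3 * ((j - 1) div 3) + t"
  shows "m mod 3 = t mod 3"
    and "m = j \<or> m mod 3 = (j + 1) mod 3 \<or> m mod 3 = (j + 2) mod 3"
proof -
  show "m mod 3 = t mod 3" by (simp add: m_def)
  have "m - j \<in> {-2, -1, 0, 1, 2}"
    using assms pos_mod_bound[of 3 "j - 1"] pos_mod_sign[of 3 "j - 1"] mult_div_mod_eq[of 3 "j - 1"]
    unfolding m_def by auto
  then show "m = j \<or> m mod 3 = (j + 1) mod 3 \<or> m mod 3 = (j + 2) mod 3"
    by (auto simp: mod_eq_dvd_iff algebra_simps)
qed

text \<open>If \<open>m = j\<close>, both sides agree. Otherwise \<open>chi (m - 1)\<close> divides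
  the coefficient of \<open>F m\<close> and \<open>chi (j - 1)\<close> that of \<open>F j\<close>,
  so both sides are 0.\<close>

lemma represents_plane_gen:
  assumes "gluing_data F p"
  shows "represents F (plane_gen j) (F j)"
  unfolding represents_def
proof
  fix t :: int assume t: "t \<in> {1, 2, 3}"
  define m where "m = 3 * ((j - 1) div 3) + t"
  note m = residue_cases[OF t, of j, folded m_def]
  have ct: "chi t = chi m" "chi (t + 1) = chi (m + 1)"
    using chi_cong_add[OF m(1), of 0] chi_cong_add[OF m(1), of 1] by simp_all
  have kill: "toA (chi (j - 1)) * F j = 0" for j
    using assms by (simp add: gluing_data_def)
  have "(\<Sum>k<\<tau>. plane_gen j $ k * F (3 * int k + t)) = toA (chi j * chi (j + 1)) ^ 2 * (\<Sum>k<\<tau>. base j $ k * F (3 * int k + t))"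
    by (simp add: plane_gen_def sum_distrib_left mult_ac)
  also have "\<dots> = toA (chi j * chi (j + 1)) ^ 2 * F m"
    using sum_base[OF assms] by (simp add: m_def)
  also have "toA (chi j * chi (j + 1)) ^ 2 * F m = toA (chi t * chi (t + 1)) ^ 2 * F j" (is ?goal)
    using m(2)
  proof (elim disjE)
    assume m2: "m mod 3 = (j + 1) mod 3"
    have c: "chi m = chi (j + 1)" "chi (m + 1) = chi (j - 1)" "chi (m - 1) = chi j"
      using chi_cong_add[OF m2, of 0] chi_cong_add[OF m2, of 1] chi_cong_add[OF m2, of "-1"] by simp_all
    have "toA (chi j * chi (j + 1)) ^ 2 * F m = toA (chi j * chi (j + 1) ^ 2) * (toA (chi (m - 1)) * F m)"
      unfolding c by (simp add: power2_eq_square mult_ac)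
    moreover have "toA (chi m * chi (m + 1)) ^ 2 * F j = toA (chi m ^ 2 * chi (m + 1)) * (toA (chi (j - 1)) * F j)"
      unfolding c by (simp add: power2_eq_square mult_ac)
    ultimately show "?goal" unfolding ct by (simp only: kill mult_zero_right)
  next
    assume m2: "m mod 3 = (j + 2) mod 3"
    have c: "chi m = chi (j - 1)" "chi (m + 1) = chi j" "chi (m - 1) = chi (j + 1)"
      using chi_cong_add[OF m2, of 0] chi_cong_add[OF m2, of 1] chi_cong_add[OF m2, of "-1"] by simp_all
    have "toA (chi j * chi (j + 1)) ^ 2 * F m = toA (chi j ^ 2 * chi (j + 1)) * (toA (chi (m - 1)) * F m)"
      unfolding c by (simp add: power2_eq_square mult_ac)
    moreover have "toA (chi m * chi (m + 1)) ^ 2 * F j = toA (chi m * chi (m + 1) ^ 2) * (toA (chi (j - 1)) * F j)"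
      unfolding c by (simp add: power2_eq_square mult_ac)
    ultimately show "?goal" unfolding ct by (simp only: kill mult_zero_right)
  qed (simp add: ct)
  finally show "toA (chi t * chi (t + 1)) ^ 2 * F j = (\<Sum>k<\<tau>. plane_gen j $ k * F (3 * int k + t))" ..
qed

text \<open>\<open>m\<close> and \<open>m'\<close> are the members at place \<open>t\<close> of the
  blocks of \<open>j\<close> and of \<open>j - 1\<close>. For the residue of \<open>j\<close> only
  the first summand survives and \<open>up\<close> evaluates it; for that of \<open>j - 1\<close>
  only the second, by \<open>down\<close>; for the third residue everything is 0.\<close>

lemma represents_axis_gen:
  assumes "gluing_data F p"
  shows "represents F (axis_gen j) (p j)"
  unfolding represents_def
proof
  fix t :: int assume t: "t \<in> {1, 2, 3}"
  define m where "m = 3 * ((j - 1) div 3) + t"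
  define m' where "m' = 3 * ((j - 1 - 1) div 3) + t"
  note m = residue_cases[OF t, of j, folded m_def]
  note m' = residue_cases[OF t, of "j - 1", folded m'_def]
  have ct: "chi t = chi m" "chi (t + 1) = chi (m + 1)" "chi (m' - 1) = chi (m - 1)"
    using chi_cong_add[OF m(1), of 0] chi_cong_add[OF m(1), of 1]
      chi_cong_add[OF trans[OF m'(1) m(1)[symmetric]], of "-1"] by simp_all
  have kill: "toA (chi (j - 1)) * F j = 0" for j
    using assms by (simp add: gluing_data_def)
  have up: "toA (chi (j + 1)) * p j = toA (chi j) ^ wneg j * F j"
    and down: "toA (chi (j - 1)) * p j = toA (chi j) ^ wpos j * F (j - 1)"
    using assms by (simp_all add: gluing_data_def)
  let ?a = "toA (chi j ^ (wneg j + 2) * chi (j + 1))" and ?b = "toA (chi (j - 1) * chi j ^ (wpos j + 2))"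
  have "axis_gen j $ k * x = ?a * (base j $ k * x) + ?b * (base (j - 1) $ k * x)" if "k < \<tau>" for k x
    unfolding axis_gen_def using that by (simp add: distrib_right mult.assoc del: index_shift)
  then have "(\<Sum>k<\<tau>. axis_gen j $ k * F (3 * int k + t)) =
      ?a * (\<Sum>k<\<tau>. base j $ k * F (3 * int k + t)) + ?b * (\<Sum>k<\<tau>. base (j - 1) $ k * F (3 * int k + t))"
    by (simp add: sum_distrib_left sum.distrib del: index_shift)
  also have "\<dots> = ?a * F m + ?b * F m'"
    unfolding sum_base[OF assms] m_def m'_def ..
  also have "?a * F m + ?b * F m' = toA (chi t * chi (t + 1)) ^ 2 * p j" (is ?goal)
    using m(2)
  proof (elim disjE)
    assume mj: "m = j"
    have "m' mod 3 = j mod 3" using m(1) m'(1) mj by simp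
    then have c: "chi (m' - 1) = chi (j - 1)" using chi_cong_add[of m' j "-1"] by simp
    have "?b * F m' = toA (chi j ^ (wpos j + 2)) * (toA (chi (m' - 1)) * F m')"
      unfolding c by (simp add: mult_ac)
    also have "\<dots> = 0" by (simp only: kill mult_zero_right)
    finally have "?b * F m' = 0" .
    moreover have "toA (chi j * chi (j + 1)) ^ 2 * p j = toA (chi j ^ 2 * chi (j + 1)) * (toA (chi (j + 1)) * p j)"
      by (simp add: power2_eq_square mult_ac)
    moreover have "\<dots> = ?a * F j"
      unfolding up by (simp add: power_add power2_eq_square mult_ac)
    ultimately show "?goal" unfolding ct mj by simp
  next
    assume m2: "m mod 3 = (j + 1) mod 3"
    have c: "chi m = chi (j + 1)" "chi (m + 1) = chi (j - 1)" "chi (m - 1) = chi j"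
      using chi_cong_add[OF m2, of 0] chi_cong_add[OF m2, of 1] chi_cong_add[OF m2, of "-1"] by simp_all
    have k: "toA (chi j) * F m = 0" "toA (chi j) * F m' = 0" "toA (chi (j + 1)) * F (j - 1) = 0"
      using kill[of m] kill[of m'] kill[of "j - 1"] unfolding ct c by simp_all
    have "?a * F m = toA (chi j ^ (wneg j + 1) * chi (j + 1)) * (toA (chi j) * F m)"
      by (simp add: mult_ac)
    then have 1: "?a * F m = 0" by (simp only: k mult_zero_right)
    have "?b * F m' = toA (chi (j - 1) * chi j ^ (wpos j + 1)) * (toA (chi j) * F m')"
      by (simp add: mult_ac)
    then have 2: "?b * F m' = 0" by (simp only: k mult_zero_right)
    have "toA (chi (j + 1) * chi (j - 1)) ^ 2 * p j
        = toA (chi (j + 1) ^ 2 * chi (j - 1)) * (toA (chi (j - 1)) * p j)"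
      by (simp add: power2_eq_square mult_ac)
    also have "\<dots> = toA (chi (j + 1) * chi (j - 1) * chi j ^ wpos j) * (toA (chi (j + 1)) * F (j - 1))"
      unfolding down by (simp add: power2_eq_square mult_ac)
    also have "\<dots> = 0" by (simp only: k mult_zero_right)
    finally show "?goal" unfolding ct c 1 2 by simp
  next
    assume m2: "m mod 3 = (j + 2) mod 3"
    have c: "chi m = chi (j - 1)" "chi (m + 1) = chi j" "chi (m - 1) = chi (j + 1)"
      using chi_cong_add[OF m2, of 0] chi_cong_add[OF m2, of 1] chi_cong_add[OF m2, of "-1"] by simp_all
    have mj: "m' = j - 1"
    proof -
      have "m' mod 3 = (j + 2) mod 3" using m(1) m'(1) m2 by simp
      then have "m' mod 3 \<noteq> (j - 1 + 1) mod 3" "m' mod 3 \<noteq> (j - 1 + 2) mod 3" by presburger+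
      then show ?thesis using m'(2) by blast
    qed
    have k: "toA (chi (j + 1)) * F m = 0"
      using kill[of m] unfolding c by simp
    have "?a * F m = toA (chi j ^ (wneg j + 2)) * (toA (chi (j + 1)) * F m)"
      by (simp add: mult_ac)
    then have 1: "?a * F m = 0" by (simp only: k mult_zero_right)
    have "toA (chi (j - 1) * chi j) ^ 2 * p j
        = toA (chi (j - 1) * chi j ^ 2) * (toA (chi (j - 1)) * p j)"
      by (simp add: power2_eq_square mult_ac)
    also have "\<dots> = ?b * F (j - 1)"
      unfolding down by (simp add: power_add power2_eq_square mult_ac)
    finally show "?goal" unfolding ct c mj 1 by simp
  qed
  finally show "toA (chi t * chi (t + 1)) ^ 2 * p j = (\<Sum>k<\<tau>. axis_gen j $ k * F (3 * int k + t))" ..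
qed

section \<open>Linear forms on M_tilde\<close>

abbreviation "dual \<equiv> carrier (hom_module class_ring (M_tilde w lam) canonical_module)"

lemma M_tilde_ops [simp]:
  "add (M_tilde w lam) = (+)" "module.smult (M_tilde w lam) = (\<cdot>\<^sub>v)"
  by (simp_all add: M_tilde_def Let_def module_vec_simps)

lemma canonical_ops [simp]:
  "carrier canonical_module = UNIV" "add canonical_module = (+)" "module.smult canonical_module = (*)"
  "zero canonical_module = 0"
  by (simp_all add: canonical_module_def)

lemma dual_iff:
  "h \<in> dual \<longleftrightarrow> h \<in> extensional M_vecs \<and> (\<forall>u\<in>M_vecs. \<forall>v\<in>M_vecs. h (u + v) = h u + h v) \<and>
     (\<forall>a. \<forall>v\<in>M_vecs. h (a \<cdot>\<^sub>v v) = a * h v)"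
  by (auto simp: hom_module_def module_hom_def)

lemma dual_0: "h \<in> dual \<Longrightarrow> h (0\<^sub>v \<tau>) = 0"
proof -
  assume "h \<in> dual"
  then have "h (0 \<cdot>\<^sub>v 0\<^sub>v \<tau>) = 0 * h (0\<^sub>v \<tau>)" using M_vecs_closed(2) unfolding dual_iff by blast
  moreover have "0 \<cdot>\<^sub>v 0\<^sub>v \<tau> = (0\<^sub>v \<tau> :: cusp vec)" by (rule eq_vecI) simp_all
  ultimately show ?thesis by simp
qed

lemma smult_plane_gen_0: "toA (chi (j - 1)) \<cdot>\<^sub>v plane_gen j = 0\<^sub>v \<tau>"
proof -
  have "toA (chi (j - 1)) * toA (chi j * chi (j + 1)) ^ 2 = 0"
    by (rule cusp_eqI[of j]) simp_all
  then show ?thesis by (auto simp: plane_gen_def smult_smult_assoc simp del: index_shift intro!: eq_vecI)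
qed

text \<open>Each multiplication completes \<open>xyz\<close> in one of the two summands and kills
  it. These are the relations recorded in \<open>gluing_data\<close>.\<close>

lemma smult_axis_gen:
  "toA (chi (j + 1)) \<cdot>\<^sub>v axis_gen j = toA (chi j) ^ wneg j \<cdot>\<^sub>v plane_gen j"
  "toA (chi (j - 1)) \<cdot>\<^sub>v axis_gen j = toA (chi j) ^ wpos j \<cdot>\<^sub>v plane_gen (j - 1)"
proof -
  let ?a = "toA (chi j ^ (wneg j + 2) * chi (j + 1))" and ?b = "toA (chi (j - 1) * chi j ^ (wpos j + 2))"
  have ab: "toA (chi (j + 1)) * ?a = toA (chi j) ^ wneg j * toA (chi j * chi (j + 1)) ^ 2"
    "toA (chi (j + 1)) * ?b = 0" "toA (chi (j - 1)) * ?a = 0"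
    "toA (chi (j - 1)) * ?b = toA (chi j) ^ wpos j * toA (chi (j - 1) * chi j) ^ 2"
    by (rule cusp_eqI[of j]; simp add: power2_eq_square mult_ac)+
  have dist: "x \<cdot>\<^sub>v axis_gen j = (x * ?a) \<cdot>\<^sub>v base j + (x * ?b) \<cdot>\<^sub>v base (j - 1)" for x
    unfolding axis_gen_def by (subst smult_add_distrib_vec[of _ \<tau>]) (simp_all add: smult_smult_assoc)
  have z: "0 \<cdot>\<^sub>v base i = 0\<^sub>v \<tau>" for i by (rule eq_vecI) simp_all
  show "toA (chi (j + 1)) \<cdot>\<^sub>v axis_gen j = toA (chi j) ^ wneg j \<cdot>\<^sub>v plane_gen j"
    unfolding dist ab z plane_gen_def by (simp add: smult_smult_assoc)
  show "toA (chi (j - 1)) \<cdot>\<^sub>v axis_gen j = toA (chi j) ^ wpos j \<cdot>\<^sub>v plane_gen (j - 1)"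
    unfolding dist ab z plane_gen_def by (simp add: smult_smult_assoc)
qed

lemma dual_gluing_data:
  assumes h: "h \<in> dual"
  shows "gluing_data (\<lambda>j. h (plane_gen j)) (\<lambda>j. h (axis_gen j))"
proof -
  have hs: "h (a \<cdot>\<^sub>v v) = a * h v" if "v \<in> M_vecs" for a v
    using h that unfolding dual_iff by blast
  have "plane_gen (j - int n) = toA (constS lam) \<cdot>\<^sub>v plane_gen j" for j
    using gen_shift(1)[of j "-1"] by (simp add: twist_simps[OF ring_map_toA])
  then have 1: "h (plane_gen (j - int n)) = toA (constS lam) * h (plane_gen j)" for j
    by (simp only: hs[OF gen_M_vecs(1)])
  have 2: "toA (chi (j - 1)) * h (plane_gen j) = 0" for j
    by (simp only: hs[OF gen_M_vecs(1), symmetric] smult_plane_gen_0 dual_0[OF h])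
  have 3: "toA (chi (j + 1)) * h (axis_gen j) = toA (chi j) ^ wneg j * h (plane_gen j)"
    "toA (chi (j - 1)) * h (axis_gen j) = toA (chi j) ^ wpos j * h (plane_gen (j - 1))" for j
    by (simp_all only: hs[OF gen_M_vecs(1), symmetric] hs[OF gen_M_vecs(2), symmetric] smult_axis_gen)
  show ?thesis unfolding gluing_data_def using 1 2 3 by blast
qed

lemma dual_represents:
  assumes h: "h \<in> dual" and v: "v \<in> M_vecs"
  shows "represents (\<lambda>j. h (plane_gen j)) v (h v)"
  using v
proof (induction rule: M_vecs_induct)
  case (plane j)
  then show ?case by (rule represents_plane_gen[OF dual_gluing_data[OF h]])
next
  case (axis j)
  then show ?case by (rule represents_axis_gen[OF dual_gluing_data[OF h]])
next
  case zero
  then show ?case by (simp add: dual_0[OF h] represents_linear(1))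
next
  case (add u v)
  then have "h (u + v) = h u + h v" using h unfolding dual_iff by blast
  then show ?case using add by (simp add: represents_linear(2) M_vecs_closed(1))
next
  case (smult a v)
  then have "h (a \<cdot>\<^sub>v v) = a * h v" using h unfolding dual_iff by blast
  then show ?case using smult by (simp add: represents_linear(3) M_vecs_closed(1))
qed

lemma dual_eqI:
  assumes "h \<in> dual" "h' \<in> dual" "\<And>j. h (plane_gen j) = h' (plane_gen j)"
  shows "h = h'"
proof (rule extensionalityI)
  show "h \<in> extensional M_vecs" "h' \<in> extensional M_vecs" using assms(1,2) unfolding dual_iff by blast+
  fix v assume v: "v \<in> M_vecs"
  show "h v = h' v"
    using dual_represents[OF assms(1) v] dual_represents[OF assms(2) v] assms(3)
    by (simp add: represents_unique)
qed

text \<open>Instead of checking the data against all relations between the generators, a represented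
  value is propagated through the span; it is unique, and so the resulting function is well defined
  and linear.\<close>

lemma ex_dual:
  assumes F: "gluing_data F p"
  shows "\<exists>h\<in>dual. \<forall>j. h (plane_gen j) = F j"
proof -
  have ex: "\<exists>a. represents F v a" if "v \<in> M_vecs" for v
    using that
  proof (induction rule: M_vecs_induct)
    case (add u v)
    then show ?case using represents_linear(2) M_vecs_closed(1) by blast
  next
    case (smult a v)
    then show ?case using represents_linear(3) M_vecs_closed(1) by blast
  qed (use represents_plane_gen[OF F] represents_axis_gen[OF F] represents_linear(1) in blast)+
  define h where "h = restrict (\<lambda>v. THE a. represents F v a) M_vecs"
  have h: "h v = a" if "v \<in> M_vecs" "represents F v a" for v a
    using that represents_unique by (auto simp: h_def)
  have rep: "represents F v (h v)" if "v \<in> M_vecs" for v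
    using ex[OF that] h[OF that] by auto
  have "h \<in> dual"
    unfolding dual_iff
  proof (intro conjI ballI allI)
    show "h \<in> extensional M_vecs" by (simp add: h_def)
    show "h (u + v) = h u + h v" if "u \<in> M_vecs" "v \<in> M_vecs" for u v
      using that by (intro h represents_linear(2) rep) (auto simp: M_vecs_closed)
    show "h (a \<cdot>\<^sub>v v) = a * h v" if "v \<in> M_vecs" for a v
      using that by (intro h represents_linear(3) rep) (auto simp: M_vecs_closed)
  qed
  moreover have "h (plane_gen j) = F j" for j
    by (rule h[OF gen_M_vecs(1) represents_plane_gen[OF F]])
  ultimately show ?thesis by blast
qed

lemma chi_power_glue:
  "pos_sign w j \<Longrightarrow> wneg j = 0 \<and> chi_pow j (ent w j) = chi j ^ wpos j"
  "\<not> pos_sign w j \<Longrightarrow> wpos j = 0 \<and> chi_pow j (- ent w j) = chi j ^ wneg j"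
  using nonneg[of j] nonpos[of j] by (auto simp: wneg_def wpos_def neg_part_def pos_part_def chi_pow_def)

text \<open>One of \<open>wneg j\<close> and \<open>wpos j\<close> is always 0, so this symmetric
  equation covers both signs.\<close>

lemma glued_iff:
  "glued g \<longleftrightarrow> (\<forall>j. set_zero (j + 2) (g j) = g j \<and>
     chi j ^ wneg j * set_zero (j + 1) (g j) = chi j ^ wpos j * set_zero (j + 2) (g (j - 1)))"
proof -
  have "(if pos_sign w j then set_zero (j + 1) (g j) = chi_pow j (ent w j) * set_zero (j + 2) (g (j - 1))
      else chi_pow j (- ent w j) * set_zero (j + 1) (g j) = set_zero (j + 2) (g (j - 1))) \<longleftrightarrow>
     chi j ^ wneg j * set_zero (j + 1) (g j) = chi j ^ wpos j * set_zero (j + 2) (g (j - 1))" for j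
    using chi_power_glue[of j] by (cases "pos_sign w j") simp_all
  then show ?thesis unfolding glued_def by simp blast
qed

text \<open>Being killed by \<open>chi (j - 1)\<close>, \<open>F j\<close> is supported on one plane
  and vanishes on both of its axes, hence is divisible by \<open>chi j * chi (j + 1)\<close>. The
  two restrictions of \<open>p j\<close> are then multiples of \<open>g j\<close> and
  \<open>g (j - 1)\<close>, and their agreement on the axis of \<open>chi j\<close> is the gluing
  condition.\<close>

lemma gluing_data_ex_glued:
  assumes F: "gluing_data F p"
  shows "\<exists>g. glued g \<and> (\<forall>j. F j = toA (chi j * chi (j + 1) * g j))"
proof -
  have kill: "toA (chi (j - 1)) * F j = 0"
    and up: "toA (chi (j + 1)) * p j = toA (chi j) ^ wneg j * F j"
    and down: "toA (chi (j - 1)) * p j = toA (chi j) ^ wpos j * F (j - 1)" for j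
    using F unfolding gluing_data_def by blast+
  have F0: "plane j (F j) = 0" "plane (j + 1) (F j) = 0" for j
    using arg_cong[OF kill[of j], of "plane j"] arg_cong[OF kill[of j], of "plane (j + 1)"] by simp_all
  have "\<exists>g. plane (j + 2) (F j) = chi j * chi (j + 1) * g" for j
  proof -
    have "set_zero j (plane (j + 2) (F j)) = 0" "set_zero (j + 1) (plane (j + 2) (F j)) = 0"
      by (simp_all only: set_zero_plane_commute[of j "j + 2"] set_zero_plane_commute[of "j + 1" "j + 2"] F0 set_zero_hom)
    then have "chi j * chi (j + 1) dvd plane (j + 2) (F j)" by (intro chi_chi_dvd) auto
    then show ?thesis by (auto elim: dvdE)
  qed
  then obtain g where g: "\<And>j. plane (j + 2) (F j) = chi j * chi (j + 1) * g j" by metis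
  note [simp] = index_comm[where g = g]
  have fix_g: "set_zero (j + 2) (g j) = g j" for j
    using set_zero_plane[of "j + 2" "F j"] unfolding g by simp
  have fix_g': "set_zero (j + 1) (g (j - 1)) = g (j - 1)" for j
    using fix_g[of "j - 1"] by simp
  have Fg: "F j = toA (chi j * chi (j + 1) * g j)" for j
    by (rule cusp_eqI[of j]) (simp_all add: F0 g fix_g)
  have glue: "chi j ^ wneg j * set_zero (j + 1) (g j) = chi j ^ wpos j * set_zero (j + 2) (g (j - 1))" for j
  proof -
    have "chi (j + 1) * plane (j + 2) (p j) = chi j ^ wneg j * (chi j * chi (j + 1) * g j)"
      using arg_cong[OF up[of j], of "plane (j + 2)"] by (simp add: g)
    then have "chi (j + 1) * plane (j + 2) (p j) = chi (j + 1) * (chi j ^ wneg j * chi j * g j)"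
      by (simp only: mult_ac)
    then have 1: "plane (j + 2) (p j) = chi j ^ wneg j * chi j * g j"
      by (simp only: mult_cancel_left chi_nonzero simp_thms)
    have "chi (j + 2) * plane (j + 1) (p j) = chi j ^ wpos j * (chi (j + 2) * chi j * g (j - 1))"
      using arg_cong[OF down[of j], of "plane (j + 1)"] by (simp add: Fg fix_g')
    then have "chi (j + 2) * plane (j + 1) (p j) = chi (j + 2) * (chi j ^ wpos j * chi j * g (j - 1))"
      by (simp only: mult_ac)
    then have 2: "plane (j + 1) (p j) = chi j ^ wpos j * chi j * g (j - 1)"
      by (simp only: mult_cancel_left chi_nonzero simp_thms)
    have "set_zero (j + 1) (plane (j + 2) (p j)) = set_zero (j + 2) (plane (j + 1) (p j))"
      by (rule set_zero_plane_commute)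
    then have "chi j * (chi j ^ wneg j * set_zero (j + 1) (g j)) = chi j * (chi j ^ wpos j * set_zero (j + 2) (g (j - 1)))"
      unfolding 1 2 by (simp add: mult_ac)
    then show ?thesis by (simp only: mult_cancel_left chi_nonzero simp_thms)
  qed
  show ?thesis unfolding glued_iff using fix_g glue Fg by blast
qed

lemma glued_ex_gluing_data:
  assumes g: "glued g" and per: "\<And>j. g (j - int n) = constS lam * g j"
  shows "\<exists>p. gluing_data (\<lambda>j. toA (chi j * chi (j + 1) * g j)) p"
proof -
  note [simp] = index_comm[where g = g]
  have fix_g: "set_zero (j + 2) (g j) = g j"
    and glue: "chi j ^ wneg j * set_zero (j + 1) (g j) = chi j ^ wpos j * set_zero (j + 2) (g (j - 1))" for j
    using g unfolding glued_iff by blast+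
  have fix_g': "set_zero (j + 1) (g (j - 1)) = g (j - 1)" for j
    using fix_g[of "j - 1"] by simp
  \<comment> \<open>The value 0 on the plane where \<open>chi j\<close> vanishes is compatible,
    since both other values carry the factor \<open>chi j\<close>.\<close>
  have "\<exists>u. plane j u = 0 \<and> plane (j + 1) u = chi j * chi j ^ wpos j * g (j - 1) \<and>
      plane (j + 2) u = chi j * chi j ^ wneg j * g j" for j
    by (rule plane_glue) (simp_all add: fix_g fix_g' glue mult.assoc)
  then obtain p where p: "\<And>j. plane j (p j) = 0" "\<And>j. plane (j + 1) (p j) = chi j * chi j ^ wpos j * g (j - 1)"
     "\<And>j. plane (j + 2) (p j) = chi j * chi j ^ wneg j * g j" by metis
  have "gluing_data (\<lambda>j. toA (chi j * chi (j + 1) * g j)) p"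
    unfolding gluing_data_def
  proof (intro allI conjI)
    fix j
    have "j - int n = j + int n * (- 1)" "j - int n + 1 = j + 1 + int n * (- 1)" by simp_all
    then have "chi (j - int n) = chi j" "chi (j - int n + 1) = chi (j + 1)"
      by (simp_all only: chi_per)
    then show "toA (chi (j - int n) * chi (j - int n + 1) * g (j - int n)) = toA (constS lam) * toA (chi j * chi (j + 1) * g j)"
      unfolding per by (simp add: mult_ac)
    show "toA (chi (j - 1)) * toA (chi j * chi (j + 1) * g j) = 0"
      by (rule cusp_eqI[of j]) simp_all
    show "toA (chi (j + 1)) * p j = toA (chi j) ^ wneg j * toA (chi j * chi (j + 1) * g j)"
      by (rule cusp_eqI[of j]) (simp_all add: p fix_g mult_ac)
    show "toA (chi (j - 1)) * p j = toA (chi j) ^ wpos j * toA (chi (j - 1) * chi (j - 1 + 1) * g (j - 1))"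
      by (rule cusp_eqI[of j]) (simp_all add: p fix_g' mult_ac)
  qed
  then show ?thesis by blast
qed

section \<open>Kernel vectors and their correspondence with linear forms\<close>

abbreviation "phiA \<equiv> map_mat toA (phi (convert_word w) lam)"

definition ker_vecs :: "cusp vec set" where
  "ker_vecs = {u \<in> carrier_vec n. transpose_mat phiA *\<^sub>v u = 0\<^sub>v n}"

definition unroll_vec :: "cusp vec \<Rightarrow> int \<Rightarrow> cusp" where
  "unroll_vec u = unroll toA (\<lambda>i. u $ i)"

lemma phi_carrier: "phi (convert_word w) lam \<in> carrier_mat n n"
  by (simp add: phi_def len)

lemma ker_seq_iff_rel: "ker_seq U \<longleftrightarrow> (\<forall>s. rel toA U s = 0)"
  by (simp add: ker_seq_def rel_def)

lemma ker_vecs_iff: "u \<in> ker_vecs \<longleftrightarrow> u \<in> carrier_vec n \<and> ker_seq (unroll_vec u)"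
proof -
  have "transpose_mat phiA *\<^sub>v u = 0\<^sub>v n \<longleftrightarrow>
      (\<forall>s<n. (\<Sum>i<n. toA (phi (convert_word w) lam $$ (i, s)) * u $ i) = 0)" if u: "u \<in> carrier_vec n"
  proof -
    have "(transpose_mat phiA *\<^sub>v u) $ s = (\<Sum>i<n. toA (phi (convert_word w) lam $$ (i, s)) * u $ i)" if "s < n" for s
      using that u phi_carrier by (simp add: scalar_prod_def atLeast0LessThan)
    then show ?thesis using phi_carrier by (auto simp: vec_eq_iff)
  qed
  then show ?thesis
    unfolding ker_vecs_def ker_seq_iff_rel unroll_vec_def rel_eq_0_iff[OF ring_map_toA, symmetric] by blast
qed

lemma unroll_vec_add: "u \<in> carrier_vec n \<Longrightarrow> u' \<in> carrier_vec n \<Longrightarrow> unroll_vec (u + u') = (\<lambda>j. unroll_vec u j + unroll_vec u' j)"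
  using tau by (intro ext) (simp add: unroll_vec_def unroll_def distrib_left nat_less_iff)

lemma unroll_vec_smult: "u \<in> carrier_vec n \<Longrightarrow> unroll_vec (a \<cdot>\<^sub>v u) = (\<lambda>j. a * unroll_vec u j)"
  using tau by (intro ext) (simp add: unroll_vec_def unroll_def mult.left_commute nat_less_iff)

lemma ker_seq_linear:
  "ker_seq U \<Longrightarrow> ker_seq U' \<Longrightarrow> ker_seq (\<lambda>j. U j + U' j)" "ker_seq U \<Longrightarrow> ker_seq (\<lambda>j. a * U j)"
  unfolding ker_seq_iff_rel rel_def by (simp_all add: distrib_left add_ac mult.left_commute)

lemma ker_seq_shift: "ker_seq U \<Longrightarrow> ker_seq (\<lambda>j. U (j + int n))"
proof -
  assume U: "ker_seq U"
  have "rel toA (\<lambda>j. U (j + int n * 1)) s = rel toA U (s + int n * 1)" for s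
  proof -
    have "s + int n * 1 - 1 = s - 1 + int n * 1" "s + int n * 1 + 1 = s + 1 + int n * 1" by simp_all
    then show ?thesis unfolding rel_def by (simp only: chi_per chi_pow_per ent_per)
  qed
  then have "rel toA (\<lambda>j. U (j + int n)) s = rel toA U (s + int n)" for s by (simp only: mult_1_right)
  then show ?thesis using U by (simp add: ker_seq_iff_rel)
qed

lemma matches_shift_n: "matches U g \<Longrightarrow> matches (\<lambda>r. U (r + int n)) (\<lambda>r. g (r + int n))"
  by (rule matches_shift[OF _ _ _ _ n_mod]) (simp_all add: ent_shift[of w, unfolded len_w] pos_sign_shift[of w, unfolded len_w]
      after_pos_shift[of w, unfolded len_w] del: of_nat_mult)

lemma matches_diff:
  assumes "matches U g" "matches U' g'"
  shows "matches (\<lambda>r. U r - a * U' r) (\<lambda>r. g r - plane (r + 2) a * g' r)"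
  using matches_add[OF assms(1) matches_smult[OF assms(2), of "- a"]] by simp

text \<open>The difference of \<open>U'\<close> and \<open>a * U\<close> matches 0 and is therefore
  0.\<close>

lemma matches_same:
  assumes "ker_seq U" "ker_seq U'" "matches U g" "matches U' (\<lambda>r. plane (r + 2) a * g r)"
  shows "U' j = a * U j"
proof -
  have "ker_seq (\<lambda>r. U' r - a * U r)"
    using ker_seq_linear(1)[OF assms(2) ker_seq_linear(2)[OF assms(1), of "- a"]] by simp
  moreover have "matches (\<lambda>r. U' r - a * U r) (\<lambda>r. 0)"
    using matches_diff[OF assms(4,3), of a] by simp
  ultimately show ?thesis using matches_0_imp[of "\<lambda>r. U' r - a * U r" j] by simp
qed

text \<open>
The bijection between the dual of M_tilde and the kernel, as a relation. A relation avoids choosing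
the plane functions of a linear form.\<close>

definition corresponds :: "(cusp vec \<Rightarrow> cusp) \<Rightarrow> cusp vec \<Rightarrow> bool" where
  "corresponds h u \<longleftrightarrow> (\<exists>g. (\<forall>j. set_zero (j + 2) (g j) = g j \<and>
     h (plane_gen j) = toA (chi j * chi (j + 1) * g j)) \<and> matches (unroll_vec u) g)"

lemma plane_value_unique:
  assumes "toA (chi j * chi (j + 1) * g) = toA (chi j * chi (j + 1) * g')"
    "set_zero (j + 2) g = g" "set_zero (j + 2) g' = g'"
  shows "g = g'"
  using arg_cong[OF assms(1), of "plane (j + 2)"] assms(2,3) by simp

text \<open>The glued functions yield a sequence on all integers. It comes from a vector because its
  shift by \<open>n\<close> and its multiple by the inverse of \<open>lam\<close> match the same
  functions.\<close>

lemma corresponds_ex_vec: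
  assumes h: "h \<in> dual"
  shows "\<exists>u\<in>ker_vecs. corresponds h u"
proof -
  have data: "gluing_data (\<lambda>j. h (plane_gen j)) (\<lambda>j. h (axis_gen j))" by (rule dual_gluing_data[OF h])
  then obtain g where g: "glued g" "\<And>j. h (plane_gen j) = toA (chi j * chi (j + 1) * g j)"
    using gluing_data_ex_glued by blast
  have fix_g: "set_zero (j + 2) (g j) = g j" for j using g(1) by (simp add: glued_def)
  have per: "g (j + int n) = constS (inverse lam) * g j" for j
  proof (rule plane_value_unique)
    have e: "j + int n = j + int n * 1" "j + int n * 1 + 1 = j + 1 + int n * 1" "j + int n * 1 + 2 = j + 2 + int n * 1" by simp_all
    have c: "chi (j + int n) = chi j" "chi (j + int n + 1) = chi (j + 1)"
      unfolding e by (simp_all only: chi_per)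
    have "h (plane_gen (j + int n)) = toA (constS (inverse lam)) * h (plane_gen j)"
      using gluing_data_shift[OF data, of j 1] by (simp add: twist_simps[OF ring_map_toA])
    then show "toA (chi j * chi (j + 1) * g (j + int n)) = toA (chi j * chi (j + 1) * (constS (inverse lam) * g j))"
      unfolding g(2) c by (simp add: mult_ac)
    have "set_zero (j + int n + 2) = set_zero (j + 2)"
      by (rule set_zero_cong) (simp add: mod_eq_dvd_iff)
    then show "set_zero (j + 2) (g (j + int n)) = g (j + int n)"
      using fix_g[of "j + int n"] by simp
  qed (simp add: fix_g)
  obtain U where U: "ker_seq U" "matches U g" using glued_ex_matches[OF g(1)] by blast
  have "matches (\<lambda>r. U (r + int n)) (\<lambda>r. plane (r + 2) (toA (constS (inverse lam))) * g r)"
    using matches_shift_n[OF U(2)] unfolding per by simp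
  then have U_step: "U (j + int n) = toA (constS (inverse lam)) * U j" for j
    by (rule matches_same[OF U(1) ker_seq_shift[OF U(1)] U(2)])
  have li: "toA (constS lam) * toA (constS (inverse lam)) = 1"
    using lam_nz by (simp add: constS_simps flip: toA_hom(6) constS_simps(3))
  have "U (j - int n) = toA (constS lam) * U j" for j
  proof -
    have "U j = toA (constS (inverse lam)) * U (j - int n)"
      using U_step[of "j - int n"] unfolding diff_add_cancel .
    then have "toA (constS lam) * U j = (toA (constS lam) * toA (constS (inverse lam))) * U (j - int n)"
      by (simp only: mult.assoc)
    then show ?thesis by (simp only: li mult_1_left)
  qed
  then have unroll_U: "unroll toA (\<lambda>i. U (int i + 1)) j = U j" for j
    by (rule unroll_eq[OF ring_map_toA])
  let ?u = "vec n (\<lambda>i. U (int i + 1))"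
  have "unroll_vec ?u = U"
  proof
    fix j
    have "nat ((j - 1) mod int n) < n" using tau by (simp add: nat_less_iff)
    then show "unroll_vec ?u j = U j" using unroll_U[of j] by (simp add: unroll_vec_def unroll_def)
  qed
  then have "?u \<in> ker_vecs" "corresponds h ?u"
    using U g fix_g by (auto simp: ker_vecs_iff corresponds_def)
  then show ?thesis by blast
qed

text \<open>Here quasi-periodicity passes from the sequence to its glued functions, by
  \<open>matches_unique\<close>.\<close>

lemma corresponds_ex_dual:
  assumes u: "u \<in> ker_vecs"
  shows "\<exists>h\<in>dual. corresponds h u"
proof -
  have U: "ker_seq (unroll_vec u)" using u by (simp add: ker_vecs_iff)
  then obtain g where g: "glued g" "matches (unroll_vec u) g" using ker_seq_ex_matches by blast
  have "unroll_vec u (j + int n) = toA (constS (inverse lam)) * unroll_vec u j" for j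
    using unroll_shift[OF ring_map_toA, of "\<lambda>i. u $ i" j 1] by (simp add: unroll_vec_def twist_simps[OF ring_map_toA])
  then have "matches (\<lambda>r. unroll_vec u (r + int n)) (\<lambda>r. plane (r + 2) (toA (constS (inverse lam))) * g r)"
    using matches_smult[OF g(2), of "toA (constS (inverse lam))"] by simp
  then have "(\<lambda>r. g (r + int n)) = (\<lambda>r. plane (r + 2) (toA (constS (inverse lam))) * g r)"
    using matches_unique matches_shift_n[OF g(2)] by blast
  then have per: "g (j + int n) = constS (inverse lam) * g j" for j
    using fun_cong[of _ _ j] by fastforce
  have "g (j - int n) = constS lam * g j" for j
    using per[of "j - int n"] lam_nz by (simp add: constS_simps flip: mult.assoc constS_simps(3))
  then obtain p where p: "gluing_data (\<lambda>j. toA (chi j * chi (j + 1) * g j)) p"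
    using glued_ex_gluing_data[OF g(1)] by blast
  obtain h where "h \<in> dual" "\<And>j. h (plane_gen j) = toA (chi j * chi (j + 1) * g j)"
    using ex_dual[OF p] by blast
  then show ?thesis using g unfolding corresponds_def glued_def by blast
qed

lemma corresponds_unique_vec:
  assumes "corresponds h u" "corresponds h u'" "u \<in> ker_vecs" "u' \<in> ker_vecs"
  shows "u = u'"
proof -
  obtain g where g: "\<And>j. set_zero (j + 2) (g j) = g j" "\<And>j. h (plane_gen j) = toA (chi j * chi (j + 1) * g j)"
    "matches (unroll_vec u) g" using assms(1) unfolding corresponds_def by blast
  obtain g' where g': "\<And>j. set_zero (j + 2) (g' j) = g' j" "\<And>j. h (plane_gen j) = toA (chi j * chi (j + 1) * g' j)"
    "matches (unroll_vec u') g'" using assms(2) unfolding corresponds_def by blast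
  have "g j = g' j" for j
    by (rule plane_value_unique[OF trans[OF g(2)[symmetric] g'(2)] g(1) g'(1)])
  then have "g = g'" by (rule ext)
  then have "unroll_vec u' j = 1 * unroll_vec u j" for j
    using g(3) g'(3) assms(3,4) by (intro matches_same[of "unroll_vec u" "unroll_vec u'" g 1 j]) (simp_all add: ker_vecs_iff)
  then have "u' $ i = u $ i" if "i < n" for i
    using unroll_base[OF ring_map_toA that, of "\<lambda>i. u $ i"] unroll_base[OF ring_map_toA that, of "\<lambda>i. u' $ i"]
    by (simp add: unroll_vec_def)
  then show ?thesis using assms(3,4) by (auto simp: ker_vecs_iff)
qed

lemma corresponds_unique_dual:
  assumes "corresponds h u" "corresponds h' u" "h \<in> dual" "h' \<in> dual"
  shows "h = h'"
proof -
  obtain g where g: "\<And>j. h (plane_gen j) = toA (chi j * chi (j + 1) * g j)" "matches (unroll_vec u) g"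
    using assms(1) unfolding corresponds_def by blast
  obtain g' where g': "\<And>j. h' (plane_gen j) = toA (chi j * chi (j + 1) * g' j)" "matches (unroll_vec u) g'"
    using assms(2) unfolding corresponds_def by blast
  have "g = g'" by (rule matches_unique[OF g(2) g'(2)])
  then show ?thesis using g(1) g'(1) by (intro dual_eqI[OF assms(3,4)]) simp
qed

lemma corresponds_add:
  assumes "corresponds h u" "corresponds h' u'" "u \<in> carrier_vec n" "u' \<in> carrier_vec n"
  shows "corresponds (\<lambda>v\<in>M_vecs. h v + h' v) (u + u')"
proof -
  obtain g where g: "\<And>j. set_zero (j + 2) (g j) = g j" "\<And>j. h (plane_gen j) = toA (chi j * chi (j + 1) * g j)"
    "matches (unroll_vec u) g" using assms(1) unfolding corresponds_def by blast
  obtain g' where g': "\<And>j. set_zero (j + 2) (g' j) = g' j" "\<And>j. h' (plane_gen j) = toA (chi j * chi (j + 1) * g' j)"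
    "matches (unroll_vec u') g'" using assms(2) unfolding corresponds_def by blast
  show ?thesis unfolding corresponds_def
  proof (intro exI[of _ "\<lambda>r. g r + g' r"] conjI allI)
    show "matches (unroll_vec (u + u')) (\<lambda>r. g r + g' r)"
      unfolding unroll_vec_add[OF assms(3,4)] by (rule matches_add[OF g(3) g'(3)])
  qed (simp_all add: g(1,2) g'(1,2) gen_M_vecs distrib_left)
qed

lemma corresponds_smult:
  assumes "corresponds h u" "u \<in> carrier_vec n"
  shows "corresponds (\<lambda>v\<in>M_vecs. a * h v) (a \<cdot>\<^sub>v u)"
proof -
  obtain g where g: "\<And>j. set_zero (j + 2) (g j) = g j" "\<And>j. h (plane_gen j) = toA (chi j * chi (j + 1) * g j)"
    "matches (unroll_vec u) g" using assms(1) unfolding corresponds_def by blast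
  show ?thesis unfolding corresponds_def
  proof (intro exI[of _ "\<lambda>r. plane (r + 2) a * g r"] conjI allI)
    show "matches (unroll_vec (a \<cdot>\<^sub>v u)) (\<lambda>r. plane (r + 2) a * g r)"
      unfolding unroll_vec_smult[OF assms(2)] by (rule matches_smult[OF g(3)])
    fix j
    show "(\<lambda>v\<in>M_vecs. a * h v) (plane_gen j) = toA (chi j * chi (j + 1) * (plane (j + 2) a * g j))"
      \<comment> \<open>The value is supported on the plane where \<open>chi (j + 2)\<close>
        vanishes, so only the restriction of \<open>a\<close> to it counts.\<close>
      by (rule cusp_eqI[of j]) (simp_all add: g(1,2) gen_M_vecs mult_ac)
  qed (simp_all add: g)
qed

end

section \<open>Duality for matrix factorizations\<close>

text \<open>Taking determinants shows \<open>det A\<close> divides a power of \<open>c\<close>.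
  Multiplying \<open>A * B\<close> by the adjugate from the left identifies
  \<open>det A \<cdot>\<^sub>m B\<close>, and cancelling \<open>det A\<close> in the domain gives
  the other product.\<close>

lemma right_inverse_up_to_scalar:
  fixes A B :: "'a::idom mat"
  assumes A: "A \<in> carrier_mat n n" and B: "B \<in> carrier_mat n n" and AB: "A * B = c \<cdot>\<^sub>m 1\<^sub>m n" and c: "c \<noteq> 0"
  shows "det A \<noteq> 0" "det A \<cdot>\<^sub>m B = c \<cdot>\<^sub>m adj_mat A" "B * A = c \<cdot>\<^sub>m 1\<^sub>m n"
proof -
  have "det A * det B = c ^ n"
    using det_mult[OF A B] by (simp add: AB det_smult)
  then show det: "det A \<noteq> 0" using c by auto
  note adj = adj_mat[OF A]
  have "det A \<cdot>\<^sub>m B = (adj_mat A * A) * B"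
    unfolding adj(3) using mult_smult_assoc_mat[OF one_carrier_mat B, of "det A"] B by simp
  also have "(adj_mat A * A) * B = adj_mat A * (A * B)" by (rule assoc_mult_mat[OF adj(1) A B])
  also have "adj_mat A * (A * B) = c \<cdot>\<^sub>m adj_mat A"
    unfolding AB using mult_smult_distrib[OF adj(1) one_carrier_mat, of c] adj(1) by simp
  finally show 1: "det A \<cdot>\<^sub>m B = c \<cdot>\<^sub>m adj_mat A" .
  have "det A \<cdot>\<^sub>m (B * A) = (det A \<cdot>\<^sub>m B) * A" by (rule mult_smult_assoc_mat[OF B A, symmetric])
  also have "(det A \<cdot>\<^sub>m B) * A = c \<cdot>\<^sub>m (det A \<cdot>\<^sub>m 1\<^sub>m n)"
    unfolding 1 using mult_smult_assoc_mat[OF adj(1) A, of c] adj(3) by simp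
  finally have *: "det A \<cdot>\<^sub>m (B * A) = c \<cdot>\<^sub>m (det A \<cdot>\<^sub>m 1\<^sub>m n)" .
  show "B * A = c \<cdot>\<^sub>m 1\<^sub>m n"
  proof (rule eq_matI)
    fix i j assume ij: "i < dim_row (c \<cdot>\<^sub>m 1\<^sub>m n)" "j < dim_col (c \<cdot>\<^sub>m 1\<^sub>m n)"
    then have ij': "i < n" "j < n" by simp_all
    have "det A * (B * A) $$ (i, j) = (det A \<cdot>\<^sub>m (B * A)) $$ (i, j)"
      using ij' A B by (simp only: index_smult_mat index_mult_mat carrier_matD)
    also have "\<dots> = det A * (c \<cdot>\<^sub>m 1\<^sub>m n) $$ (i, j)"
      unfolding * using ij' by simp
    finally show "(B * A) $$ (i, j) = (c \<cdot>\<^sub>m 1\<^sub>m n) $$ (i, j)" using det by simp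
  qed (use A B in auto)
qed

lemma scalar_mult_mat_vec: "v \<in> carrier_vec n \<Longrightarrow> (c \<cdot>\<^sub>m 1\<^sub>m n) *\<^sub>v v = c \<cdot>\<^sub>v v"
  for c :: "'a::comm_ring_1"
  by (rule eq_vecI) auto

lemma mult_mat_smult_vec:
  fixes k :: "'a::comm_ring_1"
  shows "A \<in> carrier_mat nr nc \<Longrightarrow> v \<in> carrier_vec nc \<Longrightarrow> A *\<^sub>v (k \<cdot>\<^sub>v v) = k \<cdot>\<^sub>v (A *\<^sub>v v)"
  by (rule eq_vecI) auto

interpretation toA_hom: comm_ring_hom toA
  by unfold_locales simp_all

lemma vec_lift: "v \<in> carrier_vec n \<Longrightarrow> \<exists>V\<in>carrier_vec n. v = map_vec toA V"
proof -
  assume v: "v \<in> carrier_vec n"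
  have "\<forall>i. \<exists>s. v $ i = toA s" using toA_surj by blast
  from choice[OF this] obtain f where f: "\<forall>i. v $ i = toA (f i)" by blast
  show ?thesis
    by (rule bexI[of _ "vec n f"]) (use v f in auto)
qed

lemma map_vec_toA_eq_0:
  assumes "V \<in> carrier_vec n" "map_vec toA V = 0\<^sub>v n"
  shows "\<exists>C\<in>carrier_vec n. V = (xS * yS * zS) \<cdot>\<^sub>v C"
proof -
  have "\<exists>c. i < n \<longrightarrow> V $ i = xS * yS * zS * c" for i
  proof (cases "i < n")
    case True
    have "toA (V $ i) = 0" using arg_cong[OF assms(2), of "\<lambda>v. v $ i"] assms(1) True by simp
    then show ?thesis by (auto simp: toA_eq_0_iff elim: dvdE)
  qed simp
  then have "\<forall>i. \<exists>c. i < n \<longrightarrow> V $ i = xS * yS * zS * c" by blast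
  from choice[OF this] obtain f where f: "\<forall>i. i < n \<longrightarrow> V $ i = xS * yS * zS * f i" by blast
  show ?thesis by (rule bexI[of _ "vec n f"]) (use assms(1) f in auto)
qed

lemma xyz_nonzero: "xS * yS * zS \<noteq> 0"
  using chi_prod[of 0] by (simp del: mult_eq_0_iff) simp

lemma toA_xyz: "toA (xS * yS * zS) = 0"
  unfolding toA_eq_0_iff by simp

locale matrix_factorization =
  fixes \<phi> \<psi> :: "pser mat" and n :: nat
  assumes \<phi> [simp]: "\<phi> \<in> carrier_mat n n" and \<psi> [simp]: "\<psi> \<in> carrier_mat n n"
    and \<phi>\<psi>: "\<phi> * \<psi> = (xS * yS * zS) \<cdot>\<^sub>m 1\<^sub>m n" and \<psi>\<phi>: "\<psi> * \<phi> = (xS * yS * zS) \<cdot>\<^sub>m 1\<^sub>m n"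
begin

lemma dims [simp]: "dim_row \<phi> = n" "dim_col \<phi> = n" "dim_row \<psi> = n" "dim_col \<psi> = n"
  using \<phi> \<psi> by (auto simp del: \<phi> \<psi>)

abbreviation "\<Phi> \<equiv> map_mat toA \<phi>"
abbreviation "\<Psi> \<equiv> map_mat toA \<psi>"

text \<open>For a lift \<open>V\<close> of \<open>v\<close>, \<open>\<phi> *\<^sub>v V\<close> is
  \<open>xyz\<close> times some \<open>C\<close>. Applying \<open>\<psi>\<close> makes both sides
  multiples of \<open>xyz\<close>, which cancels in S.\<close>

lemma exact:
  assumes v: "v \<in> carrier_vec n" "\<Phi> *\<^sub>v v = 0\<^sub>v n"
  shows "\<exists>c\<in>carrier_vec n. v = \<Psi> *\<^sub>v c"
proof -
  obtain V where V: "V \<in> carrier_vec n" "v = map_vec toA V" using vec_lift[OF v(1)] by blast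
  have "map_vec toA (\<phi> *\<^sub>v V) = 0\<^sub>v n"
    using toA_hom.mult_mat_vec_hom[OF \<phi> V(1)] v(2) V(2) by simp
  then obtain C where C: "C \<in> carrier_vec n" "\<phi> *\<^sub>v V = (xS * yS * zS) \<cdot>\<^sub>v C"
    using map_vec_toA_eq_0[of "\<phi> *\<^sub>v V" n] V(1) by (metis \<phi> mult_mat_vec_carrier)
  have "(xS * yS * zS) \<cdot>\<^sub>v V = (\<psi> * \<phi>) *\<^sub>v V"
    unfolding \<psi>\<phi> using V(1) by (simp add: scalar_mult_mat_vec)
  also have "\<dots> = \<psi> *\<^sub>v ((xS * yS * zS) \<cdot>\<^sub>v C)"
    using assoc_mult_mat_vec[OF \<psi> \<phi> V(1)] C(2) by simp
  also have "\<dots> = (xS * yS * zS) \<cdot>\<^sub>v (\<psi> *\<^sub>v C)"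
    by (rule mult_mat_smult_vec[OF \<psi> C(1)])
  finally have *: "(xS * yS * zS) \<cdot>\<^sub>v V = (xS * yS * zS) \<cdot>\<^sub>v (\<psi> *\<^sub>v C)" .
  have "V = \<psi> *\<^sub>v C"
  proof (rule eq_vecI)
    show "dim_vec V = dim_vec (\<psi> *\<^sub>v C)" using V(1) by simp
    fix i assume "i < dim_vec (\<psi> *\<^sub>v C)"
    then have i: "i < n" by simp
    then have "xS * yS * zS * V $ i = xS * yS * zS * (\<psi> *\<^sub>v C) $ i"
      using arg_cong[OF *, of "\<lambda>v. v $ i"] V(1) by (simp del: index_mult_mat_vec)
    then show "V $ i = (\<psi> *\<^sub>v C) $ i" using xyz_nonzero by (simp only: mult_cancel_left simp_thms)
  qed
  then have "v = \<Psi> *\<^sub>v map_vec toA C"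
    using toA_hom.mult_mat_vec_hom[OF \<psi> C(1)] V(2) by simp
  then show ?thesis using C(1) by auto
qed

lemma Phi_Psi: "b \<in> carrier_vec n \<Longrightarrow> \<Phi> *\<^sub>v (\<Psi> *\<^sub>v b) = 0\<^sub>v n"
proof -
  assume b: "b \<in> carrier_vec n"
  obtain B where B: "B \<in> carrier_vec n" "b = map_vec toA B" using vec_lift[OF b] by blast
  have "\<Phi> *\<^sub>v (\<Psi> *\<^sub>v b) = map_vec toA (\<phi> *\<^sub>v (\<psi> *\<^sub>v B))"
    unfolding B(2) toA_hom.mult_mat_vec_hom[OF \<psi> B(1), symmetric]
    by (rule toA_hom.mult_mat_vec_hom[OF \<phi> mult_mat_vec_carrier[OF \<psi> B(1)], symmetric])
  also have "\<phi> *\<^sub>v (\<psi> *\<^sub>v B) = (xS * yS * zS) \<cdot>\<^sub>v B"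
    using assoc_mult_mat_vec[OF \<phi> \<psi> B(1)] B(1) unfolding \<phi>\<psi> by (simp add: scalar_mult_mat_vec)
  also have "map_vec toA ((xS * yS * zS) \<cdot>\<^sub>v B) = 0\<^sub>v n"
  proof (rule eq_vecI)
    fix i assume "i < dim_vec (0\<^sub>v n :: cusp vec)"
    then show "map_vec toA ((xS * yS * zS) \<cdot>\<^sub>v B) $ i = 0\<^sub>v n $ i"
      using B(1) toA_xyz by (simp del: toA_hom) (simp only: toA_hom(6) toA_xyz mult_zero_left)
  qed (use B in simp)
  finally show ?thesis .
qed

end

lemma matrix_factorization_sym: "matrix_factorization \<phi> \<psi> n \<Longrightarrow> matrix_factorization \<psi> \<phi> n"
  by (simp add: matrix_factorization_def)

lemma matrix_factorization_transpose:
  assumes "matrix_factorization \<phi> \<psi> n"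
  shows "matrix_factorization (transpose_mat \<phi>) (transpose_mat \<psi>) n"
proof -
  interpret matrix_factorization \<phi> \<psi> n by (rule assms)
  have "transpose_mat ((xS * yS * zS) \<cdot>\<^sub>m 1\<^sub>m n) = (xS * yS * zS) \<cdot>\<^sub>m 1\<^sub>m n"
    by (rule eq_matI) auto
  then show ?thesis
    using transpose_mult[OF \<phi> \<psi>] transpose_mult[OF \<psi> \<phi>] by unfold_locales (simp_all add: \<phi>\<psi> \<psi>\<phi>)
qed

context matrix_factorization
begin

definition kerT :: "cusp vec set" where
  "kerT = {u \<in> carrier_vec n. transpose_mat \<Phi> *\<^sub>v u = 0\<^sub>v n}"

lemma mult_scalar_prod:
  "A \<in> carrier_mat n n \<Longrightarrow> x \<in> carrier_vec n \<Longrightarrow> y \<in> carrier_vec n \<Longrightarrow> (A *\<^sub>v x) \<bullet> y = x \<bullet> (transpose_mat A *\<^sub>v y)"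
  for A :: "cusp mat"
  using transpose_vec_mult_scalar[of A n n x y] comm_scalar_prod[of "A *\<^sub>v x" n y]
    comm_scalar_prod[of "transpose_mat A *\<^sub>v y" n x] by simp

lemma transpose_map: "transpose_mat \<Phi> = map_mat toA (transpose_mat \<phi>)" "transpose_mat \<Psi> = map_mat toA (transpose_mat \<psi>)"
  by (rule eq_matI; simp)+

lemma Phi_carrier [simp]: "\<Phi> \<in> carrier_mat n n" "\<Psi> \<in> carrier_mat n n"
  by simp_all

lemma kerT_closed:
  "0\<^sub>v n \<in> kerT" "u \<in> kerT \<Longrightarrow> u' \<in> kerT \<Longrightarrow> u + u' \<in> kerT" "u \<in> kerT \<Longrightarrow> a \<cdot>\<^sub>v u \<in> kerT"
  "b \<in> carrier_vec n \<Longrightarrow> transpose_mat \<Psi> *\<^sub>v b \<in> kerT"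
proof -
  have T: "transpose_mat \<Phi> \<in> carrier_mat n n" by simp
  show "0\<^sub>v n \<in> kerT" unfolding kerT_def by (auto intro!: eq_vecI)
  show "u \<in> kerT \<Longrightarrow> u' \<in> kerT \<Longrightarrow> u + u' \<in> kerT"
    unfolding kerT_def using mult_add_distrib_mat_vec[OF T, of u u'] by auto
  show "u \<in> kerT \<Longrightarrow> a \<cdot>\<^sub>v u \<in> kerT"
    unfolding kerT_def using mult_mat_smult_vec[OF T, of u a] by auto
  interpret T: matrix_factorization "transpose_mat \<phi>" "transpose_mat \<psi>" n
    by (rule matrix_factorization_transpose) unfold_locales
  show "b \<in> carrier_vec n \<Longrightarrow> transpose_mat \<Psi> *\<^sub>v b \<in> kerT"
    unfolding kerT_def using T.Phi_Psi[of b] mult_mat_vec_carrier[of "map_mat toA (transpose_mat \<psi>)" n n b]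
    by (simp add: transpose_map)
qed

lemma kerT_image: "u \<in> kerT \<Longrightarrow> \<exists>b\<in>carrier_vec n. u = transpose_mat \<Psi> *\<^sub>v b"
proof -
  interpret T: matrix_factorization "transpose_mat \<phi>" "transpose_mat \<psi>" n
    by (rule matrix_factorization_transpose) unfold_locales
  show "u \<in> kerT \<Longrightarrow> \<exists>b\<in>carrier_vec n. u = transpose_mat \<Psi> *\<^sub>v b"
    unfolding kerT_def transpose_map using T.exact by blast
qed

lemma image_orthogonal: "c \<in> carrier_vec n \<Longrightarrow> u \<in> kerT \<Longrightarrow> (\<Phi> *\<^sub>v c) \<bullet> u = 0"
  by (subst mult_scalar_prod) (auto simp: kerT_def)

text \<open>The rows of \<open>\<Psi>\<close> lie in \<open>kerT\<close>, so orthogonality means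
  \<open>\<Psi> *\<^sub>v v = 0\<^sub>v n\<close>, and exactness of the swapped factorization
  applies.\<close>

lemma orthogonal_image:
  assumes v: "v \<in> carrier_vec n" and orth: "\<And>u. u \<in> kerT \<Longrightarrow> v \<bullet> u = 0"
  shows "\<exists>c\<in>carrier_vec n. v = \<Phi> *\<^sub>v c"
proof -
  interpret S: matrix_factorization \<psi> \<phi> n
    by (rule matrix_factorization_sym) unfold_locales
  have "\<Psi> *\<^sub>v v = 0\<^sub>v n"
  proof (rule eq_vecI)
    fix i assume "i < dim_vec (0\<^sub>v n :: cusp vec)"
    then have i: "i < n" by simp
    have "(\<Psi> *\<^sub>v v) $ i = (\<Psi> *\<^sub>v v) \<bullet> unit_vec n i"
      using i by (subst scalar_prod_right_unit) simp_all
    also have "\<dots> = v \<bullet> (transpose_mat \<Psi> *\<^sub>v unit_vec n i)"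
      by (rule mult_scalar_prod) (use v in simp_all)
    also have "\<dots> = 0" by (rule orth) (simp add: kerT_closed)
    finally show "(\<Psi> *\<^sub>v v) $ i = 0\<^sub>v n $ i" using i by simp
  qed simp
  then show ?thesis using S.exact[OF v] by blast
qed

lemma functional_on_image:
  assumes add: "\<And>u u'. u \<in> kerT \<Longrightarrow> u' \<in> kerT \<Longrightarrow> G (u + u') = G u + (G u' :: cusp)"
    and smult: "\<And>a u. u \<in> kerT \<Longrightarrow> G (a \<cdot>\<^sub>v u) = a * G u"
    and b: "b \<in> carrier_vec n"
  shows "G (transpose_mat \<Psi> *\<^sub>v b) = vec n (\<lambda>i. G (transpose_mat \<Psi> *\<^sub>v unit_vec n i)) \<bullet> b"
proof -
  let ?T = "transpose_mat \<Psi>"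
  have T: "?T \<in> carrier_mat n n" by simp
  \<comment> \<open>Truncations of \<open>b\<close> allow an induction that adds one coordinate at a
    time.\<close>
  define trunc where "trunc m = vec n (\<lambda>i. if i < m then b $ i else 0)" for m
  have tc: "trunc m \<in> carrier_vec n" for m by (simp add: trunc_def)
  have G0: "G (0\<^sub>v n) = 0"
  proof -
    have "G (0 \<cdot>\<^sub>v 0\<^sub>v n) = 0 * G (0\<^sub>v n)" by (rule smult) (rule kerT_closed)
    moreover have "0 \<cdot>\<^sub>v 0\<^sub>v n = (0\<^sub>v n :: cusp vec)" by (rule eq_vecI) simp_all
    ultimately show ?thesis by simp
  qed
  have "G (?T *\<^sub>v trunc m) = (\<Sum>i<m. b $ i * G (?T *\<^sub>v unit_vec n i))" if "m \<le> n" for m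
    using that
  proof (induction m)
    case 0
    have "?T *\<^sub>v trunc 0 = 0\<^sub>v n" by (rule eq_vecI) (simp_all add: trunc_def scalar_prod_def)
    then show ?case by (simp add: G0)
  next
    case (Suc m)
    have "trunc (Suc m) = trunc m + b $ m \<cdot>\<^sub>v unit_vec n m"
      using Suc.prems by (intro eq_vecI) (auto simp: trunc_def less_Suc_eq)
    then have "?T *\<^sub>v trunc (Suc m) = ?T *\<^sub>v trunc m + b $ m \<cdot>\<^sub>v (?T *\<^sub>v unit_vec n m)"
      using mult_add_distrib_mat_vec[OF T tc, of "b $ m \<cdot>\<^sub>v unit_vec n m"] mult_mat_smult_vec[OF T, of "unit_vec n m" "b $ m"]
      by simp
    then show ?case using Suc by (simp add: add smult kerT_closed tc)
  qed
  from this[of n] have "G (?T *\<^sub>v trunc n) = (\<Sum>i<n. b $ i * G (?T *\<^sub>v unit_vec n i))" by simp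
  moreover have "trunc n = b" using b by (intro eq_vecI) (auto simp: trunc_def)
  ultimately show ?thesis using b by (simp add: scalar_prod_def atLeast0LessThan mult.commute)
qed

text \<open>Pulled back along the transpose of \<open>\<Psi>\<close>, whose image is
  \<open>kerT\<close>, the functional becomes the product with a vector \<open>q\<close>. It
  vanishes on the image of the transpose of \<open>\<Phi>\<close>, so
  \<open>\<Phi> *\<^sub>v q = 0\<^sub>v n\<close>, and exactness writes \<open>q\<close> as
  \<open>\<Psi> *\<^sub>v c\<close>.\<close>

lemma functional_representation:
  assumes add: "\<And>u u'. u \<in> kerT \<Longrightarrow> u' \<in> kerT \<Longrightarrow> G (u + u') = G u + (G u' :: cusp)"
    and smult: "\<And>a u. u \<in> kerT \<Longrightarrow> G (a \<cdot>\<^sub>v u) = a * G u"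
  shows "\<exists>c\<in>carrier_vec n. \<forall>u\<in>kerT. G u = c \<bullet> u"
proof -
  define q where "q = vec n (\<lambda>i. G (transpose_mat \<Psi> *\<^sub>v unit_vec n i))"
  have q: "q \<in> carrier_vec n" by (simp add: q_def)
  have Gq: "G (transpose_mat \<Psi> *\<^sub>v b) = q \<bullet> b" if "b \<in> carrier_vec n" for b
    unfolding q_def by (rule functional_on_image[OF add smult that])
  interpret S: matrix_factorization "transpose_mat \<psi>" "transpose_mat \<phi>" n
    by (rule matrix_factorization_transpose, rule matrix_factorization_sym) unfold_locales
  have "\<Phi> *\<^sub>v q = 0\<^sub>v n"
  proof (rule eq_vecI)
    fix r assume "r < dim_vec (0\<^sub>v n :: cusp vec)"
    then have r: "r < n" by simp
    have "(\<Phi> *\<^sub>v q) $ r = (\<Phi> *\<^sub>v q) \<bullet> unit_vec n r"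
      using r by (subst scalar_prod_right_unit) simp_all
    also have "\<dots> = q \<bullet> (transpose_mat \<Phi> *\<^sub>v unit_vec n r)"
      by (rule mult_scalar_prod) (use q in simp_all)
    also have "\<dots> = G (transpose_mat \<Psi> *\<^sub>v (transpose_mat \<Phi> *\<^sub>v unit_vec n r))"
      by (rule Gq[symmetric], rule mult_mat_vec_carrier[of _ n n]) simp_all
    also have "transpose_mat \<Psi> *\<^sub>v (transpose_mat \<Phi> *\<^sub>v unit_vec n r) = 0\<^sub>v n"
      unfolding transpose_map by (rule S.Phi_Psi) simp
    also have "G (0\<^sub>v n) = q \<bullet> 0\<^sub>v n"
    proof -
      have "transpose_mat \<Psi> *\<^sub>v 0\<^sub>v n = (0\<^sub>v n :: cusp vec)" by (rule eq_vecI) simp_all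
      then show ?thesis using Gq[of "0\<^sub>v n"] by simp
    qed
    finally show "(\<Phi> *\<^sub>v q) $ r = 0\<^sub>v n $ r" using q r by simp
  qed simp
  then obtain c where c: "c \<in> carrier_vec n" "q = \<Psi> *\<^sub>v c" using exact[OF q] by blast
  have "G u = c \<bullet> u" if "u \<in> kerT" for u
  proof -
    obtain b where b: "b \<in> carrier_vec n" "u = transpose_mat \<Psi> *\<^sub>v b" using kerT_image[OF \<open>u \<in> kerT\<close>] by blast
    have "G u = (\<Psi> *\<^sub>v c) \<bullet> b" unfolding b(2) Gq[OF b(1)] c(2) ..
    also have "\<dots> = c \<bullet> u" unfolding b(2) by (rule mult_scalar_prod) (use b c in simp_all)
    finally show ?thesis .
  qed
  then show ?thesis using c(1) by blast
qed

end

section \<open>The double dual\<close>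

locale band_factorization = band_datum +
  fixes \<psi> :: "pser mat"
  assumes psi: "\<psi> \<in> carrier_mat n n" "phi (convert_word w) lam * \<psi> = (xS * yS * zS) \<cdot>\<^sub>m 1\<^sub>m n"
begin

sublocale matrix_factorization "phi (convert_word w) lam" \<psi> n
  using phi_carrier psi right_inverse_up_to_scalar(3)[OF phi_carrier psi xyz_nonzero]
  by unfold_locales

lemma kerT_eq: "kerT = ker_vecs"
  by (simp add: kerT_def ker_vecs_def)

lemma ker_vecs_carrier: "u \<in> ker_vecs \<Longrightarrow> u \<in> carrier_vec n"
  by (simp add: ker_vecs_def)

abbreviation "double_dual \<equiv> carrier (M_module w lam)"

lemma dual_closed:
  "h \<in> dual \<Longrightarrow> h' \<in> dual \<Longrightarrow> (\<lambda>v\<in>M_vecs. h v + h' v) \<in> dual"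
  "h \<in> dual \<Longrightarrow> (\<lambda>v\<in>M_vecs. a * h v) \<in> dual"
  unfolding dual_iff by (auto simp: M_vecs_closed algebra_simps)

lemma double_dual_iff:
  "F \<in> double_dual \<longleftrightarrow> F \<in> extensional dual \<and>
     (\<forall>h\<in>dual. \<forall>h'\<in>dual. F (\<lambda>v\<in>M_vecs. h v + h' v) = F h + F h') \<and>
     (\<forall>a. \<forall>h\<in>dual. F (\<lambda>v\<in>M_vecs. a * h v) = a * F h)"
proof -
  have ops: "add (hom_module class_ring (M_tilde w lam) canonical_module) h h' = (\<lambda>v\<in>M_vecs. h v + h' v)"
    "module.smult (hom_module class_ring (M_tilde w lam) canonical_module) a h = (\<lambda>v\<in>M_vecs. a * h v)" for h h' a
    by (simp_all add: hom_module_def)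
  have "double_dual = module_hom class_ring (hom_module class_ring (M_tilde w lam) canonical_module) canonical_module
      \<inter> extensional dual"
    by (simp add: M_module_def macaulayfication_def hom_module_def)
  then show ?thesis by (auto simp: module_hom_def ops)
qed

lemma M_module_ops:
  "add (M_module w lam) F F' = (\<lambda>h\<in>dual. F h + F' h)"
  "module.smult (M_module w lam) a F = (\<lambda>h\<in>dual. a * F h)"
  by (simp_all add: M_module_def macaulayfication_def hom_module_def)

text \<open>
The vectors that represent a form F on the dual, viewed as a form on the kernel: a coset of the image of phi.\<close>

definition vectors_of :: "((cusp vec \<Rightarrow> cusp) \<Rightarrow> cusp) \<Rightarrow> cusp vec set" where
  "vectors_of F = {v \<in> carrier_vec n. \<forall>h\<in>dual. \<forall>u\<in>ker_vecs. corresponds h u \<longrightarrow> F h = v \<bullet> u}"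

lemma vectors_of_nonempty:
  assumes F: "F \<in> double_dual"
  shows "\<exists>v. v \<in> vectors_of F"
proof -
  \<comment> \<open>The chosen form is the only one, by \<open>corresponds_unique_dual\<close>; this
    makes \<open>H\<close> linear.\<close>
  define H where "H u = (SOME h. h \<in> dual \<and> corresponds h u)" for u
  have H: "H u \<in> dual" "corresponds (H u) u" if "u \<in> ker_vecs" for u
    using someI_ex[of "\<lambda>h. h \<in> dual \<and> corresponds h u"] corresponds_ex_dual[OF that]
    unfolding H_def by blast+
  have H_eq: "H u = h" if "u \<in> ker_vecs" "h \<in> dual" "corresponds h u" for u h
    using corresponds_unique_dual[OF H(2) that(3) H(1) that(2)] that(1) by blast
  have Hadd: "H (u + u') = (\<lambda>v\<in>M_vecs. H u v + H u' v)" if "u \<in> ker_vecs" "u' \<in> ker_vecs" for u u'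
    using that kerT_closed(2)[unfolded kerT_eq]
    by (intro H_eq dual_closed corresponds_add H ker_vecs_carrier) blast+
  have Hsmult: "H (a \<cdot>\<^sub>v u) = (\<lambda>v\<in>M_vecs. a * H u v)" if "u \<in> ker_vecs" for a u
    using that kerT_closed(3)[unfolded kerT_eq]
    by (intro H_eq dual_closed corresponds_smult H ker_vecs_carrier) blast+
  have "\<exists>c\<in>carrier_vec n. \<forall>u\<in>kerT. F (H u) = c \<bullet> u"
  proof (rule functional_representation)
    show "F (H (u + u')) = F (H u) + F (H u')" if "u \<in> kerT" "u' \<in> kerT" for u u'
      using F that H(1) unfolding double_dual_iff kerT_eq by (simp only: Hadd)
    show "F (H (a \<cdot>\<^sub>v u)) = a * F (H u)" if "u \<in> kerT" for a u
      using F that H(1) unfolding double_dual_iff kerT_eq by (simp only: Hsmult)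
  qed
  then obtain c where "c \<in> carrier_vec n" "\<And>u. u \<in> ker_vecs \<Longrightarrow> F (H u) = c \<bullet> u"
    unfolding kerT_eq by blast
  then have "c \<in> vectors_of F" unfolding vectors_of_def using H_eq by blast
  then show ?thesis by blast
qed

definition phi_image :: "cusp vec set" where
  "phi_image = (\<lambda>v. phiA *\<^sub>v v) ` carrier_vec n"

lemma phi_image_carrier: "x \<in> phi_image \<Longrightarrow> x \<in> carrier_vec n"
  unfolding phi_image_def by (auto intro: mult_mat_vec_carrier[of _ n n])

lemma phi_image_iff: "x \<in> phi_image \<longleftrightarrow> x \<in> carrier_vec n \<and> (\<forall>u\<in>ker_vecs. x \<bullet> u = 0)"
  using phi_image_carrier image_orthogonal orthogonal_image[of x] unfolding kerT_eq phi_image_def by blast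

lemma vectors_of_eq:
  assumes "v0 \<in> vectors_of F"
  shows "vectors_of F = {x + v0 |x. x \<in> phi_image}"
proof (intro equalityI subsetI)
  have v0: "v0 \<in> carrier_vec n" using assms by (simp add: vectors_of_def)
  fix v assume v: "v \<in> vectors_of F"
  then have vc: "v \<in> carrier_vec n" by (simp add: vectors_of_def)
  have "(v - v0) \<bullet> u = 0" if u: "u \<in> ker_vecs" for u
  proof -
    obtain h where "h \<in> dual" "corresponds h u" using corresponds_ex_dual[OF u] by blast
    then have "F h = v \<bullet> u" "F h = v0 \<bullet> u" using v assms u unfolding vectors_of_def by blast+
    then show ?thesis using minus_scalar_prod_distrib[OF vc v0 ker_vecs_carrier[OF u]] by simp
  qed
  then have "v - v0 \<in> phi_image" using vc v0 by (simp add: phi_image_iff)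
  moreover have "v = (v - v0) + v0" using vc v0 by (intro eq_vecI) auto
  ultimately show "v \<in> {x + v0 |x. x \<in> phi_image}" by blast
next
  fix v assume "v \<in> {x + v0 |x. x \<in> phi_image}"
  then obtain x where x: "x \<in> phi_image" "v = x + v0" by blast
  have v0: "v0 \<in> carrier_vec n" using assms by (simp add: vectors_of_def)
  have xc: "x \<in> carrier_vec n" by (rule phi_image_carrier[OF x(1)])
  have "F h = v \<bullet> u" if "h \<in> dual" "u \<in> ker_vecs" "corresponds h u" for h u
    using that assms x(1) add_scalar_prod_distrib[OF xc v0 ker_vecs_carrier[OF that(2)]]
    unfolding x(2) vectors_of_def phi_image_iff by auto
  then show "v \<in> vectors_of F" using xc v0 x(2) by (simp add: vectors_of_def)
qed

lemma vectors_of_add: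
  assumes "v \<in> vectors_of F" "v' \<in> vectors_of F'"
  shows "v + v' \<in> vectors_of (\<lambda>h\<in>dual. F h + F' h)"
  using assms add_scalar_prod_distrib[of v n v'] ker_vecs_carrier
  by (auto simp: vectors_of_def)

lemma vectors_of_smult:
  assumes "v \<in> vectors_of F"
  shows "a \<cdot>\<^sub>v v \<in> vectors_of (\<lambda>h\<in>dual. a * F h)"
  using assms ker_vecs_carrier by (auto simp: vectors_of_def)

lemma coker_simps:
  "carrier (coker phiA) = {{x + v |x. x \<in> phi_image} |v. v \<in> carrier_vec n}"
  "add (coker phiA) C C' = {c + c' |c c'. c \<in> C \<and> c' \<in> C'}"
  "module.smult (coker phiA) a C = (\<Union>v\<in>C. {x + a \<cdot>\<^sub>v v |x. x \<in> phi_image})"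
  unfolding coker_def quot_module_def
  by (auto simp: A_RCOSETS_def' a_r_coset_def' set_add_def' module_vec_simps phi_image_def[symmetric])

lemma vectors_of_hom: "vectors_of \<in> module_hom class_ring (M_module w lam) (coker phiA)"
  unfolding module_hom_def
proof (intro CollectI conjI allI impI funcsetI)
  fix F assume F: "F \<in> double_dual"
  then obtain v where v: "v \<in> vectors_of F" using vectors_of_nonempty by blast
  have "v \<in> carrier_vec n" using v by (simp add: vectors_of_def)
  then show "vectors_of F \<in> carrier (coker phiA)"
    unfolding coker_simps vectors_of_eq[OF v] by blast
next
  fix F F' assume "F \<in> double_dual \<and> F' \<in> double_dual"
  then obtain v v' where v: "v \<in> vectors_of F" "v' \<in> vectors_of F'" using vectors_of_nonempty by meson
  have c: "v \<in> carrier_vec n" "v' \<in> carrier_vec n" using v by (simp_all add: vectors_of_def)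
  show "vectors_of (add (M_module w lam) F F') = add (coker phiA) (vectors_of F) (vectors_of F')"
    unfolding M_module_ops coker_simps
  proof (intro equalityI subsetI)
    fix z assume "z \<in> vectors_of (\<lambda>h\<in>dual. F h + F' h)"
    then have "z \<in> {x + (v + v') |x. x \<in> phi_image}"
      by (simp only: vectors_of_eq[OF vectors_of_add[OF v]])
    then obtain x where x: "x \<in> phi_image" "z = x + (v + v')" by blast
    have "z = (x + v) + v'" unfolding x(2) using c phi_image_carrier[OF x(1)] by simp
    moreover have "x + v \<in> vectors_of F"
      unfolding vectors_of_eq[OF v(1)] using x(1) by blast
    ultimately show "z \<in> {c + c' |c c'. c \<in> vectors_of F \<and> c' \<in> vectors_of F'}" using v(2) by blast
  qed (use vectors_of_add in blast)
next
  fix a :: cusp and F assume "a \<in> carrier class_ring \<and> F \<in> double_dual"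
  then obtain v where v: "v \<in> vectors_of F" using vectors_of_nonempty by blast
  show "vectors_of (module.smult (M_module w lam) a F) = module.smult (coker phiA) a (vectors_of F)"
    unfolding M_module_ops coker_simps
  proof (intro equalityI subsetI)
    fix z assume "z \<in> vectors_of (\<lambda>h\<in>dual. a * F h)"
    then have "z \<in> {x + a \<cdot>\<^sub>v v |x. x \<in> phi_image}"
      by (simp only: vectors_of_eq[OF vectors_of_smult[OF v]])
    then show "z \<in> (\<Union>v\<in>vectors_of F. {x + a \<cdot>\<^sub>v v |x. x \<in> phi_image})" using v by blast
  next
    fix z assume "z \<in> (\<Union>v\<in>vectors_of F. {x + a \<cdot>\<^sub>v v |x. x \<in> phi_image})"
    then obtain v' where "v' \<in> vectors_of F" "z \<in> {x + a \<cdot>\<^sub>v v' |x. x \<in> phi_image}" by blast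
    then show "z \<in> vectors_of (\<lambda>h\<in>dual. a * F h)"
      by (simp only: vectors_of_eq[OF vectors_of_smult])
  qed
qed

text \<open>Injective because every linear form on \<open>M_tilde\<close> has a kernel vector, on
  which \<open>v\<close> prescribes the value. Surjective because \<open>v \<bullet> u\<close>
  depends only on the form corresponding to \<open>u\<close>, by
  \<open>corresponds_unique_vec\<close>.\<close>

lemma vectors_of_bij: "bij_betw vectors_of double_dual (carrier (coker phiA))"
  unfolding bij_betw_def
proof
  show "inj_on vectors_of double_dual"
  proof (rule inj_onI)
    fix F F' assume F: "F \<in> double_dual" "F' \<in> double_dual" "vectors_of F = vectors_of F'"
    obtain v where v: "v \<in> vectors_of F" "v \<in> vectors_of F'" using vectors_of_nonempty[OF F(1)] F(3) by blast
    have "F h = F' h" if h: "h \<in> dual" for h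
    proof -
      obtain u where "u \<in> ker_vecs" "corresponds h u" using corresponds_ex_vec[OF h] by blast
      then have "F h = v \<bullet> u" "F' h = v \<bullet> u" using v h unfolding vectors_of_def by blast+
      then show ?thesis by simp
    qed
    moreover have "F \<in> extensional dual" "F' \<in> extensional dual" using F unfolding double_dual_iff by blast+
    ultimately show "F = F'" by (intro extensionalityI)
  qed
  have "C \<in> vectors_of ` double_dual" if C: "C \<in> carrier (coker phiA)" for C
  proof -
    obtain v where v: "v \<in> carrier_vec n" "C = {x + v |x. x \<in> phi_image}"
      using C unfolding coker_simps by blast
    define V where "V h = (SOME u. u \<in> ker_vecs \<and> corresponds h u)" for h
    have V: "V h \<in> ker_vecs" "corresponds h (V h)" if "h \<in> dual" for h
      using someI_ex[of "\<lambda>u. u \<in> ker_vecs \<and> corresponds h u"] corresponds_ex_vec[OF that]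
      unfolding V_def by blast+
    have V_eq: "V h = u" if "h \<in> dual" "u \<in> ker_vecs" "corresponds h u" for u h
      using corresponds_unique_vec[OF V(2) that(3) V(1) that(2)] that(1) by blast
    define F where "F = (\<lambda>h\<in>dual. v \<bullet> V h)"
    have "V (\<lambda>v\<in>M_vecs. h v + h' v) = V h + V h'" if "h \<in> dual" "h' \<in> dual" for h h'
      by (intro V_eq dual_closed corresponds_add V ker_vecs_carrier kerT_closed(2)[unfolded kerT_eq] that)
    moreover have "V (\<lambda>v\<in>M_vecs. a * h v) = a \<cdot>\<^sub>v V h" if "h \<in> dual" for a h
      by (intro V_eq dual_closed corresponds_smult V ker_vecs_carrier kerT_closed(3)[unfolded kerT_eq] that)
    ultimately have "F \<in> double_dual"
      unfolding double_dual_iff using V(1) ker_vecs_carrier v(1)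
      by (auto simp: F_def dual_closed scalar_prod_add_distrib[of _ n])
    moreover have "v \<in> vectors_of F"
      unfolding vectors_of_def using v(1) V_eq by (auto simp: F_def)
    ultimately show ?thesis using vectors_of_eq v(2) by blast
  qed
  moreover have "vectors_of F \<in> carrier (coker phiA)" if "F \<in> double_dual" for F
    by (rule funcset_mem[OF module_hom_closed[OF vectors_of_hom] that])
  ultimately show "vectors_of ` double_dual = carrier (coker phiA)"
    by (intro equalityI subsetI) (erule imageE, simp, simp)
qed

lemma M_module_isomorphic: "module_isomorphic class_ring (M_module w lam) (coker phiA)"
  unfolding module_isomorphic_def using vectors_of_hom vectors_of_bij by blast

end

theorem theorem1p3:
  fixes w :: "int list" and \<tau> :: nat and lam :: complex
  assumes "\<tau> \<ge> 1" and "length w = 3 * \<tau>" and "lam \<noteq> 0"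
    and "\<not> degenerate w lam" and "\<not> periodic_word w"
  shows "let \<phi> = phi (convert_word w) lam in
      (\<exists>\<psi> \<in> carrier_mat (3 * \<tau>) (3 * \<tau>).
          \<phi> * \<psi> = (xS * yS * zS) \<cdot>\<^sub>m 1\<^sub>m (3 * \<tau>) \<and>
          \<psi> * \<phi> = (xS * yS * zS) \<cdot>\<^sub>m 1\<^sub>m (3 * \<tau>) \<and>
          det \<phi> \<noteq> 0 \<and> det \<phi> \<cdot>\<^sub>m \<psi> = (xS * yS * zS) \<cdot>\<^sub>m adj_mat \<phi>) \<and>
      module_isomorphic class_ring (M_module w lam) (coker (map_mat toA \<phi>))"
proof -
  interpret band_datum w \<tau> lam using assms by unfold_locales
  obtain \<psi> where *: "\<psi> \<in> carrier_mat (3 * \<tau>) (3 * \<tau>)"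
    "phi (convert_word w) lam * \<psi> = (xS * yS * zS) \<cdot>\<^sub>m 1\<^sub>m (3 * \<tau>)"
    using ex_psi by blast
  interpret band_factorization w \<tau> lam \<psi> using * by unfold_locales
  show ?thesis
    unfolding Let_def
    using * right_inverse_up_to_scalar[OF phi_carrier * xyz_nonzero] M_module_isomorphic by blast
qed

end
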